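(* Let $d\in\mathbb N$, $s>1/2$ and $\gamma>0$ be fixed. There is a constant $C_{d,s}>0$ such that the following holds. Let $I\subset I_{MZ}\subset\mathbb Z^d$ be hyperbolic cross frequency index sets (with parameter $\gamma$ and radii in $(1,\infty)$) with $|I|\ge3$, let $X_{MZ}=\{x^1,\dots,x^M\}\subset\mathbb T^d$ be a reconstructing rank-1 lattice for $I_{MZ}$ with $M$ points, and let $b>1+\frac1{|I|}$. Draw indices $J=(j_1,\dots,j_n)$, $n=\lceil72|I|\log|I|\rceil$, i.i.d. uniformly from $\{1,\dots,M\}$. Then with probability at least $1-4/|I|$ there is a subfamily $J'$ of $J$ with $|J'|\le\lceil b|I|\rceil$ such that, for $X'=(x^i)_{i\in J'}$, the plain (unweighted) least squares approximation $S_I^{X'}$ is well defined and $$\sup_{\|f\|_{H^s_{\mathrm{mix}}}\le1}\|f-S_I^{X'}f\|_{L_2}^2\le C_{d,s}\Big(\frac b{b-1}\Big)^3\log|I|\,\Big(|I|^{-2s}(\log|I|)^{(d-1)2s}+|I_{MZ}|^{-2s+1}(\log|I_{MZ}|)^{2(d-1)s}\Big).$$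
   Context: $\mathbb T^d\simeq(\mathbb R/\mathbb Z)^d$ with Lebesgue measure, $L_2=L_2(\mathbb T^d)$, $\eta_k(x)=\exp(2\pi\mathrm i\langle k,x\rangle)$, and $\hat f_k$ are the Fourier coefficients of $f$. Sobolev space with dominating mixed smoothness: $H^s_{\mathrm{mix}}=H^s_{\mathrm{mix}}(\mathbb T^d)$, $s>1/2$, is the Hilbert space of (continuous) functions with norm $\|f\|_{H^s_{\mathrm{mix}}}^2=\sum_{k\in\mathbb Z^d}|\hat f_k|^2\prod_{j=1}^d\big(1+(2\pi|k_j|)^{2s}\big)$. For $s\in\mathbb N$ this is the norm of the inner product $\sum_{j\in\{0,s\}^d}\langle D^{(j)}f,D^{(j)}g\rangle_{L_2}$ with $D^{(j)}=\partial^{\|j\|_1}/(\partial x_1^{j_1}\cdots\partial x_d^{j_d})$. Hyperbolic cross with parameter $\gamma>0$ and radius $R\in(1,\infty)$: $\{k\in\mathbb Z^d:\prod_{j=1}^d\max\{1,|k_j|/\gamma\}\le R\}$. A rank-1 lattice with $M$ points and generating vector $z\in\mathbb Z^d$ is $\{\frac1M(iz \bmod M): i=0,\dots,M-1\}\subset\mathbb T^d$ (componentwise mod). It is reconstructing for $I_{MZ}$ if $\frac1M\sum_{i=1}^M\exp(2\pi\mathrm i\langle k-l,x^i\rangle)=\delta_{k,l}$ for all $k,l\in I_{MZ}$. Families $J,J'$ may contain repetitions; a subfamily of $J=(j_1,\dots,j_n)$ is obtained by selecting a subset of the positions $\{1,\dots,n\}$, $|J'|$ is the number of selected positions, and repeated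 points count with multiplicity. Plain least squares: with $L=(\eta_k(x^i))_{i\in J',\,k\in I}$, $S_I^{X'}f=\sum_{k\in I}a_k\eta_k$ with $a=(L^*L)^{-1}L^*(f(x^i))_{i\in J'}$, well defined when $L^*L$ is invertible. $\log$ is the natural logarithm. *)

theory Defs
  imports "HOL-Analysis.Analysis" "HOL-Probability.Product_PMF"
begin

text \<open>
  Functions on the torus \<open>(\<real>/\<int>)\<^sup>d\<close> are rendered as functions on \<open>real ^ 'd\<close>, with \<open>d = CARD('d)\<close>,
  that have period 1 in every coordinate.  Integrals over the torus are integrals over the closed unit
  cube \<open>cbox 0 1\<close>, which differs from the fundamental domain \<open>[0,1)\<^sup>d\<close> by a null set.
\<close>

definition periodic1 :: "(real ^ 'd \<Rightarrow> complex) \<Rightarrow> bool" where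
  "periodic1 f \<longleftrightarrow> (\<forall>x j. f (x + axis j 1) = f x)"

definition eta :: "int ^ 'd \<Rightarrow> real ^ 'd \<Rightarrow> complex" where
  "eta k x = exp (2 * of_real pi * \<i> * of_real (\<Sum>j\<in>UNIV. of_int (k $ j) * x $ j))"

definition fourier_coeff :: "(real ^ 'd \<Rightarrow> complex) \<Rightarrow> int ^ 'd \<Rightarrow> complex" where
  "fourier_coeff f k = (LINT x:cbox 0 1|lborel. f x * cnj (eta k x))"

text \<open>
  Only applied to continuous functions, whose squared modulus is integrable over the cube.
\<close>
definition L2_torus_norm :: "(real ^ 'd \<Rightarrow> complex) \<Rightarrow> real" where
  "L2_torus_norm g = sqrt (LINT x:cbox 0 1|lborel. (cmod (g x))\<^sup>2)"

definition mix_weight :: "real \<Rightarrow> int ^ 'd \<Rightarrow> real" where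
  "mix_weight s k = (\<Prod>j\<in>UNIV. 1 + (2 * pi * \<bar>of_int (k $ j)\<bar>) powr (2 * s))"

definition Hmix :: "real \<Rightarrow> (real ^ 'd \<Rightarrow> complex) set" where
  "Hmix s = {f. continuous_on UNIV f \<and> periodic1 f \<and>
     (\<lambda>k. (cmod (fourier_coeff f k))\<^sup>2 * mix_weight s k) summable_on UNIV}"

definition Hmix_norm :: "real \<Rightarrow> (real ^ 'd \<Rightarrow> complex) \<Rightarrow> real" where
  "Hmix_norm s f = sqrt (\<Sum>\<^sub>\<infinity>k. (cmod (fourier_coeff f k))\<^sup>2 * mix_weight s k)"

definition hyperbolic_cross :: "real \<Rightarrow> real \<Rightarrow> (int ^ 'd) set" where
  "hyperbolic_cross \<gamma> R = {k. (\<Prod>j\<in>UNIV. max 1 (\<bar>of_int (k $ j)\<bar> / \<gamma>)) \<le> R}"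

text \<open>
  The points \<open>x\<^sup>1, \<dots>, x\<^sup>M\<close> of the lattice are \<open>lattice_point M z i\<close> for \<open>i \<in> {1..M}\<close>; the index
  \<open>i = M\<close> gives the same point as \<open>i = 0\<close>.  The points are treated as an indexed family, so they are
  not required to be distinct.
\<close>
definition lattice_point :: "nat \<Rightarrow> int ^ 'd \<Rightarrow> nat \<Rightarrow> real ^ 'd" where
  "lattice_point M z i = (\<chi> j. of_int ((int i * z $ j) mod int M) / of_nat M)"

definition reconstructing_lattice :: "nat \<Rightarrow> int ^ 'd \<Rightarrow> (int ^ 'd) set \<Rightarrow> bool" where
  "reconstructing_lattice M z K \<longleftrightarrow> (\<forall>k\<in>K. \<forall>l\<in>K.
     (\<Sum>i=1..M. eta (k - l) (lattice_point M z i)) / of_nat M = (if k = l then 1 else 0))"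

text \<open>
  Matrices with rows and columns indexed by finite sets are functions of two arguments, of which only
  the values on these index sets matter.
\<close>

definition inverse_matrix_on ::
    "'k set \<Rightarrow> ('k \<Rightarrow> 'k \<Rightarrow> complex) \<Rightarrow> ('k \<Rightarrow> 'k \<Rightarrow> complex) \<Rightarrow> bool" where
  "inverse_matrix_on I A B \<longleftrightarrow> (\<forall>k\<in>I. \<forall>l\<in>I.
     (\<Sum>m\<in>I. A k m * B m l) = (if k = l then 1 else 0) \<and>
     (\<Sum>m\<in>I. B k m * A m l) = (if k = l then 1 else 0))"

definition invertible_matrix_on :: "'k set \<Rightarrow> ('k \<Rightarrow> 'k \<Rightarrow> complex) \<Rightarrow> bool" where
  "invertible_matrix_on I A \<longleftrightarrow> (\<exists>B. inverse_matrix_on I A B)"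

text \<open>
  For finite \<open>I\<close> the inverse is unique on \<open>I \<times> I\<close>; the choice only affects the irrelevant entries.
\<close>
definition matrix_inv_on :: "'k set \<Rightarrow> ('k \<Rightarrow> 'k \<Rightarrow> complex) \<Rightarrow> 'k \<Rightarrow> 'k \<Rightarrow> complex" where
  "matrix_inv_on I A = (SOME B. inverse_matrix_on I A B)"

text \<open>
  Below, \<open>P\<close> is the finite set of selected positions and \<open>y i\<close> is the sampling point at position \<open>i\<close>,
  so that repeated points are counted with multiplicity.
\<close>

definition sampling_matrix :: "('i \<Rightarrow> real ^ 'd) \<Rightarrow> 'i \<Rightarrow> int ^ 'd \<Rightarrow> complex" where
  "sampling_matrix y i k = eta k (y i)"

text \<open>The matrix \<open>L\<^sup>* L\<close>.\<close>
definition gram_matrix :: "'i set \<Rightarrow> ('i \<Rightarrow> real ^ 'd) \<Rightarrow> int ^ 'd \<Rightarrow> int ^ 'd \<Rightarrow> complex" where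
  "gram_matrix P y k l = (\<Sum>i\<in>P. cnj (sampling_matrix y i k) * sampling_matrix y i l)"

definition least_squares_well_defined ::
    "(int ^ 'd) set \<Rightarrow> 'i set \<Rightarrow> ('i \<Rightarrow> real ^ 'd) \<Rightarrow> bool" where
  "least_squares_well_defined I P y \<longleftrightarrow> invertible_matrix_on I (gram_matrix P y)"

definition least_squares_coeff ::
    "(int ^ 'd) set \<Rightarrow> 'i set \<Rightarrow> ('i \<Rightarrow> real ^ 'd) \<Rightarrow> (real ^ 'd \<Rightarrow> complex) \<Rightarrow> int ^ 'd \<Rightarrow> complex" where
  "least_squares_coeff I P y f k =
     (\<Sum>l\<in>I. matrix_inv_on I (gram_matrix P y) k l * (\<Sum>i\<in>P. cnj (sampling_matrix y i l) * f (y i)))"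

definition least_squares ::
    "(int ^ 'd) set \<Rightarrow> 'i set \<Rightarrow> ('i \<Rightarrow> real ^ 'd) \<Rightarrow> (real ^ 'd \<Rightarrow> complex) \<Rightarrow> real ^ 'd \<Rightarrow> complex" where
  "least_squares I P y f x = (\<Sum>k\<in>I. least_squares_coeff I P y f k * eta k x)"

end

theory Submission
  imports Defs
begin

text \<open>
  Why the bound holds.  Write \<open>c\<close> for the Fourier coefficients of \<open>f\<close>, \<open>a\<close> for the coefficients of its
  least squares approximation, \<open>w\<close> for the weights of the mixed Sobolev norm, \<open>m\<close> for the number of
  frequencies in \<open>I\<close> and \<open>K\<close> for the large hyperbolic cross on which the lattice is reconstructing.
  By Parseval the squared error is the sum of \<open>\<bar>c k\<bar>\<^sup>2\<close> over \<open>k \<notin> I\<close> plus the sum of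
  \<open>\<bar>a k - c k\<bar>\<^sup>2\<close> over \<open>k \<in> I\<close>.  On the unit ball the first part is at most the largest \<open>1 / w k\<close>
  outside \<open>I\<close>.  If the exponentials with frequencies in \<open>I\<close> satisfy a lower frame inequality with
  constant \<open>\<Lambda>\<close> at the selected points, the second part is at most \<open>1 / \<Lambda>\<close> times the sum of
  \<open>\<bar>g\<bar>\<^sup>2\<close> over the selected points, where \<open>g\<close> is \<open>f\<close> minus its partial sum over \<open>I\<close>
  (\<open>least_squares_stability\<close>).  That sum can only grow if it is extended to all \<open>n\<close> drawn points, so the
  selection has to preserve a lower frame bound and nothing else.

  The function \<open>g\<close> is split at \<open>K\<close>.  The square of the part with frequencies outside \<open>K\<close> is bounded
  uniformly, by Cauchy-Schwarz, by the sum of \<open>1 / w k\<close> over \<open>k \<notin> K\<close>.  The part with frequencies in \<open>K - I\<close> is governed by the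
  largest eigenvalue of the sum of \<open>v v\<^sup>*\<close> over the drawn points, where \<open>v\<close> has the entries
  \<open>\<eta>\<^sub>k(x) / sqrt (w k)\<close>.  The reconstruction property says precisely that a uniformly random lattice point
  turns the exponentials of \<open>K\<close> into an isotropic random vector, so the expectation of \<open>v v\<^sup>*\<close> is diagonal
  with entries \<open>1 / w k\<close>.  Everything is summarised in \<open>least_squares_error_bound\<close>.

  Probability enters through two matrix Chernoff bounds: with probability at least \<open>1 - 2 / m\<close> the smallest
  eigenvalue for \<open>I\<close> is at least \<open>20 m ln m\<close>, and the largest eigenvalue for \<open>K - I\<close> is at most
  \<open>222 m ln m \<sigma>\<close>, where \<open>\<sigma>\<close> bounds \<open>1 / w k\<close> outside \<open>I\<close>.  As \<open>K\<close> may be arbitrarily large, the second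
  bound must not see the dimension of the matrix; the potential \<open>tr (exp A - 1)\<close> achieves this.
  On the first event \<open>frame_subsampling\<close>, a barrier argument in the style of Batson, Spielman and
  Srivastava, selects at most \<open>\<lceil>b m\<rceil>\<close> distinct positions with \<open>\<Lambda>\<close> of order \<open>(b - 1)\<^sup>2 m\<close>.  Since
  \<open>n\<close> is of order \<open>m ln m\<close>, the quotient \<open>n / \<Lambda>\<close> produces the factor \<open>ln m\<close> and a power of
  \<open>b / (b - 1)\<close>.  Counting lattice points in hyperbolic crosses finally turns the radii into cardinalities
  (\<open>hyperbolic_cross_weight_bounds\<close>).

  Both the Chernoff bounds and the selection only ever add a matrix \<open>v v\<^sup>*\<close> to a Hermitian matrix.  The
  locale \<open>rank_one_spectra\<close> collects the scalar identities that relate the eigenvalues before and after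
  such a step; in it \<open>exp_bound\<close> takes the place of the Golden-Thompson inequality and \<open>resolvent_trace\<close>
  that of the Sherman-Morrison formula.
\<close>

section \<open>Spectral decomposition of Hermitian matrices\<close>

text \<open>
  The row \<open>u r\<close> is the basis vector with label \<open>r\<close>; the index set itself serves as the set of labels.
  Demanding completeness together with orthonormality saves the dimension argument that derives one
  from the other.
\<close>
definition unitary_on :: "'a set \<Rightarrow> ('a \<Rightarrow> 'a \<Rightarrow> complex) \<Rightarrow> bool" where
  "unitary_on I u \<longleftrightarrow>
     (\<forall>r\<in>I. \<forall>s\<in>I. (\<Sum>k\<in>I. u r k * cnj (u s k)) = (if r = s then 1 else 0)) \<and>
     (\<forall>k\<in>I. \<forall>l\<in>I. (\<Sum>r\<in>I. u r k * cnj (u r l)) = (if k = l then 1 else 0))"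

definition spectral_on ::
    "'a set \<Rightarrow> ('a \<Rightarrow> 'a \<Rightarrow> complex) \<Rightarrow> ('a \<Rightarrow> real) \<Rightarrow> ('a \<Rightarrow> 'a \<Rightarrow> complex) \<Rightarrow> bool" where
  "spectral_on I A lam u \<longleftrightarrow> unitary_on I u \<and>
     (\<forall>k\<in>I. \<forall>l\<in>I. A k l = (\<Sum>r\<in>I. of_real (lam r) * u r k * cnj (u r l)))"

definition sesq_form :: "'a set \<Rightarrow> ('a \<Rightarrow> 'a \<Rightarrow> complex) \<Rightarrow> ('a \<Rightarrow> complex) \<Rightarrow> ('a \<Rightarrow> complex) \<Rightarrow> complex" where
  "sesq_form I A x y = (\<Sum>k\<in>I. \<Sum>l\<in>I. cnj (x k) * A k l * y l)"

definition hermitian_on :: "'a set \<Rightarrow> ('a \<Rightarrow> 'a \<Rightarrow> complex) \<Rightarrow> bool" where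
  "hermitian_on I A \<longleftrightarrow> (\<forall>k\<in>I. \<forall>l\<in>I. A l k = cnj (A k l))"

lemma sesq_form_lincomb_right:
  "sesq_form I A x (\<lambda>k. a * y k + b * z k) = a * sesq_form I A x y + b * sesq_form I A x z"
  unfolding sesq_form_def by (simp add: sum_distrib_left sum.distrib algebra_simps)

lemma sesq_form_lincomb_left:
  "sesq_form I A (\<lambda>k. a * y k + b * z k) x = cnj a * sesq_form I A y x + cnj b * sesq_form I A z x"
  unfolding sesq_form_def by (simp add: sum_distrib_left sum.distrib algebra_simps)

lemma sesq_form_hermitian:
  assumes "hermitian_on I A"
  shows "sesq_form I A y x = cnj (sesq_form I A x y)"
proof -
  have herm: "cnj (A k l) = A l k" if "k \<in> I" "l \<in> I" for k l
    using assms that unfolding hermitian_on_def by metis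
  have "sesq_form I A y x = (\<Sum>l\<in>I. \<Sum>k\<in>I. cnj (y k) * A k l * x l)"
    unfolding sesq_form_def by (rule sum.swap)
  also have "\<dots> = (\<Sum>k\<in>I. \<Sum>l\<in>I. cnj (cnj (x k) * A k l * y l))"
  proof (intro sum.cong[OF refl])
    fix k l assume "k \<in> I" "l \<in> I"
    have "cnj (cnj (x k) * A k l * y l) = x k * cnj (A k l) * cnj (y l)"
      by (simp only: complex_cnj_mult complex_cnj_cnj)
    then show "cnj (y l) * A l k * x k = cnj (cnj (x k) * A k l * y l)"
      by (simp only: herm[OF \<open>k \<in> I\<close> \<open>l \<in> I\<close>] mult_ac)
  qed
  also have "\<dots> = cnj (sesq_form I A x y)"
    unfolding sesq_form_def cnj_sum ..
  finally show ?thesis .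
qed

lemma compact_bounded_functions: "compact {f::'a \<Rightarrow> complex. \<forall>x. cmod (f x) \<le> 1}"
proof -
  have "compactin (product_topology (\<lambda>i::'a. euclidean) UNIV) (Pi\<^sub>E UNIV (\<lambda>i::'a. cball (0::complex) 1))"
    unfolding compactin_PiE by simp
  also have "Pi\<^sub>E UNIV (\<lambda>i::'a. cball (0::complex) 1) = {f. \<forall>x. cmod (f x) \<le> 1}"
    by (auto simp: PiE_def Pi_def)
  finally show ?thesis
    by (simp add: euclidean_product_topology)
qed

text \<open>
  The topology is the product topology on functions of two arguments.  The bound on all entries makes the
  set compact by Tychonoff's theorem.  For finite \<open>I\<close> it follows from unitarity on \<open>I \<times> I\<close>, and the
  other entries are irrelevant.
\<close>
lemma compact_unitary:
  "compact {f::'a \<times> 'a \<Rightarrow> complex. (\<forall>x. cmod (f x) \<le> 1) \<and> unitary_on I (curry f)}"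
proof -
  have c: "continuous_on UNIV (\<lambda>f::'a \<times> 'a \<Rightarrow> complex. f x)" for x
    by (rule continuous_on_product_coordinates)
  have 1: "closed {f::'a \<times> 'a \<Rightarrow> complex. (\<Sum>k\<in>I. f (r,k) * cnj (f (s,k))) = z}" for r s z
    by (intro closed_Collect_eq continuous_intros c)
  have 2: "closed {f::'a \<times> 'a \<Rightarrow> complex. (\<Sum>r\<in>I. f (r,k) * cnj (f (r,l))) = z}" for k l z
    by (intro closed_Collect_eq continuous_intros c)
  have "{f::'a \<times> 'a \<Rightarrow> complex. unitary_on I (curry f)} =
      (\<Inter>r\<in>I. \<Inter>s\<in>I. {f. (\<Sum>k\<in>I. f (r,k) * cnj (f (s,k))) = (if r = s then 1 else 0)}) \<inter>
      (\<Inter>k\<in>I. \<Inter>l\<in>I. {f. (\<Sum>r\<in>I. f (r,k) * cnj (f (r,l))) = (if k = l then 1 else 0)})"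
    by (simp add: unitary_on_def set_eq_iff)
  moreover have "closed \<dots>"
    by (intro closed_Int closed_INT ballI 1 2)
  ultimately have "closed {f::'a \<times> 'a \<Rightarrow> complex. unitary_on I (curry f)}"
    by simp
  then have "compact ({f::'a \<times> 'a \<Rightarrow> complex. \<forall>x. cmod (f x) \<le> 1} \<inter> {f. unitary_on I (curry f)})"
    by (intro compact_Int_closed compact_bounded_functions)
  also have "{f::'a \<times> 'a \<Rightarrow> complex. \<forall>x. cmod (f x) \<le> 1} \<inter> {f. unitary_on I (curry f)}
     = {f::'a \<times> 'a \<Rightarrow> complex. (\<forall>x. cmod (f x) \<le> 1) \<and> unitary_on I (curry f)}"
    by auto
  finally show ?thesis .
qed

lemma sum_split_two:
  fixes g :: "'a \<Rightarrow> 'b::comm_monoid_add"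
  assumes "finite I" "p \<in> I" "q \<in> I" "p \<noteq> q"
  shows "(\<Sum>r\<in>I. g r) = g p + g q + (\<Sum>r\<in>I - {p, q}. g r)"
proof -
  have "I = insert p (insert q (I - {p, q}))" using assms by auto
  then have "(\<Sum>r\<in>I. g r) = (\<Sum>r\<in>insert p (insert q (I - {p, q})). g r)" by simp
  also have "\<dots> = g p + g q + (\<Sum>r\<in>I - {p, q}. g r)"
    using assms by (simp add: add.assoc)
  finally show ?thesis .
qed

text \<open>
  A complex Jacobi rotation of the basis vectors \<open>p\<close> and \<open>q\<close>, unitary if
  \<open>\<bar>\<alpha>\<bar>\<^sup>2 + \<bar>\<beta>\<bar>\<^sup>2 = 1\<close>.
\<close>
definition rotate_rows :: "'a \<Rightarrow> 'a \<Rightarrow> complex \<Rightarrow> complex \<Rightarrow> ('a \<Rightarrow> 'a \<Rightarrow> complex) \<Rightarrow> 'a \<Rightarrow> 'a \<Rightarrow> complex" where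
  "rotate_rows p q \<alpha> \<beta> u r = (if r = p then (\<lambda>k. \<alpha> * u p k + \<beta> * u q k)
     else if r = q then (\<lambda>k. - cnj \<beta> * u p k + cnj \<alpha> * u q k) else u r)"

lemma unitary_on_rotate_rows:
  assumes fin: "finite I" and u: "unitary_on I u" and pq: "p \<in> I" "q \<in> I" "p \<noteq> q"
    and norm1: "\<alpha> * cnj \<alpha> + \<beta> * cnj \<beta> = 1"
  shows "unitary_on I (rotate_rows p q \<alpha> \<beta> u)"
proof -
  define ip where "ip x y = (\<Sum>k\<in>I. x k * cnj (y k))" for x y :: "'a \<Rightarrow> complex"
  have ip_left: "ip (\<lambda>k. a * x k + b * y k) z = a * ip x z + b * ip y z" for a b x y z
    unfolding ip_def by (simp add: sum_distrib_left sum.distrib algebra_simps)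
  have ip_right: "ip z (\<lambda>k. a * x k + b * y k) = cnj a * ip z x + cnj b * ip z y" for a b x y z
    unfolding ip_def by (simp add: sum_distrib_left sum.distrib algebra_simps)
  have ip_u: "ip (u r) (u s) = (if r = s then 1 else 0)" if "r \<in> I" "s \<in> I" for r s
    using u that unfolding unitary_on_def ip_def by blast
  have vp: "rotate_rows p q \<alpha> \<beta> u p = (\<lambda>k. \<alpha> * u p k + \<beta> * u q k)"
    and vq: "rotate_rows p q \<alpha> \<beta> u q = (\<lambda>k. (- cnj \<beta>) * u p k + cnj \<alpha> * u q k)"
    using pq by (simp_all add: rotate_rows_def)
  have "ip (rotate_rows p q \<alpha> \<beta> u r) (rotate_rows p q \<alpha> \<beta> u s) = (if r = s then 1 else 0)"
    if "r \<in> I" "s \<in> I" for r s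
  proof -
    have "ip (rotate_rows p q \<alpha> \<beta> u p) (rotate_rows p q \<alpha> \<beta> u p) = 1"
      "ip (rotate_rows p q \<alpha> \<beta> u q) (rotate_rows p q \<alpha> \<beta> u q) = 1"
      "ip (rotate_rows p q \<alpha> \<beta> u p) (rotate_rows p q \<alpha> \<beta> u q) = 0"
      "ip (rotate_rows p q \<alpha> \<beta> u q) (rotate_rows p q \<alpha> \<beta> u p) = 0"
      unfolding vp vq ip_left ip_right using pq norm1 by (simp_all add: ip_u mult.commute add.commute)
    moreover have "ip (rotate_rows p q \<alpha> \<beta> u p) (u r) = 0" "ip (rotate_rows p q \<alpha> \<beta> u q) (u r) = 0"
      "ip (u r) (rotate_rows p q \<alpha> \<beta> u p) = 0" "ip (u r) (rotate_rows p q \<alpha> \<beta> u q) = 0"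
      if "r \<in> I" "r \<noteq> p" "r \<noteq> q" for r
      unfolding vp vq ip_left ip_right using pq that by (simp_all add: ip_u)
    moreover have "rotate_rows p q \<alpha> \<beta> u r = u r" if "r \<noteq> p" "r \<noteq> q" for r
      using that by (simp add: rotate_rows_def)
    ultimately show ?thesis
      using that ip_u pq by (cases "r = p"; cases "r = q"; cases "s = p"; cases "s = q") simp_all
  qed
  moreover have "(\<Sum>r\<in>I. rotate_rows p q \<alpha> \<beta> u r k * cnj (rotate_rows p q \<alpha> \<beta> u r l)) = (if k = l then 1 else 0)"
    if kl: "k \<in> I" "l \<in> I" for k l
  proof -
    let ?v = "rotate_rows p q \<alpha> \<beta> u"
    have "?v p k * cnj (?v p l) + ?v q k * cnj (?v q l)
       = (\<alpha> * u p k + \<beta> * u q k) * cnj (\<alpha> * u p l + \<beta> * u q l)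
        + (- cnj \<beta> * u p k + cnj \<alpha> * u q k) * cnj (- cnj \<beta> * u p l + cnj \<alpha> * u q l)"
      using pq by (simp add: rotate_rows_def)
    also have "\<dots> = (\<alpha> * cnj \<alpha> + \<beta> * cnj \<beta>) * (u p k * cnj (u p l) + u q k * cnj (u q l))"
      by (simp add: algebra_simps)
    finally have two: "?v p k * cnj (?v p l) + ?v q k * cnj (?v q l) = u p k * cnj (u p l) + u q k * cnj (u q l)"
      by (simp add: norm1)
    have "(\<Sum>r\<in>I. ?v r k * cnj (?v r l)) = u p k * cnj (u p l) + u q k * cnj (u q l) + (\<Sum>r\<in>I - {p, q}. ?v r k * cnj (?v r l))"
      by (subst sum_split_two[OF fin pq]) (simp add: two)
    also have "(\<Sum>r\<in>I - {p, q}. ?v r k * cnj (?v r l)) = (\<Sum>r\<in>I - {p, q}. u r k * cnj (u r l))"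
      by (intro sum.cong refl) (simp add: rotate_rows_def)
    also have "u p k * cnj (u p l) + u q k * cnj (u q l) + \<dots> = (\<Sum>r\<in>I. u r k * cnj (u r l))"
      by (subst sum_split_two[OF fin pq]) simp
    also have "\<dots> = (if k = l then 1 else 0)"
      using u kl unfolding unitary_on_def by blast
    finally show ?thesis .
  qed
  ultimately show ?thesis
    unfolding unitary_on_def ip_def by blast
qed

lemma unitary_on_entry_bound:
  assumes "finite I" "unitary_on I u" "r \<in> I" "k \<in> I"
  shows "cmod (u r k) \<le> 1"
proof -
  have "(\<Sum>k\<in>I. u r k * cnj (u r k)) = 1"
    using assms unfolding unitary_on_def by simp
  then have "of_real (\<Sum>k\<in>I. (cmod (u r k))\<^sup>2) = (1::complex)"
    unfolding of_real_sum complex_norm_square by simp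
  then have *: "(\<Sum>k\<in>I. (cmod (u r k))\<^sup>2) = 1"
    using of_real_eq_1_iff by blast
  have "(cmod (u r k))\<^sup>2 \<le> (\<Sum>k\<in>I. (cmod (u r k))\<^sup>2)"
    using assms by (intro member_le_sum) auto
  then show ?thesis
    using * by (simp add: power2_le_iff_abs_le abs_square_le_1)
qed

lemma sesq_form_cong:
  assumes "\<And>k. k \<in> I \<Longrightarrow> x k = x' k" "\<And>k. k \<in> I \<Longrightarrow> y k = y' k"
  shows "sesq_form I A x y = sesq_form I A x' y'"
  unfolding sesq_form_def using assms by (intro sum.cong refl) simp

lemma unitary_on_cong:
  assumes "\<And>r k. r \<in> I \<Longrightarrow> k \<in> I \<Longrightarrow> u r k = u' r k"
  shows "unitary_on I u \<longleftrightarrow> unitary_on I u'"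
proof -
  have 1: "(\<Sum>k\<in>I. u r k * cnj (u s k)) = (\<Sum>k\<in>I. u' r k * cnj (u' s k))" if "r \<in> I" "s \<in> I" for r s
    using assms that by (intro sum.cong refl) simp
  have 2: "(\<Sum>r\<in>I. u r k * cnj (u r l)) = (\<Sum>r\<in>I. u' r k * cnj (u' r l))" if "k \<in> I" "l \<in> I" for k l
    using assms that by (intro sum.cong refl) simp
  show ?thesis
    unfolding unitary_on_def
    by (intro arg_cong2[where f = "(\<and>)"] ball_cong refl) (simp_all only: 1 2)
qed

lemma unitary_on_identity:
  assumes "finite I"
  shows "unitary_on I (\<lambda>r k. if r = k then 1 else 0)"
proof -
  have "(\<Sum>k\<in>I. (if r = k then 1 else 0) * cnj (if s = k then 1 else 0)) = (if r = s then 1 else 0 :: complex)"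
    if "r \<in> I" for r s
  proof -
    have "(\<Sum>k\<in>I. (if r = k then 1 else 0) * cnj (if s = k then 1 else 0)) = (\<Sum>k\<in>I. if k = r then (if r = s then 1 else 0 :: complex) else 0)"
      by (intro sum.cong refl) auto
    then show ?thesis using that assms by (simp add: sum.delta)
  qed
  moreover have "(\<Sum>r\<in>I. (if r = k then 1 else 0) * cnj (if r = l then 1 else 0)) = (if k = l then 1 else 0 :: complex)"
    if "k \<in> I" for k l
  proof -
    have "(\<Sum>r\<in>I. (if r = k then 1 else 0) * cnj (if r = l then 1 else 0)) = (\<Sum>r\<in>I. if r = k then (if k = l then 1 else 0 :: complex) else 0)"
      by (intro sum.cong refl) auto
    then show ?thesis using that assms by (simp add: sum.delta)
  qed
  ultimately show ?thesis
    unfolding unitary_on_def by blast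
qed

text \<open>
  The two squared terms are the diagonal entries, after a rotation by \<open>t\<close>, of the symmetric matrix with
  diagonal \<open>a\<close>, \<open>d\<close> and off-diagonal entry \<open>c\<close>.  Their sum is always \<open>a + d\<close>, so the sum of squares is
  decided by their difference \<open>(a - d) cos 2t + 2c sin 2t\<close>, whose maximum \<open>sqrt ((a - d)\<^sup>2 + 4c\<^sup>2)\<close>
  exceeds \<open>\<bar>a - d\<bar>\<close>.
\<close>
lemma rotation_increases_squares:
  fixes a d c :: real
  assumes "c \<noteq> 0"
  obtains t where "((cos t)\<^sup>2 * a + (sin t)\<^sup>2 * d + 2 * (cos t * sin t) * c)\<^sup>2
    + ((sin t)\<^sup>2 * a + (cos t)\<^sup>2 * d - 2 * (cos t * sin t) * c)\<^sup>2 > a\<^sup>2 + d\<^sup>2"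
proof -
  define \<rho> where "\<rho> = sqrt ((a - d)\<^sup>2 + (2 * c)\<^sup>2)"
  have \<rho>2: "\<rho>\<^sup>2 = (a - d)\<^sup>2 + (2 * c)\<^sup>2" unfolding \<rho>_def by simp
  have "\<rho> > 0" unfolding \<rho>_def using assms by (auto intro: add_nonneg_pos)
  have "((a - d) / \<rho>)\<^sup>2 + (2 * c / \<rho>)\<^sup>2 = 1"
    using \<open>\<rho> > 0\<close> unfolding power_divide add_divide_distrib[symmetric] \<rho>2[symmetric] by simp
  then obtain t' where t': "(a - d) / \<rho> = cos t'" "2 * c / \<rho> = sin t'"
    using sincos_total_2pi by blast
  define t where "t = t' / 2"
  have cs: "cos t' = (cos t)\<^sup>2 - (sin t)\<^sup>2" "sin t' = 2 * (cos t * sin t)"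
    using cos_double[of t] sin_double[of t] by (simp_all add: t_def)
  define w where "w = (a - d) * cos t' + 2 * c * sin t'"
  have "w = ((a - d)\<^sup>2 + (2 * c)\<^sup>2) / \<rho>"
    unfolding w_def t'[symmetric] by (simp add: power2_eq_square add_divide_distrib)
  then have w: "w = \<rho>" using \<open>\<rho> > 0\<close> unfolding \<rho>2[symmetric] by (simp add: power2_eq_square)
  have x2: "(cos t)\<^sup>2 = (1 + cos t') / 2" using cs(1) unfolding sin_squared_eq by simp
  have y2: "(sin t)\<^sup>2 = (1 - cos t') / 2" using cs(1) unfolding cos_squared_eq by simp
  have A: "(cos t)\<^sup>2 * a + (sin t)\<^sup>2 * d + 2 * (cos t * sin t) * c = (a + d) / 2 + w / 2"
    unfolding x2 y2 cs(2)[symmetric] w_def by (simp add: field_simps)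
  have D: "(sin t)\<^sup>2 * a + (cos t)\<^sup>2 * d - 2 * (cos t * sin t) * c = (a + d) / 2 - w / 2"
    unfolding x2 y2 cs(2)[symmetric] w_def by (simp add: field_simps)
  have "((a + d) / 2 + w / 2)\<^sup>2 + ((a + d) / 2 - w / 2)\<^sup>2 = (a + d)\<^sup>2 / 2 + w\<^sup>2 / 2"
    by (simp add: power2_eq_square field_simps)
  also have "\<dots> = (a + d)\<^sup>2 / 2 + ((a - d)\<^sup>2 + (2 * c)\<^sup>2) / 2"
    unfolding w \<rho>2 ..
  also have "\<dots> = a\<^sup>2 + d\<^sup>2 + 2 * c\<^sup>2" by (simp add: power2_eq_square field_simps)
  also have "\<dots> > a\<^sup>2 + d\<^sup>2" using assms by simp
  finally show ?thesis using that[of t] A D by simp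
qed

text \<open>
  This is \<open>A = U B U\<^sup>*\<close> with \<open>B\<close> the matrix of the form of \<open>A\<close> in the basis \<open>u\<close>.
\<close>
lemma unitary_form_expansion:
  assumes fin: "finite I" and u: "unitary_on I u" and kl: "k \<in> I" "l \<in> I"
  shows "A k l = (\<Sum>r\<in>I. \<Sum>s\<in>I. u r k * sesq_form I A (u r) (u s) * cnj (u s l))"
proof -
  have comp: "(\<Sum>r\<in>I. u r k * cnj (u r l)) = (if k = l then 1 else 0)" if "k \<in> I" "l \<in> I" for k l
    using u that unfolding unitary_on_def by blast
  have "(\<Sum>r\<in>I. \<Sum>s\<in>I. u r k * sesq_form I A (u r) (u s) * cnj (u s l))
     = (\<Sum>r\<in>I. \<Sum>s\<in>I. \<Sum>i\<in>I. \<Sum>j\<in>I. u r k * cnj (u r i) * A i j * (u s j * cnj (u s l)))"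
    unfolding sesq_form_def by (simp add: sum_distrib_left sum_distrib_right mult_ac)
  also have "\<dots> = (\<Sum>i\<in>I. \<Sum>j\<in>I. \<Sum>r\<in>I. \<Sum>s\<in>I. u r k * cnj (u r i) * A i j * (u s j * cnj (u s l)))"
  proof -
    have "(\<Sum>r\<in>I. \<Sum>s\<in>I. \<Sum>i\<in>I. \<Sum>j\<in>I. h r s i j) = (\<Sum>i\<in>I. \<Sum>j\<in>I. \<Sum>r\<in>I. \<Sum>s\<in>I. h r s i j)"
      for h :: "'a \<Rightarrow> 'a \<Rightarrow> 'a \<Rightarrow> 'a \<Rightarrow> complex"
    proof -
      have "(\<Sum>r\<in>I. \<Sum>s\<in>I. \<Sum>i\<in>I. \<Sum>j\<in>I. h r s i j) = (\<Sum>r\<in>I. \<Sum>i\<in>I. \<Sum>s\<in>I. \<Sum>j\<in>I. h r s i j)"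
        by (intro sum.cong refl sum.swap)
      also have "\<dots> = (\<Sum>i\<in>I. \<Sum>r\<in>I. \<Sum>j\<in>I. \<Sum>s\<in>I. h r s i j)"
        by (subst sum.swap) (intro sum.cong refl sum.swap)
      also have "\<dots> = (\<Sum>i\<in>I. \<Sum>j\<in>I. \<Sum>r\<in>I. \<Sum>s\<in>I. h r s i j)"
        by (intro sum.cong refl sum.swap)
      finally show ?thesis .
    qed
    then show ?thesis .
  qed
  also have "\<dots> = (\<Sum>i\<in>I. \<Sum>j\<in>I. (\<Sum>r\<in>I. u r k * cnj (u r i)) * A i j * (\<Sum>s\<in>I. u s j * cnj (u s l)))"
    by (simp add: sum_distrib_left sum_distrib_right mult_ac)
  also have "\<dots> = (\<Sum>i\<in>I. \<Sum>j\<in>I. (if k = i then 1 else 0) * A i j * (if j = l then 1 else 0))"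
    using kl comp by (intro sum.cong refl) simp
  also have "\<dots> = A k l"
  proof -
    have "(\<Sum>i\<in>I. \<Sum>j\<in>I. (if k = i then 1 else 0) * A i j * (if j = l then 1 else 0))
        = (\<Sum>i\<in>I. if i = k then (\<Sum>j\<in>I. if j = l then A k l else 0) else 0)"
      by (intro sum.cong refl) (auto intro!: sum.cong sum.neutral)
    then show ?thesis using kl fin by (simp add: sum.delta)
  qed
  finally show ?thesis by simp
qed

text \<open>
  Jacobi's method as a variational principle.  By compactness some orthonormal basis maximises the sum of
  the squared diagonal entries of the matrix in that basis.  If an off-diagonal entry did not vanish, a
  rotation of the two basis vectors would increase the sum; so the maximiser diagonalises the matrix.
\<close>
theorem hermitian_spectral_decomposition:
  assumes fin: "finite I" and herm: "hermitian_on I A"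
  obtains lam u where "spectral_on I A lam u"
proof -
  define K where "K = {f::'a \<times> 'a \<Rightarrow> complex. (\<forall>x. cmod (f x) \<le> 1) \<and> unitary_on I (curry f)}"
  define g where "g f = (\<Sum>r\<in>I. (Re (sesq_form I A (curry f r) (curry f r)))\<^sup>2)" for f :: "'a \<times> 'a \<Rightarrow> complex"
  have "compact K" unfolding K_def by (rule compact_unitary)
  moreover have "(\<lambda>(r,k). if r = k then 1 else 0) \<in> K"
    using unitary_on_identity[OF fin] by (auto simp: K_def curry_def)
  then have "K \<noteq> {}" by blast
  moreover have "continuous_on K g"
  proof -
    have c: "continuous_on K (\<lambda>f::'a \<times> 'a \<Rightarrow> complex. f x)" for x
      by (rule continuous_on_subset[OF continuous_on_product_coordinates]) simp
    show ?thesis unfolding g_def sesq_form_def curry_def by (intro continuous_intros c)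
  qed
  ultimately obtain f where f: "f \<in> K" and max: "\<And>f'. f' \<in> K \<Longrightarrow> g f' \<le> g f"
    using continuous_attains_sup[of K g] by blast
  define u where "u = curry f"
  have u: "unitary_on I u" using f by (simp add: K_def u_def)
  let ?B = "\<lambda>r s. sesq_form I A (u r) (u s)"
  have max': "(\<Sum>r\<in>I. (Re (sesq_form I A (v r) (v r)))\<^sup>2) \<le> (\<Sum>r\<in>I. (Re (?B r r))\<^sup>2)"
    if v: "unitary_on I v" for v
  proof -
    define f' where "f' = (\<lambda>(r,k). if r \<in> I \<and> k \<in> I then v r k else 0)"
    have "unitary_on I (curry f')"
      using v by (subst unitary_on_cong[of I _ v]) (simp_all add: f'_def)
    then have "f' \<in> K"
      using unitary_on_entry_bound[OF fin v] by (auto simp: K_def f'_def)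
    then have "g f' \<le> g f" by (rule max)
    moreover have "g f' = (\<Sum>r\<in>I. (Re (sesq_form I A (v r) (v r)))\<^sup>2)"
      unfolding g_def by (intro sum.cong refl arg_cong[where f = "\<lambda>z. (Re z)\<^sup>2"] sesq_form_cong) (simp_all add: f'_def)
    ultimately show ?thesis by (simp add: g_def u_def)
  qed
  have diag: "?B r r = of_real (Re (?B r r))" for r
    using sesq_form_hermitian[OF herm, of "u r" "u r"] by (simp add: complex_eq_iff)
  have off: "?B p q = 0" if pq: "p \<in> I" "q \<in> I" "p \<noteq> q" for p q
  proof (rule ccontr)
    assume ne: "?B p q \<noteq> 0"
    define c where "c = cmod (?B p q)"
    have "c \<noteq> 0" using ne by (simp add: c_def)
    obtain t where t: "((cos t)\<^sup>2 * Re (?B p p) + (sin t)\<^sup>2 * Re (?B q q) + 2 * (cos t * sin t) * c)\<^sup>2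
      + ((sin t)\<^sup>2 * Re (?B p p) + (cos t)\<^sup>2 * Re (?B q q) - 2 * (cos t * sin t) * c)\<^sup>2 > (Re (?B p p))\<^sup>2 + (Re (?B q q))\<^sup>2"
      using rotation_increases_squares[OF \<open>c \<noteq> 0\<close>] by blast
    (* The phase \<omega> turns the off-diagonal entry into the positive number c. *)
    define \<omega> where "\<omega> = cnj (?B p q) / of_real c"
    have cc: "?B p q * cnj (?B p q) = of_real c * of_real c"
      unfolding c_def complex_norm_square[symmetric] by (simp add: power2_eq_square)
    have \<omega>1: "\<omega> * cnj \<omega> = 1"
      using \<open>c \<noteq> 0\<close> cc by (simp add: \<omega>_def power2_eq_square mult.commute)
    have \<omega>B: "\<omega> * ?B p q = of_real c"
      using \<open>c \<noteq> 0\<close> cc by (simp add: \<omega>_def power2_eq_square mult.commute)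
    define v where "v = rotate_rows p q (of_real (cos t)) (of_real (sin t) * \<omega>) u"
    have "of_real (cos t) * cnj (of_real (cos t)) + (of_real (sin t) * \<omega>) * cnj (of_real (sin t) * \<omega>)
        = of_real ((cos t)\<^sup>2) + of_real ((sin t)\<^sup>2) * (\<omega> * cnj \<omega>)"
      by (simp add: power2_eq_square mult_ac)
    also have "\<dots> = 1" unfolding \<omega>1 mult_1_right of_real_add[symmetric] by simp
    finally have v: "unitary_on I v"
      unfolding v_def by (intro unitary_on_rotate_rows fin u pq)
    have Bqp: "?B q p = cnj (?B p q)" by (rule sesq_form_hermitian[OF herm])
    have \<omega>B': "cnj \<omega> * ?B q p = of_real c"
      unfolding Bqp using arg_cong[OF \<omega>B, of cnj] by simp
    have "v p = (\<lambda>k. of_real (cos t) * u p k + (of_real (sin t) * \<omega>) * u q k)"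
      using pq by (simp add: v_def rotate_rows_def)
    then have "sesq_form I A (v p) (v p) = of_real ((cos t)\<^sup>2) * ?B p p + of_real ((sin t)\<^sup>2) * (\<omega> * cnj \<omega>) * ?B q q
        + of_real (cos t * sin t) * (\<omega> * ?B p q) + of_real (cos t * sin t) * (cnj \<omega> * ?B q p)"
      by (simp only: sesq_form_lincomb_left sesq_form_lincomb_right) (simp add: algebra_simps power2_eq_square)
    then have vp: "Re (sesq_form I A (v p) (v p)) = (cos t)\<^sup>2 * Re (?B p p) + (sin t)\<^sup>2 * Re (?B q q) + 2 * (cos t * sin t) * c"
      unfolding \<omega>1 \<omega>B \<omega>B' by (simp del: of_real_power)
    have "v q = (\<lambda>k. (- cnj (of_real (sin t) * \<omega>)) * u p k + cnj (of_real (cos t)) * u q k)"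
      using pq by (simp add: v_def rotate_rows_def)
    then have "sesq_form I A (v q) (v q) = of_real ((sin t)\<^sup>2) * (\<omega> * cnj \<omega>) * ?B p p + of_real ((cos t)\<^sup>2) * ?B q q
        - of_real (cos t * sin t) * (\<omega> * ?B p q) - of_real (cos t * sin t) * (cnj \<omega> * ?B q p)"
      by (simp only: sesq_form_lincomb_left sesq_form_lincomb_right) (simp add: algebra_simps power2_eq_square)
    then have vq: "Re (sesq_form I A (v q) (v q)) = (sin t)\<^sup>2 * Re (?B p p) + (cos t)\<^sup>2 * Re (?B q q) - 2 * (cos t * sin t) * c"
      unfolding \<omega>1 \<omega>B \<omega>B' by (simp del: of_real_power)
    have "(\<Sum>r\<in>I. (Re (sesq_form I A (v r) (v r)))\<^sup>2) = (Re (sesq_form I A (v p) (v p)))\<^sup>2 + (Re (sesq_form I A (v q) (v q)))\<^sup>2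
        + (\<Sum>r\<in>I - {p, q}. (Re (sesq_form I A (v r) (v r)))\<^sup>2)"
      by (rule sum_split_two[OF fin pq])
    also have "(\<Sum>r\<in>I - {p, q}. (Re (sesq_form I A (v r) (v r)))\<^sup>2) = (\<Sum>r\<in>I - {p, q}. (Re (?B r r))\<^sup>2)"
      by (intro sum.cong refl) (simp add: v_def rotate_rows_def)
    finally have "(\<Sum>r\<in>I. (Re (sesq_form I A (v r) (v r)))\<^sup>2) > (\<Sum>r\<in>I. (Re (?B r r))\<^sup>2)"
      using t unfolding vp vq sum_split_two[OF fin pq, of "\<lambda>r. (Re (?B r r))\<^sup>2"] by linarith
    then show False using max'[OF v] by simp
  qed
  have "A k l = (\<Sum>r\<in>I. of_real (Re (?B r r)) * u r k * cnj (u r l))" if kl: "k \<in> I" "l \<in> I" for k l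
  proof -
    have "A k l = (\<Sum>r\<in>I. \<Sum>s\<in>I. u r k * ?B r s * cnj (u s l))"
      by (rule unitary_form_expansion[OF fin u kl])
    also have "\<dots> = (\<Sum>r\<in>I. \<Sum>s\<in>I. if s = r then u r k * ?B r r * cnj (u r l) else 0)"
      using off by (intro sum.cong refl) auto
    also have "\<dots> = (\<Sum>r\<in>I. u r k * ?B r r * cnj (u r l))"
      using fin by (simp add: sum.delta)
    also have "\<dots> = (\<Sum>r\<in>I. of_real (Re (?B r r)) * u r k * cnj (u r l))"
      by (subst diag) (simp add: mult_ac)
    finally show ?thesis .
  qed
  then have "spectral_on I A (\<lambda>r. Re (?B r r)) u"
    using u by (simp add: spectral_on_def)
  then show ?thesis by (rule that)
qed

text \<open>
  The coordinates of \<open>x\<close> in the orthonormal basis \<open>u\<close>.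
\<close>
definition coord :: "'a set \<Rightarrow> ('a \<Rightarrow> 'a \<Rightarrow> complex) \<Rightarrow> ('a \<Rightarrow> complex) \<Rightarrow> 'a \<Rightarrow> complex" where
  "coord I u x r = (\<Sum>k\<in>I. cnj (u r k) * x k)"

lemma unitary_on_rows:
  "unitary_on I u \<Longrightarrow> r \<in> I \<Longrightarrow> s \<in> I \<Longrightarrow> (\<Sum>k\<in>I. u r k * cnj (u s k)) = (if r = s then 1 else 0)"
  unfolding unitary_on_def by blast

lemma unitary_on_cols:
  "unitary_on I u \<Longrightarrow> k \<in> I \<Longrightarrow> l \<in> I \<Longrightarrow> (\<Sum>r\<in>I. u r k * cnj (u r l)) = (if k = l then 1 else 0)"
  unfolding unitary_on_def by blast

lemma coord_expansion:
  assumes "finite I" "unitary_on I u" "k \<in> I"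
  shows "x k = (\<Sum>r\<in>I. coord I u x r * u r k)"
proof -
  have "(\<Sum>r\<in>I. coord I u x r * u r k) = (\<Sum>r\<in>I. \<Sum>l\<in>I. x l * (u r k * cnj (u r l)))"
    unfolding coord_def sum_distrib_right by (simp only: mult_ac)
  also have "\<dots> = (\<Sum>l\<in>I. x l * (\<Sum>r\<in>I. u r k * cnj (u r l)))"
    by (subst sum.swap) (simp add: sum_distrib_left)
  also have "\<dots> = (\<Sum>l\<in>I. if l = k then x l else 0)"
    by (intro sum.cong refl) (simp add: unitary_on_cols[OF assms(2,3)])
  also have "\<dots> = x k" using assms by (simp add: sum.delta)
  finally show ?thesis by simp
qed

lemma coord_inner:
  assumes "finite I" "unitary_on I u"
  shows "(\<Sum>r\<in>I. coord I u x r * cnj (coord I u y r)) = (\<Sum>k\<in>I. x k * cnj (y k))"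
proof -
  have "(\<Sum>k\<in>I. x k * cnj (y k)) = (\<Sum>k\<in>I. (\<Sum>r\<in>I. coord I u x r * u r k) * cnj (y k))"
    by (intro sum.cong refl) (simp add: coord_expansion[OF assms, symmetric])
  also have "\<dots> = (\<Sum>k\<in>I. \<Sum>r\<in>I. coord I u x r * (u r k * cnj (y k)))"
    unfolding sum_distrib_right by (simp only: mult.assoc)
  also have "\<dots> = (\<Sum>r\<in>I. \<Sum>k\<in>I. coord I u x r * (u r k * cnj (y k)))"
    by (rule sum.swap)
  also have "\<dots> = (\<Sum>r\<in>I. coord I u x r * cnj (coord I u y r))"
    unfolding coord_def[of I u y] by (simp add: sum_distrib_left)
  finally show ?thesis by simp
qed

lemma coord_parseval:
  assumes "finite I" "unitary_on I u"
  shows "(\<Sum>r\<in>I. (cmod (coord I u x r))\<^sup>2) = (\<Sum>k\<in>I. (cmod (x k))\<^sup>2)"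
proof -
  have "complex_of_real (\<Sum>r\<in>I. (cmod (coord I u x r))\<^sup>2) = of_real (\<Sum>k\<in>I. (cmod (x k))\<^sup>2)"
    unfolding of_real_sum complex_norm_square by (rule coord_inner[OF assms])
  then show ?thesis using of_real_eq_iff by blast
qed

lemma spectral_on_unitary: "spectral_on I A lam u \<Longrightarrow> unitary_on I u"
  by (simp add: spectral_on_def)

lemma spectral_form:
  assumes "finite I" "spectral_on I A lam u"
  shows "sesq_form I A x y = (\<Sum>r\<in>I. of_real (lam r) * coord I u y r * cnj (coord I u x r))"
proof -
  have "sesq_form I A x y = (\<Sum>k\<in>I. \<Sum>l\<in>I. \<Sum>r\<in>I. of_real (lam r) * (cnj (u r l) * y l) * (u r k * cnj (x k)))"
    unfolding sesq_form_def
  proof (intro sum.cong refl)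
    fix k l assume kl: "k \<in> I" "l \<in> I"
    then have "A k l = (\<Sum>r\<in>I. of_real (lam r) * u r k * cnj (u r l))"
      using assms by (simp add: spectral_on_def)
    then show "cnj (x k) * A k l * y l = (\<Sum>r\<in>I. of_real (lam r) * (cnj (u r l) * y l) * (u r k * cnj (x k)))"
      by (simp add: sum_distrib_left sum_distrib_right mult_ac)
  qed
  also have "\<dots> = (\<Sum>k\<in>I. \<Sum>r\<in>I. \<Sum>l\<in>I. of_real (lam r) * (cnj (u r l) * y l) * (u r k * cnj (x k)))"
    by (intro sum.cong refl sum.swap)
  also have "\<dots> = (\<Sum>r\<in>I. \<Sum>k\<in>I. \<Sum>l\<in>I. of_real (lam r) * (cnj (u r l) * y l) * (u r k * cnj (x k)))"
    by (rule sum.swap)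
  also have "\<dots> = (\<Sum>r\<in>I. \<Sum>k\<in>I. (\<Sum>l\<in>I. of_real (lam r) * (cnj (u r l) * y l)) * (u r k * cnj (x k)))"
    by (simp only: sum_distrib_right)
  also have "\<dots> = (\<Sum>r\<in>I. (\<Sum>l\<in>I. of_real (lam r) * (cnj (u r l) * y l)) * (\<Sum>k\<in>I. u r k * cnj (x k)))"
    by (simp only: sum_distrib_left)
  also have "\<dots> = (\<Sum>r\<in>I. of_real (lam r) * coord I u y r * cnj (coord I u x r))"
    unfolding coord_def by (simp add: sum_distrib_left)
  finally show ?thesis .
qed

lemma spectral_quadratic_form:
  assumes "finite I" "spectral_on I A lam u"
  shows "sesq_form I A x x = of_real (\<Sum>r\<in>I. lam r * (cmod (coord I u x r))\<^sup>2)"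
  unfolding spectral_form[OF assms] of_real_sum of_real_mult complex_norm_square
  by (simp only: mult.assoc)

lemma coord_basis_vector:
  assumes "unitary_on I u" "r \<in> I" "s \<in> I"
  shows "coord I u (u s) r = (if r = s then 1 else 0)"
  using unitary_on_rows[OF assms(1,3,2)] unfolding coord_def by (simp add: mult.commute)

lemma spectral_eigenvalue:
  assumes "finite I" "spectral_on I A lam u" "r \<in> I"
  shows "sesq_form I A (u r) (u r) = of_real (lam r)"
proof -
  have "(\<Sum>s\<in>I. lam s * (cmod (coord I u (u r) s))\<^sup>2) = (\<Sum>s\<in>I. if s = r then lam s else 0)"
    using coord_basis_vector[OF spectral_on_unitary[OF assms(2)] _ assms(3)]
    by (intro sum.cong refl) simp
  also have "\<dots> = lam r" using assms by (simp add: sum.delta)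
  finally show ?thesis unfolding spectral_quadratic_form[OF assms(1,2)] by simp
qed

lemma spectral_basis_norm:
  assumes "unitary_on I u" "r \<in> I"
  shows "(\<Sum>k\<in>I. (cmod (u r k))\<^sup>2) = 1"
proof -
  have "complex_of_real (\<Sum>k\<in>I. (cmod (u r k))\<^sup>2) = 1"
    unfolding of_real_sum complex_norm_square using unitary_on_rows[OF assms(1,2,2)] by simp
  then show ?thesis using of_real_eq_1_iff by blast
qed

section \<open>Rank-one perturbations\<close>

text \<open>
  Chebyshev's sum inequality for similarly ordered \<open>f\<close> and \<open>g\<close>: expand the nonnegative double sum of
  \<open>a r a s (f r - f s) (g r - g s)\<close>.
\<close>
lemma chebyshev_weighted:
  fixes f g a :: "'a \<Rightarrow> real"
  assumes "finite I" "\<And>r. r \<in> I \<Longrightarrow> a r \<ge> 0"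
    and mono: "\<And>r s. r \<in> I \<Longrightarrow> s \<in> I \<Longrightarrow> (f r - f s) * (g r - g s) \<ge> 0"
  shows "(\<Sum>r\<in>I. a r * f r) * (\<Sum>r\<in>I. a r * g r) \<le> (\<Sum>r\<in>I. a r) * (\<Sum>r\<in>I. a r * (f r * g r))"
proof -
  have "0 \<le> (\<Sum>r\<in>I. \<Sum>s\<in>I. a r * a s * ((f r - f s) * (g r - g s)))"
    using assms by (intro sum_nonneg mult_nonneg_nonneg[OF mult_nonneg_nonneg] mono) auto
  also have "\<dots> = (\<Sum>r\<in>I. \<Sum>s\<in>I. a s * (a r * (f r * g r))) + (\<Sum>r\<in>I. \<Sum>s\<in>I. a r * (a s * (f s * g s)))
      - (\<Sum>r\<in>I. \<Sum>s\<in>I. (a r * f r) * (a s * g s)) - (\<Sum>r\<in>I. \<Sum>s\<in>I. (a s * f s) * (a r * g r))"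
    unfolding sum.distrib[symmetric] sum_subtractf[symmetric]
    by (intro sum.cong refl) (simp add: algebra_simps)
  also have "(\<Sum>r\<in>I. \<Sum>s\<in>I. a s * (a r * (f r * g r))) = (\<Sum>r\<in>I. \<Sum>s\<in>I. a r * (a s * (f s * g s)))"
    by (rule sum.swap)
  also have "(\<Sum>r\<in>I. \<Sum>s\<in>I. (a s * f s) * (a r * g r)) = (\<Sum>r\<in>I. \<Sum>s\<in>I. (a r * f r) * (a s * g s))"
    by (rule sum.swap)
  also have "(\<Sum>r\<in>I. \<Sum>s\<in>I. (a r * f r) * (a s * g s)) = (\<Sum>r\<in>I. a r * f r) * (\<Sum>r\<in>I. a r * g r)"
    by (rule sum_product[symmetric])
  also have "(\<Sum>r\<in>I. \<Sum>s\<in>I. a r * (a s * (f s * g s))) = (\<Sum>r\<in>I. a r) * (\<Sum>r\<in>I. a r * (f r * g r))"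
    by (rule sum_product[symmetric])
  finally show ?thesis by simp
qed

text \<open>
  The scalar shadow of passing from a Hermitian matrix \<open>A\<close> with eigenvalues \<open>lam\<close> and eigenvectors \<open>u r\<close>
  to \<open>A + v v\<^sup>*\<close> with eigenvalues \<open>mu\<close> and eigenvectors \<open>w s\<close>.  Here \<open>P r s\<close> is the squared modulus of
  the overlap \<open>\<langle>w s, u r\<rangle>\<close>, while \<open>a r\<close> and \<open>b s\<close> are the squared moduli of \<open>\<langle>v, u r\<rangle>\<close> and \<open>\<langle>v, w s\<rangle>\<close>,
  and \<open>T r s\<close> is the real part of the product of the overlap with
  \<open>\<langle>u r, v\<rangle>\<close> and \<open>\<langle>v, w s\<rangle>\<close>.  Evaluating \<open>\<langle>(A + v v\<^sup>*) (w s), u r\<rangle>\<close> in two ways gives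
  \<open>(mu s - lam r) \<langle>w s, u r\<rangle> = \<langle>v, u r\<rangle> \<langle>w s, v\<rangle>\<close>, of which the two gap identities are the
  products with the conjugate overlap and with \<open>\<langle>u r, v\<rangle> \<langle>v, w s\<rangle>\<close>.  Every statement about traces and
  quadratic forms at \<open>v\<close> that is needed below is a consequence of these real identities, which are
  moreover invariant under shifts of the spectrum and under exchanging the two matrices up to sign.
\<close>
locale rank_one_spectra =
  fixes I :: "'a set" and lam mu a b :: "'a \<Rightarrow> real" and P T :: "'a \<Rightarrow> 'a \<Rightarrow> real"
  assumes fin: "finite I"
    and P_nonneg: "r \<in> I \<Longrightarrow> s \<in> I \<Longrightarrow> P r s \<ge> 0"
    and a_nonneg: "r \<in> I \<Longrightarrow> a r \<ge> 0"
    and b_nonneg: "s \<in> I \<Longrightarrow> b s \<ge> 0"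
    and P_row: "r \<in> I \<Longrightarrow> (\<Sum>s\<in>I. P r s) = 1"
    and P_col: "s \<in> I \<Longrightarrow> (\<Sum>r\<in>I. P r s) = 1"
    and T_row: "r \<in> I \<Longrightarrow> (\<Sum>s\<in>I. T r s) = a r"
    and T_col: "s \<in> I \<Longrightarrow> (\<Sum>r\<in>I. T r s) = b s"
    and gap_P: "r \<in> I \<Longrightarrow> s \<in> I \<Longrightarrow> (mu s - lam r) * P r s = T r s"
    and gap_T: "r \<in> I \<Longrightarrow> s \<in> I \<Longrightarrow> (mu s - lam r) * T r s = a r * b s"
begin

lemma sum_mu: "(\<Sum>s\<in>I. f (mu s)) = (\<Sum>r\<in>I. \<Sum>s\<in>I. P r s * f (mu s))"
proof -
  have "(\<Sum>r\<in>I. \<Sum>s\<in>I. P r s * f (mu s)) = (\<Sum>s\<in>I. (\<Sum>r\<in>I. P r s) * f (mu s))"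
    by (subst sum.swap) (simp add: sum_distrib_right)
  also have "\<dots> = (\<Sum>s\<in>I. f (mu s))"
    by (intro sum.cong refl) (simp add: P_col)
  finally show ?thesis by simp
qed

lemma sum_lam: "(\<Sum>r\<in>I. f (lam r)) = (\<Sum>r\<in>I. \<Sum>s\<in>I. P r s * f (lam r))"
  by (intro sum.cong refl) (simp add: P_row flip: sum_distrib_right)

lemma sum_b: "(\<Sum>s\<in>I. b s * f s) = (\<Sum>r\<in>I. \<Sum>s\<in>I. T r s * f s)"
proof -
  have "(\<Sum>r\<in>I. \<Sum>s\<in>I. T r s * f s) = (\<Sum>s\<in>I. (\<Sum>r\<in>I. T r s) * f s)"
    by (subst sum.swap) (simp add: sum_distrib_right)
  also have "\<dots> = (\<Sum>s\<in>I. b s * f s)"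
    by (intro sum.cong refl) (simp add: T_col)
  finally show ?thesis by simp
qed

lemma sum_a: "(\<Sum>r\<in>I. a r * f r) = (\<Sum>r\<in>I. \<Sum>s\<in>I. T r s * f r)"
  by (intro sum.cong refl) (simp add: T_row flip: sum_distrib_right)

lemma sum_a_eq_sum_b: "(\<Sum>r\<in>I. a r) = (\<Sum>s\<in>I. b s)"
  using sum_a[of "\<lambda>_. 1"] sum_b[of "\<lambda>_. 1"] by simp

text \<open>
  Klein's inequality \<open>tr f(B) \<le> tr f(A) + tr (f'(B) (B - A))\<close> for convex \<open>f\<close>, specialised to
  \<open>B - A = v v\<^sup>*\<close>.  Averaging the scalar tangent inequality with the doubly stochastic \<open>P\<close> proves it.
\<close>
lemma klein_inequality:
  assumes "\<And>x y. f y - f x \<le> f' y * (y - x)"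
  shows "(\<Sum>s\<in>I. f (mu s)) \<le> (\<Sum>r\<in>I. f (lam r)) + (\<Sum>s\<in>I. b s * f' (mu s))"
proof -
  have "(\<Sum>s\<in>I. f (mu s)) - (\<Sum>r\<in>I. f (lam r)) = (\<Sum>r\<in>I. \<Sum>s\<in>I. P r s * (f (mu s) - f (lam r)))"
    by (subst sum_mu, subst sum_lam) (simp add: sum_subtractf algebra_simps)
  also have "\<dots> \<le> (\<Sum>r\<in>I. \<Sum>s\<in>I. P r s * (f' (mu s) * (mu s - lam r)))"
    using assms P_nonneg by (intro sum_mono mult_left_mono) auto
  also have "\<dots> = (\<Sum>r\<in>I. \<Sum>s\<in>I. T r s * f' (mu s))"
    by (intro sum.cong refl) (simp add: gap_P[symmetric])
  also have "\<dots> = (\<Sum>s\<in>I. b s * f' (mu s))" by (rule sum_b[symmetric])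
  finally show ?thesis by simp
qed

text \<open>
  The expansion of \<open>\<langle>(A + v v\<^sup>*)\<^sup>p v, v\<rangle>\<close> by the first occurrence of \<open>v v\<^sup>*\<close> in each word.  In scalar form
  it comes from factoring \<open>mu s ^ p - lam r ^ p\<close>.
\<close>
lemma moment_recursion:
  "(\<Sum>s\<in>I. b s * mu s ^ p) = (\<Sum>r\<in>I. a r * lam r ^ p)
     + (\<Sum>i<p. (\<Sum>r\<in>I. a r * lam r ^ (p - Suc i)) * (\<Sum>s\<in>I. b s * mu s ^ i))"
proof -
  have "(\<Sum>s\<in>I. b s * mu s ^ p) - (\<Sum>r\<in>I. a r * lam r ^ p) = (\<Sum>r\<in>I. \<Sum>s\<in>I. T r s * (mu s ^ p - lam r ^ p))"
    by (subst sum_b, subst sum_a) (simp add: sum_subtractf algebra_simps)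
  also have "\<dots> = (\<Sum>r\<in>I. \<Sum>s\<in>I. \<Sum>i<p. (a r * lam r ^ (p - Suc i)) * (b s * mu s ^ i))"
  proof (intro sum.cong refl)
    fix r s assume rs: "r \<in> I" "s \<in> I"
    have "T r s * (mu s ^ p - lam r ^ p) = ((mu s - lam r) * T r s) * (\<Sum>i<p. lam r ^ (p - Suc i) * mu s ^ i)"
      by (subst power_diff_sumr2) (simp only: mult_ac)
    also have "\<dots> = (\<Sum>i<p. (a r * lam r ^ (p - Suc i)) * (b s * mu s ^ i))"
      unfolding gap_T[OF rs] sum_distrib_left by (intro sum.cong refl) (simp only: mult_ac)
    finally show "T r s * (mu s ^ p - lam r ^ p) = (\<Sum>i<p. (a r * lam r ^ (p - Suc i)) * (b s * mu s ^ i))" .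
  qed
  also have "\<dots> = (\<Sum>r\<in>I. \<Sum>i<p. \<Sum>s\<in>I. (a r * lam r ^ (p - Suc i)) * (b s * mu s ^ i))"
    by (intro sum.cong refl sum.swap)
  also have "\<dots> = (\<Sum>i<p. \<Sum>r\<in>I. \<Sum>s\<in>I. (a r * lam r ^ (p - Suc i)) * (b s * mu s ^ i))"
    by (rule sum.swap)
  also have "\<dots> = (\<Sum>i<p. (\<Sum>r\<in>I. a r * lam r ^ (p - Suc i)) * (\<Sum>s\<in>I. b s * mu s ^ i))"
    by (simp only: sum_product)
  finally show ?thesis by simp
qed

text \<open>
  At the vector \<open>v\<close> the rank-one matrix \<open>v v\<^sup>*\<close> may be replaced by the multiple \<open>\<kappa>\<close> of the identity, where
  \<open>\<kappa>\<close> is the squared norm of \<open>v\<close>.  Each product of two moments in the recursion is at most \<open>\<kappa>\<close> times a joint moment by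
  Chebyshev, because all powers are increasing on the nonnegative spectrum, and the joint moments
  telescope.
\<close>
lemma moment_bound:
  assumes lam: "\<And>r. r \<in> I \<Longrightarrow> lam r \<ge> 0"
  defines "\<kappa> \<equiv> (\<Sum>r\<in>I. a r)"
  shows "(\<Sum>s\<in>I. b s * mu s ^ p) \<le> (\<Sum>r\<in>I. a r * (lam r + \<kappa>) ^ p)"
proof (induction p rule: less_induct)
  case (less p)
  have \<kappa>: "\<kappa> \<ge> 0" unfolding \<kappa>_def by (intro sum_nonneg a_nonneg)
  have "(\<Sum>s\<in>I. b s * mu s ^ p) \<le> (\<Sum>r\<in>I. a r * lam r ^ p)
     + (\<Sum>i<p. (\<Sum>r\<in>I. a r * lam r ^ (p - Suc i)) * (\<Sum>r\<in>I. a r * (lam r + \<kappa>) ^ i))"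
    unfolding moment_recursion[of p]
  proof (rule add_left_mono, rule sum_mono, rule mult_left_mono)
    show "(\<Sum>s\<in>I. b s * mu s ^ i) \<le> (\<Sum>r\<in>I. a r * (lam r + \<kappa>) ^ i)" if "i \<in> {..<p}" for i
      using less that by simp
    show "0 \<le> (\<Sum>r\<in>I. a r * lam r ^ (p - Suc i))" for i
      using lam a_nonneg by (intro sum_nonneg mult_nonneg_nonneg zero_le_power)
  qed
  also have "\<dots> \<le> (\<Sum>r\<in>I. a r * lam r ^ p)
     + (\<Sum>i<p. \<kappa> * (\<Sum>r\<in>I. a r * (lam r ^ (p - Suc i) * (lam r + \<kappa>) ^ i)))"
    unfolding \<kappa>_def
  proof (intro add_left_mono sum_mono chebyshev_weighted fin a_nonneg)
    fix i r s assume rs: "r \<in> I" "s \<in> I"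
    have "lam r ^ j \<le> lam s ^ j \<and> (lam r + x) ^ j \<le> (lam s + x) ^ j" if "lam r \<le> lam s" "r \<in> I" "x \<ge> 0" for r s j x
      using that lam[of r] by (intro conjI power_mono) auto
    then have mono: "lam r ^ j \<le> lam s ^ j" "(lam r + \<kappa>) ^ j \<le> (lam s + \<kappa>) ^ j" if "lam r \<le> lam s" "r \<in> I" for r s j
      using that \<kappa> by auto
    show "0 \<le> (lam r ^ (p - Suc i) - lam s ^ (p - Suc i)) * ((lam r + sum a I) ^ i - (lam s + sum a I) ^ i)"
    proof (cases "lam r \<le> lam s")
      case True
      then show ?thesis using mono[OF True \<open>r \<in> I\<close>] unfolding \<kappa>_def by (intro mult_nonpos_nonpos) auto
    next
      case False
      then have "lam s \<le> lam r" by simp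
      then show ?thesis using mono[OF _ \<open>s \<in> I\<close>] unfolding \<kappa>_def by (intro mult_nonneg_nonneg) auto
    qed
  qed
  also have "(\<Sum>i<p. \<kappa> * (\<Sum>r\<in>I. a r * (lam r ^ (p - Suc i) * (lam r + \<kappa>) ^ i)))
      = (\<Sum>i<p. \<Sum>r\<in>I. a r * (\<kappa> * (lam r ^ (p - Suc i) * (lam r + \<kappa>) ^ i)))"
    by (simp add: sum_distrib_left mult_ac)
  also have "\<dots> = (\<Sum>r\<in>I. \<Sum>i<p. a r * (\<kappa> * (lam r ^ (p - Suc i) * (lam r + \<kappa>) ^ i)))"
    by (rule sum.swap)
  also have "\<dots> = (\<Sum>r\<in>I. a r * ((lam r + \<kappa>) ^ p - lam r ^ p))"
    by (intro sum.cong refl) (simp add: power_diff_sumr2 sum_distrib_left)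
  finally show ?case by (simp add: algebra_simps sum_subtractf)
qed

text \<open>
  Sum the moment bound over the exponential series.
\<close>
lemma exp_bound_nonneg:
  assumes lam: "\<And>r. r \<in> I \<Longrightarrow> lam r \<ge> 0"
  shows "(\<Sum>s\<in>I. b s * exp (mu s)) \<le> exp (\<Sum>r\<in>I. a r) * (\<Sum>r\<in>I. a r * exp (lam r))"
proof -
  let ?\<kappa> = "\<Sum>r\<in>I. a r"
  have e: "(\<lambda>n. c * (x ^ n / fact n)) sums (c * exp x)" for c x :: real
    using sums_mult[OF exp_converges[of x], of c] by (simp add: divide_inverse mult_ac)
  have "(\<Sum>s\<in>I. b s * exp (mu s)) \<le> (\<Sum>r\<in>I. a r * exp (lam r + ?\<kappa>))"
  proof (rule sums_le)
    show "(\<lambda>n. \<Sum>s\<in>I. b s * (mu s ^ n / fact n)) sums (\<Sum>s\<in>I. b s * exp (mu s))"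
      by (intro sums_sum e)
    show "(\<lambda>n. \<Sum>r\<in>I. a r * ((lam r + ?\<kappa>) ^ n / fact n)) sums (\<Sum>r\<in>I. a r * exp (lam r + ?\<kappa>))"
      by (intro sums_sum e)
    show "(\<Sum>s\<in>I. b s * (mu s ^ n / fact n)) \<le> (\<Sum>r\<in>I. a r * ((lam r + ?\<kappa>) ^ n / fact n))" for n
    proof -
      have "(\<Sum>s\<in>I. b s * (mu s ^ n / fact n)) = (\<Sum>s\<in>I. b s * mu s ^ n) / fact n"
        by (simp add: sum_divide_distrib)
      also have "\<dots> \<le> (\<Sum>r\<in>I. a r * (lam r + ?\<kappa>) ^ n) / fact n"
        by (intro divide_right_mono moment_bound lam) simp_all
      finally show ?thesis by (simp add: sum_divide_distrib)
    qed
  qed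
  also have "\<dots> = exp ?\<kappa> * (\<Sum>r\<in>I. a r * exp (lam r))"
    by (simp add: exp_add sum_distrib_left mult_ac)
  finally show ?thesis .
qed

lemma rank_one_spectra_shift: "rank_one_spectra I (\<lambda>r. lam r + c) (\<lambda>s. mu s + c) a b P T"
  using fin P_nonneg a_nonneg b_nonneg P_row P_col T_row T_col gap_P gap_T
  by unfold_locales auto

lemma rank_one_spectra_reverse:
  "rank_one_spectra I (\<lambda>s. - mu s) (\<lambda>r. - lam r) b a (\<lambda>s r. P r s) (\<lambda>s r. T r s)"
proof unfold_locales
  show "(- lam r - - mu s) * P r s = T r s" if "s \<in> I" "r \<in> I" for r s
    using gap_P[of r s] that by (simp add: algebra_simps)
  show "(- lam r - - mu s) * T r s = b s * a r" if "s \<in> I" "r \<in> I" for r s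
    using gap_T[of r s] that by (simp add: algebra_simps)
qed (use fin P_nonneg a_nonneg b_nonneg P_row P_col T_row T_col in auto)

text \<open>
  For a rank-one update this replaces the Golden-Thompson inequality.  The spectrum may be arbitrary,
  since shifting it multiplies both sides by the same factor.
\<close>
lemma exp_bound:
  "(\<Sum>s\<in>I. b s * exp (mu s)) \<le> exp (\<Sum>r\<in>I. a r) * (\<Sum>r\<in>I. a r * exp (lam r))"
proof -
  define c where "c = (\<Sum>r\<in>I. \<bar>lam r\<bar>)"
  have c: "lam r + c \<ge> 0" if "r \<in> I" for r
  proof -
    have "\<bar>lam r\<bar> \<le> c" unfolding c_def using that fin by (intro member_le_sum) auto
    then show ?thesis by linarith
  qed
  interpret sh: rank_one_spectra I "\<lambda>r. lam r + c" "\<lambda>s. mu s + c" a b P T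
    by (rule rank_one_spectra_shift)
  have "exp c * (\<Sum>s\<in>I. b s * exp (mu s)) \<le> exp c * (exp (\<Sum>r\<in>I. a r) * (\<Sum>r\<in>I. a r * exp (lam r)))"
    using sh.exp_bound_nonneg[OF c] by (simp add: exp_add sum_distrib_left mult_ac)
  then show ?thesis by simp
qed

text \<open>
  The same inequality for the matrices \<open>- A - v v\<^sup>*\<close> and \<open>- A\<close>, which again differ by \<open>v v\<^sup>*\<close>.
\<close>
lemma exp_minus_bound:
  "(\<Sum>r\<in>I. a r * exp (- lam r)) \<le> exp (\<Sum>r\<in>I. a r) * (\<Sum>s\<in>I. b s * exp (- mu s))"
  using rank_one_spectra.exp_bound[OF rank_one_spectra_reverse] unfolding sum_a_eq_sum_b .

lemma mu_eq:
  assumes "s \<in> I"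
  shows "mu s = (\<Sum>r\<in>I. P r s * lam r) + b s"
proof -
  have "b s = (\<Sum>r\<in>I. (mu s - lam r) * P r s)"
    unfolding T_col[OF assms, symmetric] using assms by (intro sum.cong refl) (simp add: gap_P)
  also have "\<dots> = mu s * (\<Sum>r\<in>I. P r s) - (\<Sum>r\<in>I. P r s * lam r)"
    by (simp add: sum_subtractf sum_distrib_left algebra_simps)
  finally show ?thesis using P_col[OF assms] by simp
qed

text \<open>
  Each \<open>mu s\<close> is a convex combination of the \<open>lam r\<close> plus the nonnegative \<open>b s\<close>.
\<close>
lemma mu_greater:
  assumes "\<And>r. r \<in> I \<Longrightarrow> lam r > z" "s \<in> I"
  shows "mu s > z"
proof -
  have "0 < (\<Sum>r\<in>I. P r s * (lam r - z))"
  proof -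
    have "\<exists>r\<in>I. P r s > 0"
    proof (rule ccontr)
      assume "\<not> (\<exists>r\<in>I. P r s > 0)"
      then have "P r s = 0" if "r \<in> I" for r
        using that P_nonneg[OF that assms(2)] by (auto simp: not_less intro: antisym)
      then have "(\<Sum>r\<in>I. P r s) = 0" by simp
      then show False using P_col[OF assms(2)] by simp
    qed
    then obtain r where r: "r \<in> I" "P r s > 0" by blast
    then have "0 < P r s * (lam r - z)" using assms by simp
    also have "\<dots> \<le> (\<Sum>r\<in>I. P r s * (lam r - z))"
      using r fin assms P_nonneg by (intro member_le_sum mult_nonneg_nonneg) (auto simp: less_imp_le)
    finally show ?thesis .
  qed
  also have "\<dots> = (\<Sum>r\<in>I. P r s * lam r) - z * (\<Sum>r\<in>I. P r s)"
    by (simp add: sum_subtractf sum_distrib_left algebra_simps)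
  finally show ?thesis using mu_eq[OF assms(2)] P_col[OF assms(2)] b_nonneg[OF assms(2)] by simp
qed

text \<open>
  The trace of the Sherman-Morrison formula: \<open>p\<close> and \<open>q\<close> are the quadratic forms at \<open>v\<close> of the
  resolvent of \<open>A\<close> at \<open>z\<close> and of its square.  The key is that the resolvent of \<open>A + v v\<^sup>*\<close> maps \<open>v\<close> to
  \<open>1 / (1 + p)\<close> times what the resolvent of \<open>A\<close> maps it to.
\<close>
lemma resolvent_trace:
  assumes z: "\<And>r. r \<in> I \<Longrightarrow> lam r > z"
  defines "p \<equiv> (\<Sum>r\<in>I. a r / (lam r - z))" and "q \<equiv> (\<Sum>r\<in>I. a r / (lam r - z)\<^sup>2)"
  shows "(\<Sum>s\<in>I. 1 / (mu s - z)) = (\<Sum>r\<in>I. 1 / (lam r - z)) - q / (1 + p)"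
proof -
  (* p' is p for the updated matrix; 1 - p' turns out to be 1 / (1 + p). *)
  define p' where "p' = (\<Sum>s\<in>I. b s / (mu s - z))"
  have mu: "mu s > z" if "s \<in> I" for s using mu_greater[OF z that] by blast
  have p0: "p \<ge> 0" unfolding p_def using z a_nonneg by (intro sum_nonneg divide_nonneg_pos) auto
  have t: "(\<Sum>s\<in>I. T r s / (mu s - z)) = a r * (1 - p') / (lam r - z)" if r: "r \<in> I" for r
  proof -
    have "(lam r - z) * (\<Sum>s\<in>I. T r s / (mu s - z)) = (\<Sum>s\<in>I. T r s - a r * (b s / (mu s - z)))"
      unfolding sum_distrib_left
    proof (intro sum.cong refl)
      fix s assume s: "s \<in> I"
      have "(lam r - z) * (T r s / (mu s - z)) = ((mu s - z) * T r s - (mu s - lam r) * T r s) / (mu s - z)"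
        by (simp add: algebra_simps)
      also have "\<dots> = T r s - a r * (b s / (mu s - z))"
        unfolding gap_T[OF r s] using mu[OF s] by (simp add: diff_divide_distrib)
      finally show "(lam r - z) * (T r s / (mu s - z)) = T r s - a r * (b s / (mu s - z))" .
    qed
    also have "\<dots> = a r * (1 - p')"
      unfolding sum_subtractf T_row[OF r] p'_def by (simp add: sum_distrib_left algebra_simps)
    finally show ?thesis using z[OF r] by (simp add: field_simps)
  qed
  have "p' = (\<Sum>r\<in>I. \<Sum>s\<in>I. T r s / (mu s - z))"
    unfolding p'_def using sum_b[of "\<lambda>s. 1 / (mu s - z)"] by simp
  also have "\<dots> = (1 - p') * p"
    unfolding p_def sum_distrib_left by (intro sum.cong refl) (simp add: t)
  finally have "p' = (1 - p') * p" .
  then have p': "1 - p' = 1 / (1 + p)" using p0 by (simp add: field_simps)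
  have "(\<Sum>r\<in>I. 1 / (lam r - z)) - (\<Sum>s\<in>I. 1 / (mu s - z)) = (\<Sum>r\<in>I. \<Sum>s\<in>I. P r s * (1 / (lam r - z) - 1 / (mu s - z)))"
    unfolding sum_mu[of "\<lambda>x. 1 / (x - z)"] sum_lam[of "\<lambda>x. 1 / (x - z)"]
    by (simp add: sum_subtractf algebra_simps)
  also have "\<dots> = (\<Sum>r\<in>I. \<Sum>s\<in>I. (T r s / (mu s - z)) / (lam r - z))"
  proof (intro sum.cong refl)
    fix r s assume rs: "r \<in> I" "s \<in> I"
    show "P r s * (1 / (lam r - z) - 1 / (mu s - z)) = (T r s / (mu s - z)) / (lam r - z)"
      unfolding gap_P[OF rs, symmetric] using mu[OF rs(2)] z[OF rs(1)] by (simp add: field_simps)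
  qed
  also have "\<dots> = (\<Sum>r\<in>I. a r * (1 - p') / (lam r - z) / (lam r - z))"
    by (intro sum.cong refl) (simp only: sum_divide_distrib[symmetric] t)
  also have "\<dots> = (1 - p') * q"
    unfolding q_def sum_distrib_left by (intro sum.cong refl) (simp add: power2_eq_square)
  finally show ?thesis unfolding p' by simp
qed

end

lemma spectral_perturbation:
  assumes fin: "finite I" and A: "spectral_on I A lam u" and A': "spectral_on I A' mu w"
    and upd: "\<And>k l. k \<in> I \<Longrightarrow> l \<in> I \<Longrightarrow> A' k l = A k l + v k * cnj (v l)"
  shows "rank_one_spectra I lam mu (\<lambda>r. (cmod (coord I u v r))\<^sup>2) (\<lambda>s. (cmod (coord I w v s))\<^sup>2)
     (\<lambda>r s. (cmod (coord I u (w s) r))\<^sup>2)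
     (\<lambda>r s. Re (coord I u (w s) r * cnj (coord I u v r) * coord I w v s))"
proof -
  have u: "unitary_on I u" and w: "unitary_on I w" using A A' by (simp_all add: spectral_on_def)
  define ov where "ov r s = coord I u (w s) r" for r s
  define \<alpha> where "\<alpha> r = coord I u v r" for r
  define \<beta> where "\<beta> s = coord I w v s" for s
  have cov: "cnj (ov r s) = coord I w (u r) s" for r s
    unfolding ov_def coord_def by (simp add: mult.commute)
  have row: "(\<Sum>s\<in>I. (cmod (ov r s))\<^sup>2) = 1" if "r \<in> I" for r
    using coord_parseval[OF fin w, of "u r"] spectral_basis_norm[OF u that]
    unfolding cov[symmetric] by simp
  have col: "(\<Sum>r\<in>I. (cmod (ov r s))\<^sup>2) = 1" if "s \<in> I" for s
    using coord_parseval[OF fin u, of "w s"] spectral_basis_norm[OF w that]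
    unfolding ov_def by simp
  have \<alpha>: "(\<Sum>s\<in>I. ov r s * \<beta> s) = \<alpha> r" if "r \<in> I" for r
  proof -
    have "(\<Sum>s\<in>I. coord I w v s * cnj (coord I w (u r) s)) = (\<Sum>k\<in>I. v k * cnj (u r k))"
      by (rule coord_inner[OF fin w])
    then show ?thesis unfolding \<beta>_def \<alpha>_def cov[symmetric] coord_def[of I u v]
      by (simp add: mult.commute)
  qed
  have \<beta>: "(\<Sum>r\<in>I. ov r s * cnj (\<alpha> r)) = cnj (\<beta> s)" if "s \<in> I" for s
  proof -
    have "(\<Sum>r\<in>I. coord I u (w s) r * cnj (coord I u v r)) = (\<Sum>k\<in>I. w s k * cnj (v k))"
      by (rule coord_inner[OF fin u])
    then show ?thesis unfolding ov_def \<alpha>_def \<beta>_def coord_def[of I w v] by simp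
  qed
  have form_upd: "sesq_form I A' x y = sesq_form I A x y + (\<Sum>k\<in>I. cnj (x k) * v k) * (\<Sum>l\<in>I. cnj (v l) * y l)" for x y
  proof -
    have "sesq_form I A' x y = (\<Sum>k\<in>I. \<Sum>l\<in>I. cnj (x k) * A k l * y l + (cnj (x k) * v k) * (cnj (v l) * y l))"
      unfolding sesq_form_def by (intro sum.cong refl) (simp add: upd algebra_simps)
    then show ?thesis unfolding sesq_form_def sum.distrib by (simp add: sum_product)
  qed
  have gap: "of_real (mu s - lam r) * ov r s = \<alpha> r * cnj (\<beta> s)" if r: "r \<in> I" and s: "s \<in> I" for r s
  proof -
    have 1: "sesq_form I A' (u r) (w s) = of_real (mu s) * ov r s"
    proof -
      have "sesq_form I A' (u r) (w s) = (\<Sum>t\<in>I. if t = s then of_real (mu t) * ov r t else 0)"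
        unfolding spectral_form[OF fin A'] cov[symmetric] using coord_basis_vector[OF w _ s]
        by (intro sum.cong refl) simp
      then show ?thesis using fin s by (simp add: sum.delta)
    qed
    have 2: "sesq_form I A (u r) (w s) = of_real (lam r) * ov r s"
    proof -
      have "sesq_form I A (u r) (w s) = (\<Sum>t\<in>I. if t = r then of_real (lam t) * ov t s else 0)"
        unfolding spectral_form[OF fin A] ov_def using coord_basis_vector[OF u _ r]
        by (intro sum.cong refl) simp
      then show ?thesis using fin r by (simp add: sum.delta)
    qed
    have "(\<Sum>k\<in>I. cnj (v k) * w s k) = cnj (\<beta> s)"
      unfolding \<beta>_def coord_def by (simp add: mult.commute)
    then show ?thesis
      using form_upd[of "u r" "w s"] unfolding 1 2 \<alpha>_def coord_def[of I u v]
      by (simp add: algebra_simps)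
  qed
  have "rank_one_spectra I lam mu (\<lambda>r. (cmod (\<alpha> r))\<^sup>2) (\<lambda>s. (cmod (\<beta> s))\<^sup>2)
     (\<lambda>r s. (cmod (ov r s))\<^sup>2) (\<lambda>r s. Re (ov r s * cnj (\<alpha> r) * \<beta> s))"
  proof unfold_locales
    show "(\<Sum>s\<in>I. Re (ov r s * cnj (\<alpha> r) * \<beta> s)) = (cmod (\<alpha> r))\<^sup>2" if "r \<in> I" for r
    proof -
      have "(\<Sum>s\<in>I. ov r s * cnj (\<alpha> r) * \<beta> s) = cnj (\<alpha> r) * (\<Sum>s\<in>I. ov r s * \<beta> s)"
        by (simp add: sum_distrib_left mult_ac)
      also have "\<dots> = of_real ((cmod (\<alpha> r))\<^sup>2)"
        unfolding \<alpha>[OF that] complex_norm_square by (rule mult.commute)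
      finally show ?thesis unfolding Re_sum[symmetric] by (simp del: of_real_power)
    qed
    show "(\<Sum>r\<in>I. Re (ov r s * cnj (\<alpha> r) * \<beta> s)) = (cmod (\<beta> s))\<^sup>2" if "s \<in> I" for s
    proof -
      have "(\<Sum>r\<in>I. ov r s * cnj (\<alpha> r) * \<beta> s) = \<beta> s * (\<Sum>r\<in>I. ov r s * cnj (\<alpha> r))"
        by (simp add: sum_distrib_left mult_ac)
      also have "\<dots> = of_real ((cmod (\<beta> s))\<^sup>2)"
        unfolding \<beta>[OF that] complex_norm_square ..
      finally show ?thesis unfolding Re_sum[symmetric] by (simp del: of_real_power)
    qed
    show "(mu s - lam r) * (cmod (ov r s))\<^sup>2 = Re (ov r s * cnj (\<alpha> r) * \<beta> s)" if "r \<in> I" "s \<in> I" for r s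
    proof -
      have "complex_of_real ((mu s - lam r) * (cmod (ov r s))\<^sup>2) = (of_real (mu s - lam r) * ov r s) * cnj (ov r s)"
        unfolding of_real_mult complex_norm_square by (simp only: mult_ac)
      also have "\<dots> = cnj (ov r s * cnj (\<alpha> r) * \<beta> s)"
        unfolding gap[OF that] by (simp add: mult_ac)
      finally have "Re (complex_of_real ((mu s - lam r) * (cmod (ov r s))\<^sup>2)) = Re (cnj (ov r s * cnj (\<alpha> r) * \<beta> s))"
        by (rule arg_cong)
      then show ?thesis by (simp only: Re_complex_of_real cnj.simps)
    qed
    show "(mu s - lam r) * Re (ov r s * cnj (\<alpha> r) * \<beta> s) = (cmod (\<alpha> r))\<^sup>2 * (cmod (\<beta> s))\<^sup>2" if "r \<in> I" "s \<in> I" for r s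
    proof -
      have "of_real (mu s - lam r) * (ov r s * cnj (\<alpha> r) * \<beta> s) = (\<alpha> r * cnj (\<alpha> r)) * (\<beta> s * cnj (\<beta> s))"
        using gap[OF that] by (simp only: mult.assoc[symmetric]) (simp only: mult_ac)
      also have "\<dots> = of_real ((cmod (\<alpha> r))\<^sup>2 * (cmod (\<beta> s))\<^sup>2)"
        by (simp only: of_real_mult complex_norm_square)
      finally have "Re (of_real (mu s - lam r) * (ov r s * cnj (\<alpha> r) * \<beta> s)) = Re (of_real ((cmod (\<alpha> r))\<^sup>2 * (cmod (\<beta> s))\<^sup>2))"
        by (rule arg_cong)
      then show ?thesis by (simp only: Re_complex_of_real scaleR_conv_of_real[symmetric] scaleR_complex.sel)
    qed
  qed (use fin row col in auto)
  then show ?thesis unfolding ov_def \<alpha>_def \<beta>_def .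
qed

section \<open>Matrix Chernoff bounds\<close>

lemma expectation_pair_pmf_iterated:
  fixes h :: "'a \<times> 'b \<Rightarrow> real"
  assumes fin: "finite (set_pmf p)" "finite (set_pmf q)"
  shows "measure_pmf.expectation (pair_pmf p q) h
    = measure_pmf.expectation q (\<lambda>b. measure_pmf.expectation p (\<lambda>a. h (a, b)))"
proof -
  have "measure_pmf.expectation (pair_pmf p q) h
      = (\<Sum>x\<in>set_pmf p \<times> set_pmf q. pmf (pair_pmf p q) x *\<^sub>R h x)"
    using fin by (intro integral_measure_pmf) auto
  also have "\<dots> = (\<Sum>a\<in>set_pmf p. \<Sum>b\<in>set_pmf q. pmf p a * pmf q b * h (a, b))"
    unfolding sum.cartesian_product by (intro sum.cong refl) (auto simp: pmf_pair)
  also have "\<dots> = (\<Sum>b\<in>set_pmf q. \<Sum>a\<in>set_pmf p. pmf p a * pmf q b * h (a, b))"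
    by (rule sum.swap)
  also have "\<dots> = (\<Sum>b\<in>set_pmf q. pmf q b *\<^sub>R (\<Sum>a\<in>set_pmf p. pmf p a *\<^sub>R h (a, b)))"
    by (simp add: sum_distrib_left mult_ac)
  also have "\<dots> = measure_pmf.expectation q (\<lambda>b. measure_pmf.expectation p (\<lambda>a. h (a, b)))"
    using fin by (subst (1 2) integral_measure_pmf[where A = "set_pmf _"]) auto
  finally show ?thesis .
qed

lemma markov_pmf:
  fixes h :: "'a \<Rightarrow> real"
  assumes fin: "finite (set_pmf p)" and nn: "\<And>x. x \<in> set_pmf p \<Longrightarrow> h x \<ge> 0"
    and S: "\<And>x. x \<in> set_pmf p \<Longrightarrow> x \<in> S \<Longrightarrow> h x \<ge> c" and c: "c > 0"
  shows "measure_pmf.prob p S \<le> measure_pmf.expectation p h / c"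
proof -
  have "c * measure_pmf.prob p S = measure_pmf.expectation p (\<lambda>x. c * indicator S x)"
    by simp
  also have "\<dots> \<le> measure_pmf.expectation p h"
    using nn S by (intro integral_mono_AE integrable_measure_pmf_finite fin)
       (auto simp: AE_measure_pmf_iff indicator_def)
  finally show ?thesis using c by (simp add: field_simps)
qed

lemma finite_set_Pi_pmf:
  assumes "finite (set_pmf p)"
  shows "finite (set_pmf (Pi_pmf {1..n::nat} d (\<lambda>_. p)))"
  using assms by (intro finite_subset[OF set_Pi_pmf_subset'[OF finite_atLeastAtMost]] finite_PiE_dflt) auto

text \<open>
  If conditionally on the past the potential \<open>h\<close> satisfies an affine drift inequality, so does its
  expectation.  The insertion rule for product distributions makes the last draw independent of the
  others.
\<close>
lemma iid_drift:
  fixes h :: "nat \<Rightarrow> (nat \<Rightarrow> 'b) \<Rightarrow> real" and x :: "nat \<Rightarrow> real"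
  assumes fin: "finite (set_pmf p)"
    and base: "\<And>J. h 0 J \<le> x 0"
    and step: "\<And>n J. measure_pmf.expectation p (\<lambda>y. h (Suc n) (J(Suc n := y))) \<le> \<alpha> * h n J + \<gamma>"
    and x: "\<And>n. \<alpha> * x n + \<gamma> \<le> x (Suc n)" and \<alpha>: "\<alpha> \<ge> 0"
  shows "measure_pmf.expectation (Pi_pmf {1..n} d (\<lambda>_. p)) (h n) \<le> x n"
proof (induction n)
  case 0
  then show ?case using base by simp
next
  case (Suc n)
  let ?q = "Pi_pmf {1..n} d (\<lambda>_. p)"
  have ins: "{1..Suc n} = insert (Suc n) {1..n}" by auto
  have "measure_pmf.expectation (Pi_pmf {1..Suc n} d (\<lambda>_. p)) (h (Suc n))
      = measure_pmf.expectation (pair_pmf p ?q) (\<lambda>(y, J). h (Suc n) (J(Suc n := y)))"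
    unfolding ins by (subst Pi_pmf_insert) (simp_all add: case_prod_unfold)
  also have "\<dots> = measure_pmf.expectation ?q (\<lambda>J. measure_pmf.expectation p (\<lambda>y. h (Suc n) (J(Suc n := y))))"
    by (subst expectation_pair_pmf_iterated[OF fin finite_set_Pi_pmf[OF fin]]) simp
  also have "\<dots> \<le> measure_pmf.expectation ?q (\<lambda>J. \<alpha> * h n J + \<gamma>)"
    by (intro integral_mono integrable_measure_pmf_finite finite_set_Pi_pmf fin step)
  also have "\<dots> = \<alpha> * measure_pmf.expectation ?q (h n) + \<gamma>"
    using integrable_measure_pmf_finite[OF finite_set_Pi_pmf[OF fin], of n d "h n"]
    by (subst Bochner_Integration.integral_add) (simp_all add: measure_pmf.prob_space)
  also have "\<dots> \<le> \<alpha> * x n + \<gamma>" using Suc \<alpha> by (intro add_right_mono mult_left_mono)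
  also have "\<dots> \<le> x (Suc n)" by (rule x)
  finally show ?case .
qed

definition sum_outer :: "('i \<Rightarrow> 'k \<Rightarrow> complex) \<Rightarrow> 'i set \<Rightarrow> 'k \<Rightarrow> 'k \<Rightarrow> complex" where
  "sum_outer v S k l = (\<Sum>i\<in>S. v i k * cnj (v i l))"

lemma hermitian_sum_outer: "hermitian_on I (sum_outer v S)"
  unfolding hermitian_on_def sum_outer_def by (simp add: mult.commute)

lemma sesq_form_sum_outer:
  "sesq_form I (sum_outer v S) x x = of_real (\<Sum>i\<in>S. (cmod (\<Sum>k\<in>I. cnj (v i k) * x k))\<^sup>2)"
proof -
  have "sesq_form I (sum_outer v S) x x = (\<Sum>k\<in>I. \<Sum>l\<in>I. \<Sum>i\<in>S. (cnj (v i l) * x l) * (v i k * cnj (x k)))"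
    unfolding sesq_form_def sum_outer_def by (simp add: sum_distrib_left sum_distrib_right mult_ac)
  also have "\<dots> = (\<Sum>k\<in>I. \<Sum>i\<in>S. \<Sum>l\<in>I. (cnj (v i l) * x l) * (v i k * cnj (x k)))"
    by (intro sum.cong refl sum.swap)
  also have "\<dots> = (\<Sum>i\<in>S. \<Sum>k\<in>I. \<Sum>l\<in>I. (cnj (v i l) * x l) * (v i k * cnj (x k)))"
    by (rule sum.swap)
  also have "\<dots> = (\<Sum>i\<in>S. (\<Sum>l\<in>I. cnj (v i l) * x l) * (\<Sum>k\<in>I. v i k * cnj (x k)))"
    by (simp only: sum_distrib_right[symmetric] sum_distrib_left[symmetric])
  also have "\<dots> = of_real (\<Sum>i\<in>S. (cmod (\<Sum>k\<in>I. cnj (v i k) * x k))\<^sup>2)"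
    unfolding of_real_sum complex_norm_square by simp
  finally show ?thesis .
qed

lemma sum_outer_spectral_form:
  assumes "finite I" "spectral_on I (sum_outer v S) lam u"
  shows "(\<Sum>i\<in>S. (cmod (\<Sum>k\<in>I. cnj (v i k) * x k))\<^sup>2) = (\<Sum>r\<in>I. lam r * (cmod (coord I u x r))\<^sup>2)"
    (is "?l = ?r")
proof -
  have "complex_of_real ?l = of_real ?r"
    using sesq_form_sum_outer[of I v S x] spectral_quadratic_form[OF assms, of x] by simp
  then show ?thesis using of_real_eq_iff by blast
qed

lemma sum_outer_eigenvalue:
  assumes "finite I" "spectral_on I (sum_outer v S) lam u" "r \<in> I"
  shows "lam r = (\<Sum>i\<in>S. (cmod (\<Sum>k\<in>I. cnj (v i k) * u r k))\<^sup>2)"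
    (is "_ = ?r")
proof -
  have "complex_of_real (lam r) = of_real ?r"
    using sesq_form_sum_outer[of I v S "u r"] spectral_eigenvalue[OF assms] by simp
  then show ?thesis using of_real_eq_iff by blast
qed

lemma sum_outer_eigenvalue_nonneg:
  assumes "finite I" "spectral_on I (sum_outer v S) lam u" "r \<in> I"
  shows "lam r \<ge> 0"
  unfolding sum_outer_eigenvalue[OF assms] by (intro sum_nonneg) simp

text \<open>
  Any choice of a decomposition serves, since potentials only need to be compared between consecutive
  matrices.
\<close>
definition spectrum_of :: "'a set \<Rightarrow> ('a \<Rightarrow> 'a \<Rightarrow> complex) \<Rightarrow> ('a \<Rightarrow> real) \<times> ('a \<Rightarrow> 'a \<Rightarrow> complex)" where
  "spectrum_of I A = (SOME p. spectral_on I A (fst p) (snd p))"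

lemma spectrum_of:
  assumes "finite I" "hermitian_on I A"
  shows "spectral_on I A (fst (spectrum_of I A)) (snd (spectrum_of I A))"
proof -
  obtain lam u where "spectral_on I A lam u"
    using hermitian_spectral_decomposition[OF assms] by blast
  then have "\<exists>p. spectral_on I A (fst p) (snd p)" by (metis fst_conv snd_conv)
  then show ?thesis unfolding spectrum_of_def by (rule someI_ex)
qed

text \<open>
  The trace of the matrix \<open>f(A)\<close>.
\<close>
definition trace_fun :: "(real \<Rightarrow> real) \<Rightarrow> 'a set \<Rightarrow> ('a \<Rightarrow> 'a \<Rightarrow> complex) \<Rightarrow> real" where
  "trace_fun f I A = (\<Sum>r\<in>I. f (fst (spectrum_of I A) r))"

text \<open>
  The expectation of \<open>v v\<^sup>*\<close> is diagonal with entries \<open>\<omega>\<close>, so the expected squared coordinate in direction \<open>u r\<close>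
  is its quadratic form at \<open>u r\<close>.
\<close>
lemma expectation_coord:
  assumes "finite I" "finite (set_pmf p)"
    and iso: "\<And>k l. k \<in> I \<Longrightarrow> l \<in> I \<Longrightarrow>
       measure_pmf.expectation p (\<lambda>i. v i k * cnj (v i l)) = (if k = l then of_real (\<omega> k) else 0)"
  shows "measure_pmf.expectation p (\<lambda>i. (cmod (coord I u (v i) r))\<^sup>2) = (\<Sum>k\<in>I. \<omega> k * (cmod (u r k))\<^sup>2)"
proof -
  note int = integrable_measure_pmf_finite[OF assms(2)]
  have "complex_of_real (measure_pmf.expectation p (\<lambda>i. (cmod (coord I u (v i) r))\<^sup>2))
      = measure_pmf.expectation p (\<lambda>i. coord I u (v i) r * cnj (coord I u (v i) r))"
    unfolding complex_norm_square[symmetric] by (rule integral_complex_of_real[symmetric])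
  also have "\<dots> = measure_pmf.expectation p (\<lambda>i. \<Sum>k\<in>I. \<Sum>l\<in>I. (cnj (u r k) * u r l) * (v i k * cnj (v i l)))"
    unfolding coord_def cnj_sum sum_product by (simp add: mult_ac)
  also have "\<dots> = (\<Sum>k\<in>I. \<Sum>l\<in>I. (cnj (u r k) * u r l) * measure_pmf.expectation p (\<lambda>i. v i k * cnj (v i l)))"
    by (simp add: Bochner_Integration.integral_sum int)
  also have "\<dots> = (\<Sum>k\<in>I. \<Sum>l\<in>I. if l = k then cnj (u r k) * u r k * of_real (\<omega> k) else 0)"
    by (intro sum.cong refl) (simp add: iso)
  also have "\<dots> = (\<Sum>k\<in>I. cnj (u r k) * u r k * of_real (\<omega> k))"
    using assms by (simp add: sum.delta)
  also have "\<dots> = of_real (\<Sum>k\<in>I. \<omega> k * (cmod (u r k))\<^sup>2)"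
    unfolding of_real_sum of_real_mult complex_norm_square by (simp add: mult_ac)
  finally show ?thesis using of_real_eq_iff by blast
qed

lemma sum_outer_draw:
  "sum_outer (\<lambda>i. v ((J(Suc n := y)) i)) {1..Suc n} k l = sum_outer (\<lambda>i. v (J i)) {1..n} k l + v y k * cnj (v y l)"
proof -
  have "{1..Suc n} = insert (Suc n) {1..n}" by auto
  moreover have "(\<Sum>i\<in>{1..n}. v ((J(Suc n := y)) i) k * cnj (v ((J(Suc n := y)) i) l)) = (\<Sum>i\<in>{1..n}. v (J i) k * cnj (v (J i) l))"
    by (intro sum.cong refl) auto
  ultimately show ?thesis unfolding sum_outer_def by simp
qed

lemma sum_outer_draw_spectra:
  fixes v :: "'i \<Rightarrow> 'k \<Rightarrow> complex"
  assumes "finite I"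
  defines "A \<equiv> (\<lambda>n (J :: nat \<Rightarrow> 'i). sum_outer (\<lambda>i. v (J i)) {1..n})"
  shows "rank_one_spectra I (fst (spectrum_of I (A n J))) (fst (spectrum_of I (A (Suc n) (J(Suc n := y)))))
     (\<lambda>r. (cmod (coord I (snd (spectrum_of I (A n J))) (v y) r))\<^sup>2)
     (\<lambda>s. (cmod (coord I (snd (spectrum_of I (A (Suc n) (J(Suc n := y))))) (v y) s))\<^sup>2)
     (\<lambda>r s. (cmod (coord I (snd (spectrum_of I (A n J))) (snd (spectrum_of I (A (Suc n) (J(Suc n := y)))) s) r))\<^sup>2)
     (\<lambda>r s. Re (coord I (snd (spectrum_of I (A n J))) (snd (spectrum_of I (A (Suc n) (J(Suc n := y)))) s) r
        * cnj (coord I (snd (spectrum_of I (A n J))) (v y) r)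
        * coord I (snd (spectrum_of I (A (Suc n) (J(Suc n := y))))) (v y) s))"
  unfolding A_def
  by (rule spectral_perturbation[OF assms(1) spectrum_of[OF assms(1)] spectrum_of[OF assms(1)]])
     (rule hermitian_sum_outer sum_outer_draw)+

text \<open>
  The potential \<open>tr exp (- A)\<close> starts at most at the dimension, and a step multiplies its expectation by
  at most \<open>1 - \<epsilon> / e\<close>: Klein's inequality bounds the decrease below by the form of \<open>exp (- A)\<close> after
  the step at \<open>v\<close>, which is at least \<open>1 / e\<close> times the one before the step, as \<open>v\<close> has norm at most
  1; and the latter has expectation \<open>\<epsilon> tr exp (- A)\<close>.  Markov's inequality concludes, because an
  eigenvalue below \<open>t\<close> makes the potential at least \<open>exp (- t)\<close>.
\<close>
theorem matrix_chernoff_lower: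
  fixes v :: "'i \<Rightarrow> 'k \<Rightarrow> complex"
  assumes fin: "finite I" and finp: "finite (set_pmf p)"
    and small: "\<And>i. i \<in> set_pmf p \<Longrightarrow> (\<Sum>k\<in>I. (cmod (v i k))\<^sup>2) \<le> 1"
    and iso: "\<And>k l. k \<in> I \<Longrightarrow> l \<in> I \<Longrightarrow>
       measure_pmf.expectation p (\<lambda>i. v i k * cnj (v i l)) = (if k = l then of_real \<epsilon> else 0)"
    and \<epsilon>: "0 \<le> \<epsilon>" "\<epsilon> \<le> 1"
  shows "measure_pmf.prob (Pi_pmf {1..n} d (\<lambda>_. p))
     {J. \<exists>x. (\<Sum>i\<in>{1..n}. (cmod (\<Sum>k\<in>I. cnj (v (J i) k) * x k))\<^sup>2) < t * (\<Sum>k\<in>I. (cmod (x k))\<^sup>2)}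
     \<le> real (card I) * (1 - \<epsilon> / exp 1) ^ n * exp t"
proof -
  define A where "A = (\<lambda>n (J::nat \<Rightarrow> 'i). sum_outer (\<lambda>i. v (J i)) {1..n})"
  define h where "h n J = trace_fun (\<lambda>x. exp (- x)) I (A n J)" for n J
  note int = integrable_measure_pmf_finite[OF finp]
  have \<epsilon>e: "\<epsilon> / exp 1 \<le> 1" using \<epsilon> exp_ge_add_one_self[of 1] by (simp add: field_simps)
  have spec: "spectral_on I (A n J) (fst (spectrum_of I (A n J))) (snd (spectrum_of I (A n J)))" for n J
    unfolding A_def by (intro spectrum_of fin hermitian_sum_outer)
  have step: "measure_pmf.expectation p (\<lambda>y. h (Suc n) (J(Suc n := y))) \<le> (1 - \<epsilon> / exp 1) * h n J + 0" for n J
  proof -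
    define lam where "lam = fst (spectrum_of I (A n J))"
    define u where "u = snd (spectrum_of I (A n J))"
    have u: "unitary_on I u" using spec[of n J] by (simp add: spectral_on_def u_def)
    have one: "h (Suc n) (J(Suc n := y)) \<le> h n J - (\<Sum>r\<in>I. (cmod (coord I u (v y) r))\<^sup>2 * exp (- lam r)) / exp 1"
      if y: "y \<in> set_pmf p" for y
    proof -
      define mu where "mu = fst (spectrum_of I (A (Suc n) (J(Suc n := y))))"
      define w where "w = snd (spectrum_of I (A (Suc n) (J(Suc n := y))))"
      interpret rank_one_spectra I lam mu "\<lambda>r. (cmod (coord I u (v y) r))\<^sup>2" "\<lambda>s. (cmod (coord I w (v y) s))\<^sup>2"
        "\<lambda>r s. (cmod (coord I u (w s) r))\<^sup>2"
        "\<lambda>r s. Re (coord I u (w s) r * cnj (coord I u (v y) r) * coord I w (v y) s)"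
        unfolding lam_def u_def mu_def w_def A_def by (rule sum_outer_draw_spectra[OF fin])
      have total: "(\<Sum>r\<in>I. (cmod (coord I u (v y) r))\<^sup>2) \<le> 1"
        using small[OF y] coord_parseval[OF fin u, of "v y"] by simp
      have convex: "exp (- y) - exp (- x) \<le> - exp (- y) * (y - x)" for x y :: real
      proof -
        have "exp (- y) * (1 + (y - x)) \<le> exp (- y) * exp (y - x)"
          by (intro mult_left_mono exp_ge_add_one_self) simp
        then show ?thesis by (simp add: algebra_simps flip: exp_add)
      qed
      have "(\<Sum>r\<in>I. (cmod (coord I u (v y) r))\<^sup>2 * exp (- lam r))
          \<le> exp (\<Sum>r\<in>I. (cmod (coord I u (v y) r))\<^sup>2) * (\<Sum>s\<in>I. (cmod (coord I w (v y) s))\<^sup>2 * exp (- mu s))"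
        by (rule exp_minus_bound)
      also have "\<dots> \<le> exp 1 * (\<Sum>s\<in>I. (cmod (coord I w (v y) s))\<^sup>2 * exp (- mu s))"
        using total by (intro mult_right_mono sum_nonneg) auto
      finally have "(\<Sum>r\<in>I. (cmod (coord I u (v y) r))\<^sup>2 * exp (- lam r)) / exp 1
          \<le> (\<Sum>s\<in>I. (cmod (coord I w (v y) s))\<^sup>2 * exp (- mu s))"
        by (simp add: field_simps)
      moreover have "(\<Sum>s\<in>I. exp (- mu s)) \<le> (\<Sum>r\<in>I. exp (- lam r)) + (\<Sum>s\<in>I. (cmod (coord I w (v y) s))\<^sup>2 * (- exp (- mu s)))"
        by (rule klein_inequality[of "\<lambda>x. exp (- x)" "\<lambda>x. - exp (- x)"]) (rule convex)
      ultimately show ?thesis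
        unfolding h_def trace_fun_def lam_def[symmetric] mu_def[symmetric] by (simp add: sum_negf)
    qed
    have "measure_pmf.expectation p (\<lambda>y. h (Suc n) (J(Suc n := y)))
        \<le> measure_pmf.expectation p (\<lambda>y. h n J - (\<Sum>r\<in>I. (cmod (coord I u (v y) r))\<^sup>2 * exp (- lam r)) / exp 1)"
      by (intro integral_mono_AE int) (use one in \<open>auto simp: AE_measure_pmf_iff\<close>)
    also have "\<dots> = h n J - (\<Sum>r\<in>I. measure_pmf.expectation p (\<lambda>y. (cmod (coord I u (v y) r))\<^sup>2) * exp (- lam r)) / exp 1"
      by (subst Bochner_Integration.integral_diff) (simp_all add: int Bochner_Integration.integral_sum measure_pmf.prob_space)
    also have "(\<Sum>r\<in>I. measure_pmf.expectation p (\<lambda>y. (cmod (coord I u (v y) r))\<^sup>2) * exp (- lam r)) = (\<Sum>r\<in>I. \<epsilon> * exp (- lam r))"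
    proof (intro sum.cong refl)
      fix r assume r: "r \<in> I"
      have "measure_pmf.expectation p (\<lambda>y. (cmod (coord I u (v y) r))\<^sup>2) = (\<Sum>k\<in>I. \<epsilon> * (cmod (u r k))\<^sup>2)"
        by (rule expectation_coord[OF fin finp]) (rule iso)
      also have "\<dots> = \<epsilon>" using spectral_basis_norm[OF u r] by (simp flip: sum_distrib_left)
      finally show "measure_pmf.expectation p (\<lambda>y. (cmod (coord I u (v y) r))\<^sup>2) * exp (- lam r) = \<epsilon> * exp (- lam r)" by simp
    qed
    also have "\<dots> = \<epsilon> * h n J" by (simp add: h_def trace_fun_def lam_def sum_distrib_left)
    also have "h n J - \<epsilon> * h n J / exp 1 = (1 - \<epsilon> / exp 1) * h n J + 0" by (simp add: algebra_simps)
    finally show ?thesis .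
  qed
  have base: "h 0 J \<le> real (card I)" for J
  proof -
    have "exp (- fst (spectrum_of I (A 0 J)) r) \<le> 1" if "r \<in> I" for r
      using sum_outer_eigenvalue_nonneg[OF fin spec[of 0 J, unfolded A_def] that] by (simp add: A_def)
    then have "h 0 J \<le> (\<Sum>r\<in>I. 1)" unfolding h_def trace_fun_def by (intro sum_mono)
    then show ?thesis by simp
  qed
  have "measure_pmf.expectation (Pi_pmf {1..n} d (\<lambda>_. p)) (h n) \<le> real (card I) * (1 - \<epsilon> / exp 1) ^ n"
    by (rule iid_drift[where x = "\<lambda>n. real (card I) * (1 - \<epsilon> / exp 1) ^ n", OF finp _ step])
       (use base \<epsilon>e in auto)
  moreover have "measure_pmf.prob (Pi_pmf {1..n} d (\<lambda>_. p))
     {J. \<exists>x. (\<Sum>i\<in>{1..n}. (cmod (\<Sum>k\<in>I. cnj (v (J i) k) * x k))\<^sup>2) < t * (\<Sum>k\<in>I. (cmod (x k))\<^sup>2)}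
     \<le> measure_pmf.expectation (Pi_pmf {1..n} d (\<lambda>_. p)) (h n) / exp (- t)"
  proof (rule markov_pmf)
    show "finite (set_pmf (Pi_pmf {1..n} d (\<lambda>_. p)))" by (rule finite_set_Pi_pmf[OF finp])
    show "h n J \<ge> 0" for J unfolding h_def trace_fun_def by (intro sum_nonneg) simp
    show "h n J \<ge> exp (- t)"
      if J: "J \<in> {J. \<exists>x. (\<Sum>i\<in>{1..n}. (cmod (\<Sum>k\<in>I. cnj (v (J i) k) * x k))\<^sup>2) < t * (\<Sum>k\<in>I. (cmod (x k))\<^sup>2)}" for J
    proof -
      define lam where "lam = fst (spectrum_of I (A n J))"
      define u where "u = snd (spectrum_of I (A n J))"
      have sp: "spectral_on I (A n J) lam u" unfolding lam_def u_def by (rule spec)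
      obtain x where x: "(\<Sum>i\<in>{1..n}. (cmod (\<Sum>k\<in>I. cnj (v (J i) k) * x k))\<^sup>2) < t * (\<Sum>k\<in>I. (cmod (x k))\<^sup>2)"
        using J by blast
      have "(\<Sum>r\<in>I. lam r * (cmod (coord I u x r))\<^sup>2) < (\<Sum>r\<in>I. t * (cmod (coord I u x r))\<^sup>2)"
        using x unfolding sum_outer_spectral_form[OF fin sp[unfolded A_def]]
          coord_parseval[OF fin spectral_on_unitary[OF sp], of x, symmetric] sum_distrib_left .
      then obtain r where r: "r \<in> I" "lam r * (cmod (coord I u x r))\<^sup>2 < t * (cmod (coord I u x r))\<^sup>2"
        using sum_mono[of I "\<lambda>r. t * (cmod (coord I u x r))\<^sup>2" "\<lambda>r. lam r * (cmod (coord I u x r))\<^sup>2"]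
        by (force simp: not_less[symmetric])
      then have "lam r < t" by (simp add: mult_less_cancel_right)
      then have "exp (- t) \<le> exp (- lam r)" by simp
      also have "\<dots> \<le> h n J" unfolding h_def trace_fun_def lam_def[symmetric]
        using fin r by (intro member_le_sum) auto
      finally show ?thesis .
    qed
  qed simp
  ultimately have "measure_pmf.prob (Pi_pmf {1..n} d (\<lambda>_. p))
     {J. \<exists>x. (\<Sum>i\<in>{1..n}. (cmod (\<Sum>k\<in>I. cnj (v (J i) k) * x k))\<^sup>2) < t * (\<Sum>k\<in>I. (cmod (x k))\<^sup>2)}
     \<le> real (card I) * (1 - \<epsilon> / exp 1) ^ n / exp (- t)"
    by (meson divide_right_mono exp_ge_zero order_trans)
  then show ?thesis by (simp add: exp_minus divide_inverse)
qed

text \<open>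
  The potential is \<open>tr (exp A - 1)\<close>, whose start value 0 and drift do not involve the dimension: the
  expected increase is at most \<open>e\<close> times the trace of \<open>exp A\<close> against the diagonal matrix \<open>\<omega>\<close>, and
  writing \<open>exp A = (exp A - 1) + 1\<close> bounds it by \<open>e \<epsilon>\<close> times the potential plus \<open>e\<close> times the trace of
  \<open>\<omega>\<close>, which is at most 1.
\<close>
theorem matrix_chernoff_upper:
  fixes v :: "'i \<Rightarrow> 'k \<Rightarrow> complex"
  assumes fin: "finite I" and finp: "finite (set_pmf p)"
    and small: "\<And>i. i \<in> set_pmf p \<Longrightarrow> (\<Sum>k\<in>I. (cmod (v i k))\<^sup>2) \<le> 1"
    and iso: "\<And>k l. k \<in> I \<Longrightarrow> l \<in> I \<Longrightarrow>
       measure_pmf.expectation p (\<lambda>i. v i k * cnj (v i l)) = (if k = l then of_real (\<omega> k) else 0)"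
    and \<omega>: "\<And>k. k \<in> I \<Longrightarrow> 0 \<le> \<omega> k" "\<And>k. k \<in> I \<Longrightarrow> \<omega> k \<le> \<epsilon>" "(\<Sum>k\<in>I. \<omega> k) \<le> 1"
    and \<epsilon>: "0 < \<epsilon>" and t: "t > 0"
  shows "measure_pmf.prob (Pi_pmf {1..n} d (\<lambda>_. p))
     {J. \<exists>x. (\<Sum>i\<in>{1..n}. (cmod (\<Sum>k\<in>I. cnj (v (J i) k) * x k))\<^sup>2) > t * (\<Sum>k\<in>I. (cmod (x k))\<^sup>2)}
     \<le> ((1 + exp 1 * \<epsilon>) ^ n - 1) / \<epsilon> / (exp t - 1)"
proof -
  define A where "A = (\<lambda>n (J::nat \<Rightarrow> 'i). sum_outer (\<lambda>i. v (J i)) {1..n})"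
  define h where "h n J = trace_fun (\<lambda>x. exp x - 1) I (A n J)" for n J
  note int = integrable_measure_pmf_finite[OF finp]
  have spec: "spectral_on I (A n J) (fst (spectrum_of I (A n J))) (snd (spectrum_of I (A n J)))" for n J
    unfolding A_def by (intro spectrum_of fin hermitian_sum_outer)
  have nonneg: "fst (spectrum_of I (A n J)) r \<ge> 0" if "r \<in> I" for n J r
    using sum_outer_eigenvalue_nonneg[OF fin spec[of n J, unfolded A_def] that] by (simp add: A_def)
  have h0: "h n J \<ge> 0" for n J
    unfolding h_def trace_fun_def using nonneg by (intro sum_nonneg) auto
  have step: "measure_pmf.expectation p (\<lambda>y. h (Suc n) (J(Suc n := y))) \<le> (1 + exp 1 * \<epsilon>) * h n J + exp 1" for n J
  proof -
    define lam where "lam = fst (spectrum_of I (A n J))"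
    define u where "u = snd (spectrum_of I (A n J))"
    have u: "unitary_on I u" using spec[of n J] by (simp add: spectral_on_def u_def)
    have one: "h (Suc n) (J(Suc n := y)) \<le> h n J + exp 1 * (\<Sum>r\<in>I. (cmod (coord I u (v y) r))\<^sup>2 * exp (lam r))"
      if y: "y \<in> set_pmf p" for y
    proof -
      define mu where "mu = fst (spectrum_of I (A (Suc n) (J(Suc n := y))))"
      define w where "w = snd (spectrum_of I (A (Suc n) (J(Suc n := y))))"
      interpret rank_one_spectra I lam mu "\<lambda>r. (cmod (coord I u (v y) r))\<^sup>2" "\<lambda>s. (cmod (coord I w (v y) s))\<^sup>2"
        "\<lambda>r s. (cmod (coord I u (w s) r))\<^sup>2"
        "\<lambda>r s. Re (coord I u (w s) r * cnj (coord I u (v y) r) * coord I w (v y) s)"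
        unfolding lam_def u_def mu_def w_def A_def by (rule sum_outer_draw_spectra[OF fin])
      have total: "(\<Sum>r\<in>I. (cmod (coord I u (v y) r))\<^sup>2) \<le> 1"
        using small[OF y] coord_parseval[OF fin u, of "v y"] by simp
      have convex: "(exp y - 1) - (exp x - 1) \<le> exp y * (y - x)" for x y :: real
      proof -
        have "exp y * (1 + (x - y)) \<le> exp y * exp (x - y)"
          by (intro mult_left_mono exp_ge_add_one_self) simp
        then show ?thesis by (simp add: algebra_simps flip: exp_add)
      qed
      have "(\<Sum>s\<in>I. (cmod (coord I w (v y) s))\<^sup>2 * exp (mu s))
          \<le> exp (\<Sum>r\<in>I. (cmod (coord I u (v y) r))\<^sup>2) * (\<Sum>r\<in>I. (cmod (coord I u (v y) r))\<^sup>2 * exp (lam r))"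
        by (rule exp_bound)
      also have "\<dots> \<le> exp 1 * (\<Sum>r\<in>I. (cmod (coord I u (v y) r))\<^sup>2 * exp (lam r))"
        using total by (intro mult_right_mono sum_nonneg) auto
      finally have "(\<Sum>s\<in>I. (cmod (coord I w (v y) s))\<^sup>2 * exp (mu s)) \<le> exp 1 * (\<Sum>r\<in>I. (cmod (coord I u (v y) r))\<^sup>2 * exp (lam r))" .
      moreover have "(\<Sum>s\<in>I. exp (mu s) - 1) \<le> (\<Sum>r\<in>I. exp (lam r) - 1) + (\<Sum>s\<in>I. (cmod (coord I w (v y) s))\<^sup>2 * exp (mu s))"
        by (rule klein_inequality[of "\<lambda>x. exp x - 1" exp]) (rule convex)
      ultimately show ?thesis
        unfolding h_def trace_fun_def lam_def[symmetric] mu_def[symmetric] by linarith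
    qed
    have "measure_pmf.expectation p (\<lambda>y. h (Suc n) (J(Suc n := y)))
        \<le> measure_pmf.expectation p (\<lambda>y. h n J + exp 1 * (\<Sum>r\<in>I. (cmod (coord I u (v y) r))\<^sup>2 * exp (lam r)))"
      by (intro integral_mono_AE int) (use one in \<open>auto simp: AE_measure_pmf_iff\<close>)
    also have "\<dots> = h n J + exp 1 * (\<Sum>r\<in>I. measure_pmf.expectation p (\<lambda>y. (cmod (coord I u (v y) r))\<^sup>2) * exp (lam r))"
      by (subst Bochner_Integration.integral_add) (simp_all add: int Bochner_Integration.integral_sum measure_pmf.prob_space)
    also have "\<dots> \<le> h n J + exp 1 * (\<epsilon> * h n J + 1)"
    proof -
      define c where "c r = (\<Sum>k\<in>I. \<omega> k * (cmod (u r k))\<^sup>2)" for r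
      have E: "measure_pmf.expectation p (\<lambda>y. (cmod (coord I u (v y) r))\<^sup>2) = c r" for r
        unfolding c_def by (rule expectation_coord[OF fin finp]) (rule iso)
      have c\<epsilon>: "c r \<le> \<epsilon>" if "r \<in> I" for r
      proof -
        have "c r \<le> (\<Sum>k\<in>I. \<epsilon> * (cmod (u r k))\<^sup>2)" unfolding c_def using \<omega> by (intro sum_mono mult_right_mono) auto
        also have "\<dots> = \<epsilon>" using spectral_basis_norm[OF u that] by (simp flip: sum_distrib_left)
        finally show ?thesis .
      qed
      have "(\<Sum>r\<in>I. c r) = (\<Sum>k\<in>I. \<omega> k * (\<Sum>r\<in>I. (cmod (u r k))\<^sup>2))"
        unfolding c_def by (subst sum.swap) (simp add: sum_distrib_left)
      also have "\<dots> = (\<Sum>k\<in>I. \<omega> k)"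
      proof (intro sum.cong refl)
        fix k assume k: "k \<in> I"
        have "complex_of_real (\<Sum>r\<in>I. (cmod (u r k))\<^sup>2) = 1"
          unfolding of_real_sum complex_norm_square using unitary_on_cols[OF u k k] by simp
        then have "(\<Sum>r\<in>I. (cmod (u r k))\<^sup>2) = 1" using of_real_eq_1_iff by blast
        then show "\<omega> k * (\<Sum>r\<in>I. (cmod (u r k))\<^sup>2) = \<omega> k" by simp
      qed
      finally have c1: "(\<Sum>r\<in>I. c r) \<le> 1" using \<omega> by simp
      have "(\<Sum>r\<in>I. c r * exp (lam r)) = (\<Sum>r\<in>I. c r * (exp (lam r) - 1)) + (\<Sum>r\<in>I. c r)"
        by (simp add: algebra_simps flip: sum.distrib)
      also have "\<dots> \<le> (\<Sum>r\<in>I. \<epsilon> * (exp (lam r) - 1)) + 1"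
        using c1 c\<epsilon> nonneg by (intro add_mono sum_mono mult_right_mono) (auto simp: lam_def)
      also have "\<dots> = \<epsilon> * h n J + 1" by (simp add: h_def trace_fun_def lam_def sum_distrib_left)
      finally show ?thesis unfolding E by (intro add_left_mono mult_left_mono) auto
    qed
    also have "\<dots> = (1 + exp 1 * \<epsilon>) * h n J + exp 1" by (simp add: algebra_simps)
    finally show ?thesis .
  qed
  have base: "h 0 J \<le> 0" for J
  proof -
    have "fst (spectrum_of I (A 0 J)) r = 0" if "r \<in> I" for r
      using spectral_eigenvalue[OF fin spec[of 0 J] that] by (simp add: A_def sum_outer_def sesq_form_def)
    then show ?thesis unfolding h_def trace_fun_def by simp
  qed
  have "measure_pmf.expectation (Pi_pmf {1..n} d (\<lambda>_. p)) (h n) \<le> ((1 + exp 1 * \<epsilon>) ^ n - 1) / \<epsilon>"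
    by (rule iid_drift[where x = "\<lambda>n. ((1 + exp 1 * \<epsilon>) ^ n - 1) / \<epsilon>", OF finp _ step])
       (use base \<epsilon> in \<open>auto simp: field_simps\<close>)
  moreover have "measure_pmf.prob (Pi_pmf {1..n} d (\<lambda>_. p))
     {J. \<exists>x. (\<Sum>i\<in>{1..n}. (cmod (\<Sum>k\<in>I. cnj (v (J i) k) * x k))\<^sup>2) > t * (\<Sum>k\<in>I. (cmod (x k))\<^sup>2)}
     \<le> measure_pmf.expectation (Pi_pmf {1..n} d (\<lambda>_. p)) (h n) / (exp t - 1)"
  proof (rule markov_pmf)
    show "finite (set_pmf (Pi_pmf {1..n} d (\<lambda>_. p)))" by (rule finite_set_Pi_pmf[OF finp])
    show "h n J \<ge> 0" for J by (rule h0)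
    show "exp t - 1 > 0" using t by simp
    show "h n J \<ge> exp t - 1"
      if J: "J \<in> {J. \<exists>x. (\<Sum>i\<in>{1..n}. (cmod (\<Sum>k\<in>I. cnj (v (J i) k) * x k))\<^sup>2) > t * (\<Sum>k\<in>I. (cmod (x k))\<^sup>2)}" for J
    proof -
      define lam where "lam = fst (spectrum_of I (A n J))"
      define u where "u = snd (spectrum_of I (A n J))"
      have sp: "spectral_on I (A n J) lam u" unfolding lam_def u_def by (rule spec)
      obtain x where x: "(\<Sum>i\<in>{1..n}. (cmod (\<Sum>k\<in>I. cnj (v (J i) k) * x k))\<^sup>2) > t * (\<Sum>k\<in>I. (cmod (x k))\<^sup>2)"
        using J by blast
      have "(\<Sum>r\<in>I. lam r * (cmod (coord I u x r))\<^sup>2) > (\<Sum>r\<in>I. t * (cmod (coord I u x r))\<^sup>2)"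
        using x unfolding sum_outer_spectral_form[OF fin sp[unfolded A_def]]
          coord_parseval[OF fin spectral_on_unitary[OF sp], of x, symmetric] sum_distrib_left .
      then obtain r where r: "r \<in> I" "lam r * (cmod (coord I u x r))\<^sup>2 > t * (cmod (coord I u x r))\<^sup>2"
        using sum_mono[of I "\<lambda>r. lam r * (cmod (coord I u x r))\<^sup>2" "\<lambda>r. t * (cmod (coord I u x r))\<^sup>2"]
        by (force simp: not_less[symmetric])
      then have "lam r > t" by (simp add: mult_less_cancel_right)
      then have "exp t - 1 \<le> exp (lam r) - 1" by simp
      also have "\<dots> \<le> h n J" unfolding h_def trace_fun_def lam_def[symmetric]
        using fin r nonneg by (intro member_le_sum) (auto simp: lam_def)
      finally show ?thesis .
    qed
  qed
  ultimately show ?thesis using t by (meson divide_right_mono diff_ge_0_iff_ge less_imp_le one_le_exp_iff order_trans)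
qed

section \<open>Subsampling a finite frame\<close>

text \<open>
  Two inequalities for the trace \<open>\<phi>\<close> of a resolvent at \<open>l\<close> when the barrier moves to \<open>l + \<delta>\<close>.  With
  \<open>x r = 1 / (lam r - l)\<close> and \<open>y r = 1 / (lam r - (l + \<delta>))\<close> one has \<open>y r - x r = \<delta> x r y r\<close>, so the increase
  of the trace is \<open>\<delta>\<close> times the sum of \<open>x r y r\<close>.  The first inequality is then Cauchy-Schwarz for the
  vectors \<open>sqrt (x r)\<close> and \<open>sqrt (x r) y r\<close>, the second is Chebyshev for \<open>x\<close> and \<open>y\<close>.
\<close>
lemma barrier_trace_inequality:
  fixes lam :: "'a \<Rightarrow> real"
  assumes fin: "finite I" and \<delta>: "\<delta> > 0" and lam: "\<And>r. r \<in> I \<Longrightarrow> lam r > l + \<delta>"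
    and \<phi>: "(\<Sum>r\<in>I. 1 / (lam r - l)) = \<phi>" and \<delta>\<phi>: "\<delta> * \<phi> \<le> 1"
  defines "\<Psi> \<equiv> (\<Sum>r\<in>I. 1 / (lam r - (l + \<delta>)))"
  shows "(\<Psi> - \<phi>) * (1 / \<delta> - \<phi>) \<le> (\<Sum>r\<in>I. 1 / (lam r - (l + \<delta>))\<^sup>2) - (\<Psi> - \<phi>) * \<Psi>"
    and "\<phi> * \<Psi> * \<delta> \<le> real (card I) * (\<Psi> - \<phi>)"
proof -
  define x where "x r = 1 / (lam r - l)" for r
  define y where "y r = 1 / (lam r - (l + \<delta>))" for r
  have pos: "x r > 0" "y r > 0" if "r \<in> I" for r using lam[OF that] \<delta> by (simp_all add: x_def y_def)
  have diff: "y r - x r = \<delta> * (x r * y r)" if "r \<in> I" for r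
    using lam[OF that] \<delta> by (simp add: x_def y_def field_simps)
  have \<Psi>: "\<Psi> = (\<Sum>r\<in>I. y r)" and \<phi>': "\<phi> = (\<Sum>r\<in>I. x r)" using \<phi> by (simp_all add: \<Psi>_def y_def x_def)
  define X where "X = (\<Sum>r\<in>I. x r * y r)"
  have D: "\<Psi> - \<phi> = \<delta> * X"
    unfolding \<Psi> \<phi>' X_def sum_subtractf[symmetric] sum_distrib_left by (intro sum.cong refl diff)
  have "X\<^sup>2 = (\<Sum>r\<in>I. sqrt (x r) * (sqrt (x r) * y r))\<^sup>2"
    unfolding X_def using pos by (intro arg_cong[where f = "\<lambda>z. z\<^sup>2"] sum.cong refl) (simp add: less_imp_le flip: mult.assoc)
  also have "\<dots> \<le> (\<Sum>r\<in>I. (sqrt (x r))\<^sup>2) * (\<Sum>r\<in>I. (sqrt (x r) * y r)\<^sup>2)"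
    by (rule Cauchy_Schwarz_ineq_sum)
  also have "(\<Sum>r\<in>I. (sqrt (x r))\<^sup>2) = \<phi>"
    unfolding \<phi>' using pos by (intro sum.cong refl) (simp add: less_imp_le)
  also have "(\<Sum>r\<in>I. (sqrt (x r) * y r)\<^sup>2) = (\<Sum>r\<in>I. x r * (y r)\<^sup>2)"
    using pos by (intro sum.cong refl) (simp add: less_imp_le power_mult_distrib)
  finally have CS: "X\<^sup>2 \<le> \<phi> * (\<Sum>r\<in>I. x r * (y r)\<^sup>2)" .
  have nn: "(\<Sum>r\<in>I. x r * (y r)\<^sup>2) \<ge> 0" using pos by (intro sum_nonneg mult_nonneg_nonneg) (auto simp: less_imp_le)
  have "\<delta> * X\<^sup>2 \<le> (\<delta> * \<phi>) * (\<Sum>r\<in>I. x r * (y r)\<^sup>2)"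
    using CS \<delta> by (simp add: mult.assoc)
  also have "\<dots> \<le> 1 * (\<Sum>r\<in>I. x r * (y r)\<^sup>2)" using \<delta>\<phi> nn by (rule mult_right_mono)
  finally have "\<delta> * (\<delta> * X\<^sup>2) \<le> \<delta> * (\<Sum>r\<in>I. x r * (y r)\<^sup>2)" using \<delta> by simp
  also have "\<dots> = (\<Sum>r\<in>I. (y r)\<^sup>2) - X"
    unfolding X_def sum_distrib_left sum_subtractf[symmetric]
  proof (intro sum.cong refl)
    fix r assume "r \<in> I"
    from diff[OF this] have "(\<delta> * (x r * y r)) * y r = (y r - x r) * y r" by simp
    then show "\<delta> * (x r * (y r)\<^sup>2) = (y r)\<^sup>2 - x r * y r" by (simp add: power2_eq_square algebra_simps)
  qed
  finally have "\<delta> * (\<delta> * X\<^sup>2) + X \<le> (\<Sum>r\<in>I. (y r)\<^sup>2)" by simp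
  moreover have "(\<Psi> - \<phi>) * (1 / \<delta> - \<phi>) + (\<Psi> - \<phi>) * \<Psi> = \<delta> * (\<delta> * X\<^sup>2) + X"
  proof -
    have "(\<Psi> - \<phi>) * (1 / \<delta> - \<phi>) + (\<Psi> - \<phi>) * \<Psi> = (\<Psi> - \<phi>) / \<delta> + (\<Psi> - \<phi>) * (\<Psi> - \<phi>)"
      by (simp add: algebra_simps)
    also have "\<dots> = \<delta> * (\<delta> * X\<^sup>2) + X" unfolding D using \<delta> by (simp add: power2_eq_square)
    finally show ?thesis .
  qed
  ultimately show "(\<Psi> - \<phi>) * (1 / \<delta> - \<phi>) \<le> (\<Sum>r\<in>I. 1 / (lam r - (l + \<delta>))\<^sup>2) - (\<Psi> - \<phi>) * \<Psi>"
    by (simp add: y_def power_one_over)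
  have "(\<Sum>r\<in>I. 1 * x r) * (\<Sum>r\<in>I. 1 * y r) \<le> (\<Sum>r\<in>I. 1) * (\<Sum>r\<in>I. 1 * (x r * y r))"
  proof (rule chebyshev_weighted[OF fin])
    fix r s assume rs: "r \<in> I" "s \<in> I"
    have mono: "x s \<le> x r \<and> y s \<le> y r" if "lam r \<le> lam s" "r \<in> I" "s \<in> I" for r s
      using that lam[of r] lam[of s] \<delta> by (auto simp: x_def y_def intro!: divide_left_mono mult_pos_pos)
    show "0 \<le> (x r - x s) * (y r - y s)"
      using mono[of r s] mono[of s r] rs by (cases "lam r \<le> lam s") (auto intro: mult_nonneg_nonneg mult_nonpos_nonpos)
  qed simp
  then have "\<phi> * \<Psi> \<le> real (card I) * X" by (simp add: \<phi>' \<Psi> X_def)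
  then have "\<phi> * \<Psi> * \<delta> \<le> real (card I) * X * \<delta>" using \<delta> by (intro mult_right_mono) auto
  then show "\<phi> * \<Psi> * \<delta> \<le> real (card I) * (\<Psi> - \<phi>)" unfolding D by (simp add: mult_ac)
qed

text \<open>
  Maintaining equality of the resolvent trace with \<open>\<phi>\<close>, and not merely an upper bound, keeps the trace
  from becoming small, which would make the vectors that have already been used count too much in the
  averaging argument for the next step.
\<close>
definition barrier :: "'k set \<Rightarrow> ('i \<Rightarrow> 'k \<Rightarrow> complex) \<Rightarrow> real \<Rightarrow> 'i set \<Rightarrow> real \<Rightarrow> bool" where
  "barrier I w \<phi> S l \<longleftrightarrow> (\<exists>lam u. spectral_on I (sum_outer w S) lam u \<and>
     (\<forall>r\<in>I. lam r > l) \<and> (\<Sum>r\<in>I. 1 / (lam r - l)) = \<phi>)"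

text \<open>
  The resolvent trace is continuous and blows up at the smallest eigenvalue; at distance \<open>1 / \<phi>\<close>
  below it the trace is already at least \<open>\<phi>\<close>.
\<close>
lemma raise_barrier:
  fixes mu :: "'a \<Rightarrow> real"
  assumes fin: "finite I" and ne: "I \<noteq> {}" and mu: "\<And>s. s \<in> I \<Longrightarrow> mu s > l"
    and le: "(\<Sum>s\<in>I. 1 / (mu s - l)) \<le> \<phi>" and \<phi>: "\<phi> > 0"
  obtains l' where "l' \<ge> l" "\<And>s. s \<in> I \<Longrightarrow> mu s > l'" "(\<Sum>s\<in>I. 1 / (mu s - l')) = \<phi>"
proof -
  define mn where "mn = Min (mu ` I)"
  have mn: "mn \<le> mu s" if "s \<in> I" for s unfolding mn_def using fin that by simp
  have "mn \<in> mu ` I" unfolding mn_def using fin ne by (intro Min_in) auto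
  then obtain s0 where s0: "s0 \<in> I" "mu s0 = mn" by auto
  define T where "T = mn - 1 / \<phi>"
  have one: "1 / (mn - t) \<le> (\<Sum>s\<in>I. 1 / (mu s - t))" if "t < mn" for t
  proof -
    have "1 / (mu s0 - t) \<le> (\<Sum>s\<in>I. 1 / (mu s - t))"
    proof (rule member_le_sum[OF s0(1) _ fin])
      show "0 \<le> 1 / (mu x - t)" if "x \<in> I - {s0}" for x
        using mn[of x] that \<open>t < mn\<close> by simp
    qed
    then show ?thesis using s0 by simp
  qed
  have lmn: "l < mn" using mu[OF s0(1)] s0 by simp
  have "1 / (mn - l) \<le> \<phi>" using one[OF lmn] le by simp
  then have lT: "l \<le> T" using lmn \<phi> by (simp add: T_def field_simps)
  have Tmn: "T < mn" using \<phi> by (simp add: T_def)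
  have hi: "\<phi> \<le> (\<Sum>s\<in>I. 1 / (mu s - T))" using one[OF Tmn] by (simp add: T_def)
  have cont: "continuous_on {l..T} (\<lambda>t. \<Sum>s\<in>I. 1 / (mu s - t))"
  proof (intro continuous_intros)
    show "\<forall>x\<in>{l..T}. mu s - x \<noteq> 0" if "s \<in> I" for s
      using mn[OF that] Tmn by auto
  qed
  obtain l' where l': "l' \<ge> l" "l' \<le> T" "(\<Sum>s\<in>I. 1 / (mu s - l')) = \<phi>"
    using IVT'[of "\<lambda>t. \<Sum>s\<in>I. 1 / (mu s - t)" l \<phi> T, OF le hi lT cont] by blast
  have "mu s > l'" if "s \<in> I" for s using mn[OF that] Tmn l'(2) by linarith
  then show ?thesis using that l'(1,3) by blast
qed

text \<open>
  One step of the selection.  Adding \<open>w i\<close> keeps the trace at \<open>l + \<delta>\<close> below \<open>\<phi>\<close> as soon as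
  \<open>q i \<ge> (\<Psi> - \<phi>) (1 + p i)\<close>, by the resolvent trace formula.  If no unused \<open>i\<close> qualified, summing over
  the unused \<open>i\<close> would contradict isotropy: for an eigenvector \<open>u r\<close> the full sum of \<open>\<bar>\<langle>w i, u r\<rangle>\<bar>\<^sup>2\<close>
  is \<open>n\<close>, the used vectors contribute exactly \<open>lam r\<close>, and the barrier inequalities bound the remainder
  from below.  In this way no vector is selected twice.
\<close>
lemma barrier_step:
  fixes w :: "'i \<Rightarrow> 'k \<Rightarrow> complex"
  assumes fin: "finite I" "finite N" and ne: "I \<noteq> {}" and SN: "S \<subseteq> N"
    and iso: "\<And>x. (\<Sum>i\<in>N. (cmod (\<Sum>k\<in>I. cnj (w i k) * x k))\<^sup>2) = real (card N) * (\<Sum>k\<in>I. (cmod (x k))\<^sup>2)"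
    and bar: "barrier I w \<phi> S l" and \<delta>: "\<delta> > 0" and \<phi>: "\<phi> > 0" and \<delta>\<phi>: "\<delta> * \<phi> < 1"
    and ln: "l + \<delta> \<le> real (card N)"
    and room: "(real (card N) - (l + \<delta>)) * (1 / \<delta> - \<phi>) - real (card I) / (\<delta> * \<phi>) \<ge> real (card N)"
  shows "\<exists>i\<in>N - S. \<exists>l' \<ge> l + \<delta>. barrier I w \<phi> (insert i S) l'"
proof -
  let ?n = "real (card N)" and ?m = "real (card I)" and ?l' = "l + \<delta>"
  obtain lam u where sp: "spectral_on I (sum_outer w S) lam u" and lam: "\<And>r. r \<in> I \<Longrightarrow> lam r > l"
    and \<phi>eq: "(\<Sum>r\<in>I. 1 / (lam r - l)) = \<phi>"
    using bar unfolding barrier_def by blast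
  have u: "unitary_on I u" using sp by (rule spectral_on_unitary)
  have lam': "lam r > ?l'" if r: "r \<in> I" for r
  proof -
    have "1 / (lam r - l) \<le> \<phi>"
      unfolding \<phi>eq[symmetric] using lam r fin by (intro member_le_sum) (auto simp: less_imp_le)
    then have "1 \<le> \<phi> * (lam r - l)" using lam[OF r] by (simp add: field_simps)
    then have "\<delta> * \<phi> < \<phi> * (lam r - l)" using \<delta>\<phi> by linarith
    then have "\<delta> < lam r - l" using \<phi> by (simp add: mult.commute mult_less_cancel_left_pos)
    then show ?thesis by simp
  qed
  define a where "a i r = (cmod (coord I u (w i) r))\<^sup>2" for i r
  have cmod_cnj: "(cmod (\<Sum>k\<in>I. cnj (w i k) * u r k))\<^sup>2 = a i r" for i r
  proof -
    have "coord I u (w i) r = cnj (\<Sum>k\<in>I. cnj (w i k) * u r k)"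
      unfolding coord_def by (simp add: mult.commute)
    then show ?thesis unfolding a_def by (simp only: complex_mod_cnj)
  qed
  have aN: "(\<Sum>i\<in>N. a i r) = ?n" if "r \<in> I" for r
    using iso[of "u r"] spectral_basis_norm[OF u that] unfolding cmod_cnj by simp
  have aS: "(\<Sum>i\<in>S. a i r) = lam r" if "r \<in> I" for r
    using sum_outer_eigenvalue[OF fin(1) sp that] unfolding cmod_cnj by simp
  have aR: "(\<Sum>i\<in>N - S. a i r) = ?n - lam r" if "r \<in> I" for r
    using aN[OF that] aS[OF that] sum_diff[OF fin(2) SN, of "\<lambda>i. a i r"] by simp
  define \<Psi> where "\<Psi> = (\<Sum>r\<in>I. 1 / (lam r - ?l'))"
  define Q where "Q = (\<Sum>r\<in>I. 1 / (lam r - ?l')\<^sup>2)"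
  define p where "p i = (\<Sum>r\<in>I. a i r / (lam r - ?l'))" for i
  define q where "q i = (\<Sum>r\<in>I. a i r / (lam r - ?l')\<^sup>2)" for i
  have b1: "(\<Psi> - \<phi>) * (1 / \<delta> - \<phi>) \<le> Q - (\<Psi> - \<phi>) * \<Psi>"
    and b2: "\<phi> * \<Psi> * \<delta> \<le> ?m * (\<Psi> - \<phi>)"
    using barrier_trace_inequality[OF fin(1) \<delta> lam' \<phi>eq less_imp_le[OF \<delta>\<phi>]] unfolding \<Psi>_def Q_def by auto
  have \<Psi>0: "\<Psi> > 0" unfolding \<Psi>_def using lam' fin ne by (intro sum_pos) auto
  have m0: "?m > 0" using fin ne by (simp add: card_gt_0_iff)
  have "0 < \<phi> * \<Psi> * \<delta>" using \<phi> \<Psi>0 \<delta> by simp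
  then have "0 < ?m * (\<Psi> - \<phi>)" using b2 by linarith
  then have D0: "\<Psi> - \<phi> > 0" using m0 by (rule zero_less_mult_pos)
  have sumq: "(\<Sum>i\<in>N - S. q i) = (\<Sum>r\<in>I. (?n - lam r) / (lam r - ?l')\<^sup>2)"
    unfolding q_def by (subst sum.swap) (simp add: aR flip: sum_divide_distrib)
  have sump: "(\<Sum>i\<in>N - S. p i) = (\<Sum>r\<in>I. (?n - lam r) / (lam r - ?l'))"
    unfolding p_def by (subst sum.swap) (simp add: aR flip: sum_divide_distrib)
  have q': "(\<Sum>i\<in>N - S. q i) = (?n - ?l') * Q - \<Psi>"
    unfolding sumq Q_def \<Psi>_def sum_distrib_left sum_subtractf[symmetric]
  proof (intro sum.cong refl)
    fix r assume "r \<in> I"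
    define e where "e = lam r - ?l'"
    have "e > 0" using lam'[OF \<open>r \<in> I\<close>] by (simp add: e_def)
    then have "((?n - ?l') - e) / e\<^sup>2 = (?n - ?l') * (1 / e\<^sup>2) - 1 / e"
      by (simp add: diff_divide_distrib power2_eq_square)
    then show "(?n - lam r) / (lam r - ?l')\<^sup>2 = (?n - ?l') * (1 / (lam r - ?l')\<^sup>2) - 1 / (lam r - ?l')"
      by (simp add: e_def)
  qed
  have p': "(\<Sum>i\<in>N - S. p i) = (?n - ?l') * \<Psi> - ?m"
  proof -
    have "(\<Sum>i\<in>N - S. p i) = (\<Sum>r\<in>I. (?n - ?l') * (1 / (lam r - ?l')) - 1)"
      unfolding sump
    proof (intro sum.cong refl)
      fix r assume "r \<in> I"
      from lam'[OF this] show "(?n - lam r) / (lam r - ?l') = (?n - ?l') * (1 / (lam r - ?l')) - 1"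
        by (simp add: field_simps)
    qed
    then show ?thesis by (simp add: sum_subtractf \<Psi>_def sum_distrib_left)
  qed
  (* The averaging argument over the positions that are still unused. *)
  have "\<exists>i\<in>N - S. q i \<ge> (\<Psi> - \<phi>) * (1 + p i)"
  proof (rule ccontr)
    assume "\<not> ?thesis"
    then have "q i - (\<Psi> - \<phi>) * p i \<le> \<Psi> - \<phi>" if "i \<in> N - S" for i
      using that by (force simp: algebra_simps not_le)
    then have "(\<Sum>i\<in>N - S. q i - (\<Psi> - \<phi>) * p i) \<le> (\<Sum>i\<in>N - S. \<Psi> - \<phi>)" by (intro sum_mono)
    also have "\<dots> = real (card (N - S)) * (\<Psi> - \<phi>)" by simp
    also have "\<dots> \<le> ?n * (\<Psi> - \<phi>)" using D0 fin by (intro mult_right_mono) (auto intro!: card_mono)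
    finally have upper: "((?n - ?l') * Q - \<Psi>) - (\<Psi> - \<phi>) * ((?n - ?l') * \<Psi> - ?m) \<le> ?n * (\<Psi> - \<phi>)"
      unfolding sum_subtractf sum_distrib_left[symmetric] p' q' .
    have "\<Psi> \<le> (\<Psi> - \<phi>) * (?m / (\<delta> * \<phi>))"
      using b2 \<phi> \<delta> by (simp add: field_simps)
    moreover have "(?n - ?l') * ((\<Psi> - \<phi>) * (1 / \<delta> - \<phi>)) \<le> (?n - ?l') * (Q - (\<Psi> - \<phi>) * \<Psi>)"
      using b1 ln by (intro mult_left_mono) auto
    moreover have "(\<Psi> - \<phi>) * ?n \<le> (\<Psi> - \<phi>) * ((?n - ?l') * (1 / \<delta> - \<phi>) - ?m / (\<delta> * \<phi>))"
      using room D0 by (intro mult_left_mono) auto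
    ultimately have "(\<Psi> - \<phi>) * ?m \<le> 0" using upper by (simp add: algebra_simps)
    then show False using D0 m0 by (simp add: mult_le_0_iff)
  qed
  then obtain i where i: "i \<in> N - S" and crit: "q i \<ge> (\<Psi> - \<phi>) * (1 + p i)" by blast
  obtain mu w' where sp': "spectral_on I (sum_outer w (insert i S)) mu w'"
    using hermitian_spectral_decomposition[OF fin(1) hermitian_sum_outer] by blast
  have "finite S" using SN fin finite_subset by blast
  interpret rank_one_spectra I lam mu "\<lambda>r. (cmod (coord I u (w i) r))\<^sup>2" "\<lambda>s. (cmod (coord I w' (w i) s))\<^sup>2"
     "\<lambda>r s. (cmod (coord I u (w' s) r))\<^sup>2"
     "\<lambda>r s. Re (coord I u (w' s) r * cnj (coord I u (w i) r) * coord I w' (w i) s)"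
    by (rule spectral_perturbation[OF fin(1) sp sp'])
       (use i \<open>finite S\<close> in \<open>simp add: sum_outer_def add.commute\<close>)
  have mu': "mu s > ?l'" if "s \<in> I" for s using mu_greater[OF lam' that] .
  have p0: "p i \<ge> 0" unfolding p_def a_def using lam' by (intro sum_nonneg) (auto simp: less_imp_le)
  have "(\<Sum>s\<in>I. 1 / (mu s - ?l')) = \<Psi> - q i / (1 + p i)"
    using resolvent_trace[OF lam'] unfolding \<Psi>_def q_def p_def a_def .
  also have "\<dots> \<le> \<phi>" using crit p0 by (simp add: field_simps)
  finally have le: "(\<Sum>s\<in>I. 1 / (mu s - ?l')) \<le> \<phi>" .
  obtain l' where "l' \<ge> ?l'" "\<And>s. s \<in> I \<Longrightarrow> mu s > l'" "(\<Sum>s\<in>I. 1 / (mu s - l')) = \<phi>"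
    using raise_barrier[OF fin(1) ne mu' le \<phi>] by blast
  then have "barrier I w \<phi> (insert i S) l'" using sp' unfolding barrier_def by blast
  then show ?thesis using i \<open>l' \<ge> ?l'\<close> by blast
qed

lemma barrier_form_bound:
  assumes fin: "finite I" and bar: "barrier I w \<phi> S l"
  shows "(\<Sum>i\<in>S. (cmod (\<Sum>k\<in>I. cnj (w i k) * x k))\<^sup>2) \<ge> l * (\<Sum>k\<in>I. (cmod (x k))\<^sup>2)"
proof -
  obtain lam u where sp: "spectral_on I (sum_outer w S) lam u" and lam: "\<And>r. r \<in> I \<Longrightarrow> lam r > l"
    using bar unfolding barrier_def by blast
  have "l * (\<Sum>k\<in>I. (cmod (x k))\<^sup>2) = (\<Sum>r\<in>I. l * (cmod (coord I u x r))\<^sup>2)"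
    unfolding coord_parseval[OF fin spectral_on_unitary[OF sp], of x, symmetric] sum_distrib_left ..
  also have "\<dots> \<le> (\<Sum>r\<in>I. lam r * (cmod (coord I u x r))\<^sup>2)"
    using lam by (intro sum_mono mult_right_mono) (auto simp: less_imp_le)
  also have "\<dots> = (\<Sum>i\<in>S. (cmod (\<Sum>k\<in>I. cnj (w i k) * x k))\<^sup>2)"
    by (rule sum_outer_spectral_form[OF fin sp, symmetric])
  finally show ?thesis .
qed

lemma barrier_start:
  assumes fin: "finite I" and ne: "I \<noteq> {}" and \<phi>: "\<phi> > 0"
  shows "barrier I w \<phi> {} (- real (card I) / \<phi>)"
proof -
  obtain lam u where sp: "spectral_on I (sum_outer w {}) lam u"
    using hermitian_spectral_decomposition[OF fin hermitian_sum_outer] by blast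
  have lam: "lam r = 0" if "r \<in> I" for r
    using spectral_eigenvalue[OF fin sp that] by (simp add: sum_outer_def sesq_form_def)
  have m0: "real (card I) > 0" using fin ne by (simp add: card_gt_0_iff)
  have "(\<Sum>r\<in>I. 1 / (lam r - (- real (card I) / \<phi>))) = (\<Sum>r\<in>I. \<phi> / real (card I))"
    by (intro sum.cong refl) (simp add: lam)
  also have "\<dots> = \<phi>" using m0 by simp
  finally show ?thesis unfolding barrier_def using sp lam m0 \<phi> by (intro exI[of _ lam] exI[of _ u]) auto
qed

text \<open>
  Iterating the step; the procedure stops early once the barrier exceeds \<open>cap\<close>, since the averaging
  argument needs the barrier to stay well below \<open>n\<close>.
\<close>
lemma barrier_climb:
  fixes w :: "'i \<Rightarrow> 'k \<Rightarrow> complex"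
  assumes fin: "finite I" "finite N" and ne: "I \<noteq> {}"
    and iso: "\<And>x. (\<Sum>i\<in>N. (cmod (\<Sum>k\<in>I. cnj (w i k) * x k))\<^sup>2) = real (card N) * (\<Sum>k\<in>I. (cmod (x k))\<^sup>2)"
    and \<delta>: "\<delta> > 0" and \<phi>: "\<phi> > 0" and \<delta>\<phi>: "\<delta> * \<phi> < 1"
    and cap: "cap + \<delta> \<le> real (card N)"
    and room: "(real (card N) - (cap + \<delta>)) * (1 / \<delta> - \<phi>) - real (card I) / (\<delta> * \<phi>) \<ge> real (card N)"
  shows "\<exists>S\<subseteq>N. card S \<le> j \<and> (\<exists>l \<ge> min cap (- real (card I) / \<phi> + real j * \<delta>). barrier I w \<phi> S l)"
proof -
  have "(\<exists>S\<subseteq>N. card S \<le> j \<and> (\<exists>l \<ge> cap. barrier I w \<phi> S l))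
      \<or> (\<exists>S\<subseteq>N. card S = j \<and> (\<exists>l \<ge> - real (card I) / \<phi> + real j * \<delta>. barrier I w \<phi> S l))"
  proof (induction j)
    case 0
    show ?case
      by (rule disjI2, rule exI[of _ "{}"]) (use barrier_start[OF fin(1) ne \<phi>, of w] in auto)
  next
    case (Suc j)
    show ?case
    proof (cases "\<exists>S\<subseteq>N. card S \<le> j \<and> (\<exists>l \<ge> cap. barrier I w \<phi> S l)")
      case True
      then show ?thesis by (meson le_SucI)
    next
      case False
      with Suc obtain S l where S: "S \<subseteq> N" "card S = j" "l \<ge> - real (card I) / \<phi> + real j * \<delta>" "barrier I w \<phi> S l"
        by blast
      with False have l: "l < cap" by (meson linorder_not_le order_refl)
      have pos: "1 / \<delta> - \<phi> > 0" using \<delta> \<delta>\<phi> by (simp add: field_simps)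
      have "(real (card N) - (cap + \<delta>)) * (1 / \<delta> - \<phi>) \<le> (real (card N) - (l + \<delta>)) * (1 / \<delta> - \<phi>)"
        using l pos by (intro mult_right_mono) auto
      then have room': "(real (card N) - (l + \<delta>)) * (1 / \<delta> - \<phi>) - real (card I) / (\<delta> * \<phi>) \<ge> real (card N)"
        using room by linarith
      obtain i l' where i: "i \<in> N - S" and l': "l' \<ge> l + \<delta>" "barrier I w \<phi> (insert i S) l'"
        using barrier_step[OF fin ne S(1) iso S(4) \<delta> \<phi> \<delta>\<phi> _ room'] l cap by auto
      have "finite S" using S fin finite_subset by blast
      then have "card (insert i S) = Suc j" using i S by simp
      moreover have "l' \<ge> - real (card I) / \<phi> + real (Suc j) * \<delta>" using l' S by (simp add: algebra_simps)
      ultimately show ?thesis using i S l' by (intro disjI2 exI[of _ "insert i S"]) auto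
    qed
  qed
  then show ?thesis
  proof
    assume "\<exists>S\<subseteq>N. card S \<le> j \<and> (\<exists>l \<ge> cap. barrier I w \<phi> S l)"
    then obtain S l where "S \<subseteq> N" "card S \<le> j" "l \<ge> cap" "barrier I w \<phi> S l" by blast
    then show ?thesis by (intro exI[of _ S] conjI exI[of _ l]) auto
  next
    assume "\<exists>S\<subseteq>N. card S = j \<and> (\<exists>l \<ge> - real (card I) / \<phi> + real j * \<delta>. barrier I w \<phi> S l)"
    then obtain S l where "S \<subseteq> N" "card S = j" "l \<ge> - real (card I) / \<phi> + real j * \<delta>" "barrier I w \<phi> S l" by blast
    then show ?thesis by (intro exI[of _ S] conjI exI[of _ l]) auto
  qed
qed

text \<open>
  The parameter \<open>\<kappa>\<close> is the reciprocal of the resolvent trace.  The barrier starts at \<open>- \<kappa> m\<close> and climbs by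
  almost \<open>\<kappa> / (1 + \<kappa>)\<close> in each of \<open>\<lceil>b m\<rceil>\<close> steps, so it ends above 0 if \<open>1 + \<kappa> < b\<close>.  The choice
  \<open>\<kappa> = (b - 1) / 4\<close> leaves a final height of order \<open>(b - 1)\<^sup>2 m\<close>; the factor \<open>1 - 3 \<kappa> m / n\<close> in \<open>\<delta>\<close> pays
  for the vectors that are no longer available.
\<close>
lemma isotropic_subsampling:
  fixes w :: "'i \<Rightarrow> 'k \<Rightarrow> complex"
  assumes fin: "finite I" "finite N" and ne: "I \<noteq> {}" and b: "1 < b" "b \<le> 2"
    and n: "real (card N) \<ge> 72 * real (card I)"
    and iso: "\<And>x. (\<Sum>i\<in>N. (cmod (\<Sum>k\<in>I. cnj (w i k) * x k))\<^sup>2) = real (card N) * (\<Sum>k\<in>I. (cmod (x k))\<^sup>2)"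
  obtains S where "S \<subseteq> N" "int (card S) \<le> \<lceil>b * real (card I)\<rceil>"
    "\<And>x. (\<Sum>i\<in>S. (cmod (\<Sum>k\<in>I. cnj (w i k) * x k))\<^sup>2) \<ge> (b - 1)\<^sup>2 * real (card I) / 10 * (\<Sum>k\<in>I. (cmod (x k))\<^sup>2)"
proof -
  define m n \<kappa> where "m = real (card I)" and "n = real (card N)" and "\<kappa> = (b - 1) / 4"
  define \<delta> where "\<delta> = \<kappa> / (1 + \<kappa>) * (1 - 3 * \<kappa> * m / n)"
  have "card I \<noteq> 0" using fin ne by simp
  then have m1: "m \<ge> 1" by (simp add: m_def)
  have n72: "n \<ge> 72 * m" using n by (simp add: m_def n_def)
  have n0: "n > 0" using m1 n72 by linarith
  have \<kappa>: "0 < \<kappa>" "\<kappa> \<le> 1 / 4" using b by (simp_all add: \<kappa>_def)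
  have frac: "3 * \<kappa> * m / n \<le> \<kappa> / 24"
  proof -
    have "3 * \<kappa> * m * 24 \<le> \<kappa> * n" using mult_left_mono[OF n72, of \<kappa>] \<kappa> by simp
    then show ?thesis using n0 by (simp add: field_simps)
  qed
  have frac0: "3 * \<kappa> * m / n \<ge> 0" using \<kappa> m1 n0 by simp
  have \<delta>0: "\<delta> > 0" unfolding \<delta>_def using \<kappa> frac by (intro mult_pos_pos) auto
  have "\<delta> \<le> \<kappa> / (1 + \<kappa>) * 1" unfolding \<delta>_def using \<kappa> frac0 by (intro mult_left_mono) auto
  also have "\<dots> < \<kappa>" using \<kappa> by (simp add: field_simps)
  finally have \<delta>\<kappa>: "\<delta> < \<kappa>" .
  have "\<kappa> * 1 \<le> \<kappa> * m" using m1 \<kappa> by (intro mult_left_mono) auto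
  then have \<kappa>m: "\<kappa> \<le> \<kappa> * m" by simp
  have "\<kappa> * m \<le> 1 / 4 * m" using \<kappa> m1 by (intro mult_right_mono) auto
  then have capn: "2 * (\<kappa> * m) \<le> n" using n72 m1 by linarith
  (* This identity is what determines the value of \<delta>. *)
  have key: "n * (1 + \<kappa>) / \<kappa> = (n - 3 * \<kappa> * m) / \<delta>"
  proof -
    define e where "e = 1 - 3 * \<kappa> * m / n"
    have "e > 0" using frac \<kappa> by (simp add: e_def)
    moreover have "n - 3 * \<kappa> * m = n * e" using n0 by (simp add: e_def field_simps)
    ultimately show ?thesis unfolding \<delta>_def e_def[symmetric] using \<kappa> by simp
  qed
  have room: "(n - (\<kappa> * m + \<delta>)) * (1 / \<delta> - 1 / \<kappa>) - m / (\<delta> * (1 / \<kappa>)) \<ge> n"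
  proof -
    have "1 / \<delta> - 1 / \<kappa> \<ge> 0" using \<delta>0 \<delta>\<kappa> by (simp add: field_simps)
    then have "(n - 2 * (\<kappa> * m)) * (1 / \<delta> - 1 / \<kappa>) \<le> (n - (\<kappa> * m + \<delta>)) * (1 / \<delta> - 1 / \<kappa>)"
      using \<delta>\<kappa> \<kappa>m by (intro mult_right_mono) auto
    moreover have "(n - 2 * (\<kappa> * m)) * (1 / \<delta> - 1 / \<kappa>) - m / (\<delta> * (1 / \<kappa>)) = (n - 3 * \<kappa> * m) / \<delta> - n / \<kappa> + 2 * m"
      using \<kappa> \<delta>0 by (simp add: field_simps)
    moreover have "(n - 3 * \<kappa> * m) / \<delta> = n / \<kappa> + n"
      unfolding key[symmetric] using \<kappa> by (simp add: field_simps)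
    ultimately show ?thesis using m1 by linarith
  qed
  obtain S l where S: "S \<subseteq> N" "card S \<le> nat \<lceil>b * m\<rceil>" and bar: "barrier I w (1 / \<kappa>) S l"
    and l: "l \<ge> min (\<kappa> * m) (- m / (1 / \<kappa>) + real (nat \<lceil>b * m\<rceil>) * \<delta>)"
    using barrier_climb[OF fin ne iso \<delta>0, of "1 / \<kappa>" "\<kappa> * m" "nat \<lceil>b * m\<rceil>"] \<kappa> \<delta>\<kappa> \<kappa>m capn room
    unfolding m_def n_def by (auto simp: field_simps)
  have "(b - 1)\<^sup>2 * m / 10 \<le> \<kappa> * m"
  proof -
    have "(b - 1) * (b - 1) \<le> (b - 1) * 1" using b by (intro mult_left_mono) auto
    then have "(b - 1)\<^sup>2 / 10 \<le> (b - 1) / 10" by (simp add: power2_eq_square)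
    also have "\<dots> \<le> \<kappa>" using b by (simp add: \<kappa>_def)
    finally have "(b - 1)\<^sup>2 / 10 \<le> \<kappa>" .
    then show ?thesis using mult_right_mono[of "(b - 1)\<^sup>2 / 10" \<kappa> m] m1 by simp
  qed
  moreover have "(b - 1)\<^sup>2 * m / 10 \<le> - m / (1 / \<kappa>) + real (nat \<lceil>b * m\<rceil>) * \<delta>"
  proof -
    have "b * m \<le> real (nat \<lceil>b * m\<rceil>)" by linarith
    then have "b * m * \<delta> \<le> real (nat \<lceil>b * m\<rceil>) * \<delta>" using \<delta>0 by (intro mult_right_mono) auto
    moreover have "(b - 1)\<^sup>2 / 10 \<le> b * \<delta> - \<kappa>"
    proof -
      have "\<kappa> / (1 + \<kappa>) * (1 - \<kappa> / 24) \<le> \<delta>" unfolding \<delta>_def using frac \<kappa> by (intro mult_left_mono) auto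
      then have "b * (\<kappa> / (1 + \<kappa>) * (1 - \<kappa> / 24)) \<le> b * \<delta>" using b by (intro mult_left_mono) auto
      moreover have "(b - 1)\<^sup>2 / 10 \<le> b * (\<kappa> / (1 + \<kappa>) * (1 - \<kappa> / 24)) - \<kappa>"
      proof -
        have bk: "b = 1 + 4 * \<kappa>" by (simp add: \<kappa>_def field_simps)
        have "(1 + 4 * \<kappa>) * (1 - \<kappa> / 24) - (1 + \<kappa>) = \<kappa> * (71 / 24 - \<kappa> / 6)"
          by (simp add: field_simps)
        also have "\<dots> \<ge> \<kappa> * (2 * (1 + \<kappa>))" using \<kappa> by (intro mult_left_mono) auto
        finally have "2 * \<kappa> * (1 + \<kappa>) \<le> b * (1 - \<kappa> / 24) - (1 + \<kappa>)" unfolding bk by (simp add: mult_ac)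
        then have "\<kappa> / (1 + \<kappa>) * (2 * \<kappa> * (1 + \<kappa>)) \<le> \<kappa> / (1 + \<kappa>) * (b * (1 - \<kappa> / 24) - (1 + \<kappa>))"
          using \<kappa> by (intro mult_left_mono) auto
        also have "\<dots> = b * (\<kappa> / (1 + \<kappa>) * (1 - \<kappa> / 24)) - \<kappa>" using \<kappa> by (simp add: field_simps)
        also have "\<kappa> / (1 + \<kappa>) * (2 * \<kappa> * (1 + \<kappa>)) = 2 * \<kappa>\<^sup>2" using \<kappa> by (simp add: field_simps power2_eq_square)
        finally have "2 * \<kappa>\<^sup>2 \<le> b * (\<kappa> / (1 + \<kappa>) * (1 - \<kappa> / 24)) - \<kappa>" .
        moreover have "(b - 1)\<^sup>2 = 16 * \<kappa>\<^sup>2" by (simp add: bk power2_eq_square)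
        ultimately show ?thesis using zero_le_power2[of \<kappa>] by linarith
      qed
      ultimately show ?thesis by linarith
    qed
    then have "(b - 1)\<^sup>2 / 10 * m \<le> (b * \<delta> - \<kappa>) * m" using m1 by (intro mult_right_mono) auto
    ultimately show ?thesis by (simp add: algebra_simps)
  qed
  ultimately have "(b - 1)\<^sup>2 * m / 10 \<le> l" using l by linarith
  then have "(\<Sum>i\<in>S. (cmod (\<Sum>k\<in>I. cnj (w i k) * x k))\<^sup>2) \<ge> (b - 1)\<^sup>2 * real (card I) / 10 * (\<Sum>k\<in>I. (cmod (x k))\<^sup>2)" for x
    using barrier_form_bound[OF fin(1) bar, of x] mult_right_mono[of "(b - 1)\<^sup>2 * m / 10" l "\<Sum>k\<in>I. (cmod (x k))\<^sup>2"]
    by (simp add: m_def sum_nonneg)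
  moreover have "int (card S) \<le> \<lceil>b * real (card I)\<rceil>"
  proof -
    have "0 \<le> b * m" using b m1 by simp
    then have "int (nat \<lceil>b * m\<rceil>) = \<lceil>b * m\<rceil>" by simp
    then show ?thesis using S(2) unfolding m_def by linarith
  qed
  ultimately show ?thesis using that S by blast
qed

text \<open>
  Reduction to the isotropic case: in the eigenbasis of the frame operator the vectors are rescaled by
  \<open>sqrt (n / lam r)\<close>, and undoing this costs only the lower frame bound \<open>c\<close>.
\<close>
theorem frame_subsampling:
  fixes y :: "'i \<Rightarrow> 'k \<Rightarrow> complex"
  assumes fin: "finite I" "finite N" and ne: "I \<noteq> {}" and b: "1 < b" "b \<le> 2"
    and n: "real (card N) \<ge> 72 * real (card I)" and c: "c > 0"
    and frame: "\<And>x. (\<Sum>i\<in>N. (cmod (\<Sum>k\<in>I. cnj (y i k) * x k))\<^sup>2) \<ge> c * real (card N) * (\<Sum>k\<in>I. (cmod (x k))\<^sup>2)"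
  obtains S where "S \<subseteq> N" "int (card S) \<le> \<lceil>b * real (card I)\<rceil>"
    "\<And>x. (\<Sum>i\<in>S. (cmod (\<Sum>k\<in>I. cnj (y i k) * x k))\<^sup>2) \<ge> c * ((b - 1)\<^sup>2 * real (card I) / 10) * (\<Sum>k\<in>I. (cmod (x k))\<^sup>2)"
proof -
  define n where "n = real (card N)"
  have "card I \<noteq> 0" using fin ne by simp
  then have n0: "n > 0" using n unfolding n_def by linarith
  obtain lam u where sp: "spectral_on I (sum_outer y N) lam u"
    using hermitian_spectral_decomposition[OF fin(1) hermitian_sum_outer] by blast
  have u: "unitary_on I u" by (rule spectral_on_unitary[OF sp])
  have quad: "(\<Sum>i\<in>N. (cmod (\<Sum>k\<in>I. cnj (y i k) * x k))\<^sup>2) = (\<Sum>r\<in>I. lam r * (cmod (coord I u x r))\<^sup>2)" for x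
    by (rule sum_outer_spectral_form[OF fin(1) sp])
  have lam: "lam r \<ge> c * n" if r: "r \<in> I" for r
    using frame[of "u r"] spectral_basis_norm[OF u r] unfolding sum_outer_eigenvalue[OF fin(1) sp r] n_def by simp
  have lam0: "lam r > 0" if "r \<in> I" for r using lam[OF that] c n0 by (smt (verit) mult_pos_pos)
  define w where "w i r = of_real (sqrt (n / lam r)) * coord I u (y i) r" for i r
  have yw: "(\<Sum>k\<in>I. cnj (y i k) * x k) = (\<Sum>r\<in>I. cnj (w i r) * (of_real (sqrt (lam r / n)) * coord I u x r))" for i x
  proof -
    have "(\<Sum>k\<in>I. cnj (y i k) * x k) = (\<Sum>k\<in>I. x k * cnj (y i k))" by (simp add: mult.commute)
    also have "\<dots> = (\<Sum>r\<in>I. coord I u x r * cnj (coord I u (y i) r))"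
      by (rule coord_inner[OF fin(1) u, symmetric])
    also have "\<dots> = (\<Sum>r\<in>I. cnj (w i r) * (of_real (sqrt (lam r / n)) * coord I u x r))"
    proof (intro sum.cong refl)
      fix r assume "r \<in> I"
      then have "sqrt (n / lam r) * sqrt (lam r / n) = 1"
        using lam0[of r] n0 by (simp flip: real_sqrt_mult)
      then have "complex_of_real (sqrt (n / lam r)) * of_real (sqrt (lam r / n)) = 1"
        unfolding of_real_mult[symmetric] by simp
      then have "coord I u x r * cnj (coord I u (y i) r) = (complex_of_real (sqrt (n / lam r)) * of_real (sqrt (lam r / n))) * (coord I u x r * cnj (coord I u (y i) r))"
        by simp
      then show "coord I u x r * cnj (coord I u (y i) r) = cnj (w i r) * (of_real (sqrt (lam r / n)) * coord I u x r)"
        unfolding w_def by (simp only: complex_cnj_mult complex_cnj_complex_of_real mult_ac)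
    qed
    finally show ?thesis .
  qed
  have iso: "(\<Sum>i\<in>N. (cmod (\<Sum>k\<in>I. cnj (w i k) * x k))\<^sup>2) = real (card N) * (\<Sum>k\<in>I. (cmod (x k))\<^sup>2)" for x
  proof -
    define x' where "x' k = (\<Sum>s\<in>I. of_real (sqrt (n / lam s)) * x s * u s k)" for k
    have cx': "coord I u x' r = of_real (sqrt (n / lam r)) * x r" if r: "r \<in> I" for r
    proof -
      have "coord I u x' r = (\<Sum>k\<in>I. \<Sum>s\<in>I. of_real (sqrt (n / lam s)) * x s * (cnj (u r k) * u s k))"
        unfolding coord_def x'_def sum_distrib_left by (simp only: mult_ac)
      also have "\<dots> = (\<Sum>s\<in>I. of_real (sqrt (n / lam s)) * x s * coord I u (u s) r)"
        unfolding coord_def sum_distrib_left by (rule sum.swap)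
      also have "\<dots> = (\<Sum>s\<in>I. if s = r then of_real (sqrt (n / lam s)) * x s else 0)"
        using coord_basis_vector[OF u r] by (intro sum.cong refl) simp
      also have "\<dots> = of_real (sqrt (n / lam r)) * x r" using fin r by (simp add: sum.delta)
      finally show ?thesis .
    qed
    have "(\<Sum>k\<in>I. cnj (w i k) * x k) = (\<Sum>k\<in>I. cnj (y i k) * x' k)" for i
      unfolding yw
    proof (intro sum.cong refl)
      fix r assume r: "r \<in> I"
      then have "sqrt (lam r / n) * sqrt (n / lam r) = 1"
        using lam0[of r] n0 by (simp flip: real_sqrt_mult)
      then have "of_real (sqrt (lam r / n)) * (of_real (sqrt (n / lam r)) * x r) = x r"
        unfolding mult.assoc[symmetric] of_real_mult[symmetric] by simp
      then show "cnj (w i r) * x r = cnj (w i r) * (of_real (sqrt (lam r / n)) * coord I u x' r)"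
        unfolding cx'[OF r] by simp
    qed
    then have "(\<Sum>i\<in>N. (cmod (\<Sum>k\<in>I. cnj (w i k) * x k))\<^sup>2) = (\<Sum>r\<in>I. lam r * (cmod (coord I u x' r))\<^sup>2)"
      by (simp add: quad)
    also have "\<dots> = (\<Sum>r\<in>I. n * (cmod (x r))\<^sup>2)"
    proof (intro sum.cong refl)
      fix r assume "r \<in> I"
      then show "lam r * (cmod (coord I u x' r))\<^sup>2 = n * (cmod (x r))\<^sup>2"
        using lam0[of r] n0 by (simp add: cx' norm_mult power_mult_distrib)
    qed
    finally show ?thesis by (simp add: n_def sum_distrib_left)
  qed
  obtain S where S: "S \<subseteq> N" "int (card S) \<le> \<lceil>b * real (card I)\<rceil>"
    and Sw: "\<And>x. (\<Sum>i\<in>S. (cmod (\<Sum>k\<in>I. cnj (w i k) * x k))\<^sup>2) \<ge> (b - 1)\<^sup>2 * real (card I) / 10 * (\<Sum>k\<in>I. (cmod (x k))\<^sup>2)"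
    using isotropic_subsampling[OF fin ne b n iso] by blast
  have "(\<Sum>i\<in>S. (cmod (\<Sum>k\<in>I. cnj (y i k) * x k))\<^sup>2) \<ge> c * ((b - 1)\<^sup>2 * real (card I) / 10) * (\<Sum>k\<in>I. (cmod (x k))\<^sup>2)" for x
  proof -
    let ?\<beta> = "(b - 1)\<^sup>2 * real (card I) / 10"
    have "c * ?\<beta> * (\<Sum>k\<in>I. (cmod (x k))\<^sup>2) = ?\<beta> * (\<Sum>r\<in>I. c * (cmod (coord I u x r))\<^sup>2)"
      unfolding coord_parseval[OF fin(1) u, of x, symmetric] sum_distrib_left[symmetric] by simp
    also have "\<dots> \<le> ?\<beta> * (\<Sum>r\<in>I. (cmod (of_real (sqrt (lam r / n)) * coord I u x r))\<^sup>2)"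
    proof (intro mult_left_mono sum_mono)
      fix r assume r: "r \<in> I"
      have "c \<le> lam r / n" using lam[OF r] n0 by (simp add: field_simps)
      then have "c * (cmod (coord I u x r))\<^sup>2 \<le> lam r / n * (cmod (coord I u x r))\<^sup>2"
        by (rule mult_right_mono) simp
      then show "c * (cmod (coord I u x r))\<^sup>2 \<le> (cmod (of_real (sqrt (lam r / n)) * coord I u x r))\<^sup>2"
        using lam0[OF r] n0 by (simp add: norm_mult power_mult_distrib less_imp_le)
    qed simp
    also have "\<dots> \<le> (\<Sum>i\<in>S. (cmod (\<Sum>k\<in>I. cnj (y i k) * x k))\<^sup>2)"
      unfolding yw[of _ x] by (rule Sw)
    finally show ?thesis .
  qed
  then show ?thesis using that S by blast
qed

section \<open>Fourier series on the torus\<close>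

lemma eta_add: "eta (k + l) x = eta k x * eta l x"
  unfolding eta_def by (simp add: distrib_right sum.distrib distrib_left exp_add)

lemma eta_uminus: "eta (- k) x = cnj (eta k x)"
  unfolding eta_def by (simp add: exp_cnj sum_negf)

lemma eta_diff: "eta (k - l) x = eta k x * cnj (eta l x)"
  using eta_add[of k "- l" x] by (simp add: eta_uminus)

lemma eta_zero: "eta 0 x = 1"
  unfolding eta_def by simp

lemma norm_eta: "cmod (eta k x) = 1"
proof -
  have "eta k x = exp (\<i> * of_real (2 * pi * (\<Sum>j\<in>UNIV. of_int (k $ j) * x $ j)))"
    unfolding eta_def by (simp add: mult_ac)
  then show ?thesis by simp
qed

lemma continuous_eta: "continuous_on A (eta k)"
  unfolding eta_def by (intro continuous_intros)

lemma periodic_eta: "periodic1 (eta (k :: int ^ 'd))"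
  unfolding periodic1_def
proof (intro allI)
  fix x :: "real ^ 'd" and j
  have "(\<Sum>i\<in>UNIV. of_int (k $ i) * (x + axis j 1) $ i)
      = (\<Sum>i\<in>UNIV. of_int (k $ i) * x $ i) + (\<Sum>i\<in>UNIV. if i = j then of_int (k $ i) else 0 :: real)"
    unfolding sum.distrib[symmetric] by (intro sum.cong refl) (simp add: axis_def algebra_simps)
  also have "\<dots> = (\<Sum>i\<in>UNIV. of_int (k $ i) * x $ i) + of_int (k $ j)"
    by simp
  finally have "eta k (x + axis j 1) = eta k x * exp (2 * of_real pi * \<i> * of_int (k $ j))"
    unfolding eta_def by (simp add: distrib_left exp_add)
  also have "exp (2 * of_real pi * \<i> * of_int (k $ j)) = 1"
    using exp_integer_2pi[of "of_int (k $ j)"] by (simp add: mult_ac)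
  finally show "eta k (x + axis j 1) = eta k x" by simp
qed

lemma set_integrable_cube:
  fixes f :: "real ^ 'd \<Rightarrow> 'b :: {banach, second_countable_topology}"
  assumes "continuous_on (cbox 0 1) f"
  shows "set_integrable lborel (cbox 0 1) f"
  using borel_integrable_compact[OF compact_cbox assms] unfolding set_integrable_def .

lemma integral_exp_unit_interval:
  fixes n :: int
  shows "(LINT t|lborel. indicator {0..1} t *\<^sub>R exp (2 * of_real pi * \<i> * of_int n * of_real t)) = (if n = 0 then 1 else 0)"
proof -
  let ?c = "2 * of_real pi * \<i> * of_int n :: complex"
  have int: "set_integrable lborel {0..1} (\<lambda>t. exp (?c * of_real t))"
    unfolding set_integrable_def
    by (intro borel_integrable_compact continuous_intros) auto
  have "(LINT t:{0..1}|lborel. exp (?c * of_real t)) = integral {0..1} (\<lambda>t. exp (?c * of_real t))"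
    by (rule set_borel_integral_eq_integral(2)[OF int])
  also have "\<dots> = (if n = 0 then 1 else 0)"
  proof (cases "n = 0")
    case True
    then show ?thesis by simp
  next
    case False
    then have c: "?c \<noteq> 0" by simp
    have "((\<lambda>t. exp (?c * of_real t)) has_integral exp (?c * of_real 1) / ?c - exp (?c * of_real 0) / ?c) {0..1}"
    proof (rule fundamental_theorem_of_calculus)
      fix t :: real assume "t \<in> {0..1}"
      have "((\<lambda>z. exp (?c * z) / ?c) has_field_derivative exp (?c * of_real t)) (at (of_real t))"
        using c by (auto intro!: derivative_eq_intros)
      then show "((\<lambda>t. exp (?c * of_real t) / ?c) has_vector_derivative exp (?c * of_real t)) (at t within {0..1})"
        by (intro has_vector_derivative_real_field)
    qed simp
    moreover have "exp (?c * of_real 1) = 1"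
      using exp_integer_2pi[of "of_int n"] by (simp add: mult_ac)
    ultimately show ?thesis using False by (simp add: integral_unique)
  qed
  finally show ?thesis unfolding set_lebesgue_integral_def .
qed

text \<open>
  Lebesgue measure is a product measure, so the integral factors into one-dimensional ones, of which the
  one in a direction with nonzero frequency vanishes.
\<close>
lemma integral_eta: "(LINT x:cbox 0 1|lborel. eta (k :: int ^ 'd) x) = (if k = 0 then 1 else 0)"
proof -
  define kr :: "real ^ 'd" where "kr = (\<chi> j. of_int (k $ j))"
  define g where "g b t = indicator {0..1} t *\<^sub>R exp (2 * of_real pi * \<i> * of_real (kr \<bullet> b) * of_real t)"
    for b :: "real ^ 'd" and t :: real
  have int_coord: "\<exists>n. kr \<bullet> b = of_int n" if "b \<in> Basis" for b
    using that by (auto simp: Basis_vec_def inner_axis kr_def)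
  have cube: "indicator (cbox 0 1) x = (\<Prod>b\<in>Basis. indicator {0..1} (x \<bullet> b) :: real)" for x :: "real ^ 'd"
  proof -
    have "(1 :: real ^ 'd) \<bullet> b = 1" if "b \<in> Basis" for b
      using that by (auto simp: Basis_vec_def inner_axis)
    then have "x \<in> cbox 0 1 \<longleftrightarrow> (\<forall>b\<in>Basis. x \<bullet> b \<in> {0..1})" by (simp add: mem_box)
    then show ?thesis by (auto simp: indicator_def)
  qed
  have expo: "eta k x = (\<Prod>b\<in>Basis. exp (2 * of_real pi * \<i> * of_real (kr \<bullet> b) * of_real (x \<bullet> b)))" for x
  proof -
    have "(\<Sum>j\<in>UNIV. of_int (k $ j) * x $ j) = kr \<bullet> x" by (simp add: inner_vec_def kr_def)
    also have "\<dots> = (\<Sum>b\<in>Basis. (kr \<bullet> b) * (x \<bullet> b))" by (rule euclidean_inner)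
    finally have "eta k x = exp (\<Sum>b\<in>Basis. 2 * of_real pi * \<i> * of_real (kr \<bullet> b) * of_real (x \<bullet> b))"
      unfolding eta_def by (simp add: sum_distrib_left mult_ac)
    then show ?thesis by (simp add: exp_sum)
  qed
  have prod: "indicator (cbox 0 1) x *\<^sub>R eta k x = (\<Prod>b\<in>Basis. g b (x \<bullet> b))" for x
    unfolding g_def cube expo scaleR_conv_of_real prod.distrib of_real_prod ..
  have gmeas: "g b \<in> borel_measurable borel" for b
    unfolding g_def by measurable
  interpret product_sigma_finite "\<lambda>_ :: real ^ 'd. interval_measure (\<lambda>x. x)"
    unfolding lborel_eq_real[symmetric] by standard
  have "(LINT x:cbox 0 1|lborel. eta k x) = (LINT x|lborel. (\<Prod>b\<in>Basis. g b (x \<bullet> b)))"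
    unfolding set_lebesgue_integral_def prod ..
  also have "\<dots> = (LINT f|(\<Pi>\<^sub>M b\<in>(Basis :: (real ^ 'd) set). interval_measure (\<lambda>x. x)). (\<Prod>b\<in>Basis. g b ((\<Sum>c\<in>Basis. f c *\<^sub>R c) \<bullet> b)))"
    unfolding lborel_def using gmeas by (subst integral_distr) auto
  also have "\<dots> = (LINT f|(\<Pi>\<^sub>M b\<in>(Basis :: (real ^ 'd) set). interval_measure (\<lambda>x. x)). (\<Prod>b\<in>Basis. g b (f b)))"
    by (intro Bochner_Integration.integral_cong prod.cong refl arg_cong[where f = "g _"]) (simp add: inner_sum_left inner_Basis if_distrib sum.delta' cong: if_cong)
  also have "\<dots> = (\<Prod>b\<in>Basis. integral\<^sup>L (interval_measure (\<lambda>x. x)) (g b))"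
  proof (rule product_integral_prod)
    show "integrable (interval_measure (\<lambda>x. x)) (g b)" for b
      unfolding lborel_eq_real[symmetric] g_def
      by (intro borel_integrable_compact continuous_intros) auto
  qed simp
  also have "\<dots> = (\<Prod>b\<in>Basis. if kr \<bullet> b = 0 then 1 else 0)"
  proof (intro prod.cong refl)
    fix b :: "real ^ 'd" assume "b \<in> Basis"
    then obtain n where n: "kr \<bullet> b = of_int n" using int_coord by blast
    show "integral\<^sup>L (interval_measure (\<lambda>x. x)) (g b) = (if kr \<bullet> b = 0 then 1 else 0)"
      unfolding lborel_eq_real[symmetric] g_def n using integral_exp_unit_interval[of n] by simp
  qed
  also have "\<dots> = (if kr = 0 then 1 else 0)"
    by (auto simp: euclidean_eq_iff[of kr 0])
  also have "kr = 0 \<longleftrightarrow> k = 0" by (simp add: vec_eq_iff kr_def)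
  finally show ?thesis .
qed

lemma fourier_coeff_eta: "fourier_coeff (eta l) k = (if k = l then 1 else 0)"
  unfolding fourier_coeff_def eta_diff[symmetric] integral_eta by auto

inductive trig_poly :: "(real ^ 'd \<Rightarrow> complex) \<Rightarrow> bool" where
  monomial: "trig_poly (\<lambda>x. c * eta k x)"
| add: "trig_poly f \<Longrightarrow> trig_poly g \<Longrightarrow> trig_poly (\<lambda>x. f x + g x)"

lemma trig_poly_const: "trig_poly (\<lambda>_. c)"
  using trig_poly.monomial[of c 0] by (simp add: eta_zero)

lemma trig_poly_mult_term: "trig_poly f \<Longrightarrow> trig_poly (\<lambda>x. c * eta k x * f x)"
proof (induction rule: trig_poly.induct)
  case (monomial c' l)
  have "(\<lambda>x. c * eta k x * (c' * eta l x)) = (\<lambda>x. (c * c') * eta (k + l) x)"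
    by (simp add: eta_add mult_ac)
  then show ?case using trig_poly.monomial by metis
next
  case (add f g)
  then have "trig_poly (\<lambda>x. c * eta k x * f x + c * eta k x * g x)" by (intro trig_poly.add)
  then show ?case by (simp add: distrib_left)
qed

lemma trig_poly_mult: "trig_poly f \<Longrightarrow> trig_poly g \<Longrightarrow> trig_poly (\<lambda>x. f x * g x)"
proof (induction rule: trig_poly.induct)
  case (monomial c k)
  then show ?case by (rule trig_poly_mult_term)
next
  case (add f f')
  then have "trig_poly (\<lambda>x. f x * g x + f' x * g x)" by (intro trig_poly.add) auto
  then show ?case by (simp add: distrib_right)
qed

lemma trig_poly_scale: "trig_poly f \<Longrightarrow> trig_poly (\<lambda>x. c * f x)"
  using trig_poly_mult[OF trig_poly_const] .

lemma trig_poly_continuous: "trig_poly f \<Longrightarrow> continuous_on A f"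
  by (induction rule: trig_poly.induct) (auto intro!: continuous_intros continuous_eta)

text \<open>
  Move one coordinate at a time.
\<close>
lemma periodic_int_shift:
  assumes "periodic1 f"
  shows "f (x + (\<chi> j. of_int (n j))) = f (x :: real ^ 'a)"
proof -
  have step: "f (x + axis j 1) = f x" for x j using assms by (simp add: periodic1_def)
  have nat: "f (x + real m *\<^sub>R axis j 1) = f x" for x j m
  proof (induction m)
    case (Suc m)
    have "x + real (Suc m) *\<^sub>R axis j 1 = (x + real m *\<^sub>R axis j 1) + axis j 1"
      by (simp add: algebra_simps)
    then show ?case by (simp only: step Suc.IH)
  qed simp
  have int: "f (x + of_int i *\<^sub>R axis j 1) = f x" for x j and i :: int
  proof (cases "i \<ge> 0")
    case True
    then show ?thesis using nat[of x "nat i" j] by simp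
  next
    case False
    then have "f ((x + of_int i *\<^sub>R axis j 1) + real (nat (- i)) *\<^sub>R axis j 1) = f (x + of_int i *\<^sub>R axis j 1)"
      by (intro nat)
    moreover have "(x + of_int i *\<^sub>R axis j 1) + real (nat (- i)) *\<^sub>R axis j 1 = x"
      using False by (simp add: algebra_simps flip: scaleR_add_left)
    ultimately show ?thesis by simp
  qed
  have "f (x + (\<Sum>j\<in>A. of_int (n j) *\<^sub>R axis j 1)) = f x" if "finite A" for A
    using that
  proof (induction A)
    case (insert j A)
    have "x + (\<Sum>j\<in>insert j A. of_int (n j) *\<^sub>R axis j 1) = (x + (\<Sum>j\<in>A. of_int (n j) *\<^sub>R axis j 1)) + of_int (n j) *\<^sub>R axis j 1"
      using insert by (simp add: algebra_simps)
    then show ?case by (simp only: int insert.IH)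
  qed simp
  from this[OF finite_class.finite_UNIV]
  have "f (x + (\<Sum>j\<in>UNIV. of_int (n j) *\<^sub>R axis j 1)) = f x" .
  moreover have "(\<Sum>j\<in>UNIV. of_int (n j) *\<^sub>R axis j 1) = ((\<chi> j. of_int (n j)) :: real ^ 'a)"
  proof -
    have "(\<Sum>j\<in>UNIV. of_int (n j) *\<^sub>R axis j 1) $ i = (of_int (n i) :: real)" for i
    proof -
      have "(\<Sum>j\<in>UNIV. of_int (n j) *\<^sub>R axis j 1) $ i = (\<Sum>j\<in>UNIV. if j = i then of_int (n j) else 0 :: real)"
        unfolding sum_component by (intro sum.cong refl) (simp add: axis_def)
      then show ?thesis by simp
    qed
    then show ?thesis by (simp add: vec_eq_iff)
  qed
  ultimately show ?thesis by (simp only: finite_class.finite_UNIV)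
qed

text \<open>
  The embedding of the torus as a compact subset of complex space.  Periodic functions are those that
  factor through it, and on its image the trigonometric polynomials separate points.
\<close>
definition torus_map :: "real ^ 'd \<Rightarrow> complex ^ 'd" where
  "torus_map x = (\<chi> j. cis (2 * pi * x $ j))"

lemma torus_map_eq_imp:
  assumes "periodic1 f" "torus_map x = torus_map y"
  shows "f x = f y"
proof -
  have "\<exists>n::int. x $ j = y $ j + of_int n" for j
  proof -
    have "cis (2 * pi * x $ j) = cis (2 * pi * y $ j)"
      using assms(2) by (simp add: torus_map_def vec_eq_iff)
    then have "sin (2 * pi * x $ j) = sin (2 * pi * y $ j) \<and> cos (2 * pi * x $ j) = cos (2 * pi * y $ j)"
      by (simp add: complex_eq_iff)
    then obtain n :: int where "2 * pi * x $ j = 2 * pi * y $ j + 2 * pi * of_int n"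
      unfolding sin_cos_eq_iff by auto
    then have "2 * pi * x $ j = 2 * pi * (y $ j + of_int n)" by (simp add: algebra_simps)
    then show ?thesis by auto
  qed
  then obtain n where "\<And>j. x $ j = y $ j + of_int (n j :: int)" by metis
  then have "x = y + (\<chi> j. of_int (n j))" by (simp add: vec_eq_iff)
  then show ?thesis using periodic_int_shift[OF assms(1), of y n] by simp
qed

lemma torus_map_cube: "\<exists>y\<in>cbox 0 1. torus_map y = torus_map x"
proof (intro bexI)
  show "torus_map (\<chi> j. frac (x $ j)) = torus_map x"
  proof -
    have "cis (2 * pi * frac t) = cis (2 * pi * t)" for t :: real
    proof -
      have "2 * pi * t = 2 * pi * frac t + 2 * pi * of_int \<lfloor>t\<rfloor>" by (simp add: frac_def algebra_simps)
      then have "cis (2 * pi * t) = cis (2 * pi * frac t) * cis (2 * pi * of_int \<lfloor>t\<rfloor>)" by (simp only: cis_mult)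
      then show ?thesis by (simp add: cis_multiple_2pi)
    qed
    then show ?thesis by (simp add: torus_map_def)
  qed
  show "(\<chi> j. frac (x $ j)) \<in> cbox 0 1"
    by (auto simp: mem_box_cart frac_lt_1 less_imp_le)
qed

lemma continuous_torus_map: "continuous_on A torus_map"
  unfolding torus_map_def by (intro continuous_intros)

text \<open>
  Stone-Weierstrass on the compact image \<open>S\<close> of the torus.  A function that factors through the torus map
  induces a continuous function on \<open>S\<close>, because preimages of closed sets are images of compact subsets of
  the cube.
\<close>
lemma real_trig_poly_dense:
  fixes f :: "real ^ 'd \<Rightarrow> real"
  assumes cont: "continuous_on UNIV f" and per: "\<And>x y. torus_map x = torus_map y \<Longrightarrow> f x = f y" and e: "e > 0"
  obtains t where "trig_poly t" "\<And>x. cmod (of_real (f x) - t x) < e"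
proof -
  define S where "S = torus_map ` (cbox 0 1 :: (real ^ 'd) set)"
  (* R consists of the real functions on S whose pullback to the torus is a trigonometric polynomial. *)
  define R where "R = {p :: complex ^ 'd \<Rightarrow> real. continuous_on S p \<and> (\<exists>t. trig_poly t \<and> (\<forall>x. complex_of_real (p (torus_map x)) = t x))}"
  define g where "g y = f (SOME x. x \<in> cbox 0 1 \<and> torus_map x = y)" for y
  have S_compact: "compact S" unfolding S_def by (intro compact_continuous_image continuous_torus_map compact_cbox)
  have in_S: "torus_map x \<in> S" for x unfolding S_def using torus_map_cube[of x] by (metis image_eqI)
  have g: "g (torus_map x) = f x" for x
  proof -
    have "\<exists>y. y \<in> cbox 0 1 \<and> torus_map y = torus_map x" using torus_map_cube[of x] by blast
    then have "torus_map (SOME y. y \<in> cbox 0 1 \<and> torus_map y = torus_map x) = torus_map x"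
      by (rule someI2_ex) simp
    then show ?thesis unfolding g_def by (rule per)
  qed
  have g_cont: "continuous_on S g"
    unfolding continuous_on_closed_vimage[OF compact_imp_closed[OF S_compact]]
  proof (intro allI impI)
    fix B :: "real set" assume "closed B"
    then have "closed (f -` B)" using cont by (intro closed_vimage) (auto simp: continuous_on_eq_continuous_at)
    then have "compact (cbox 0 1 \<inter> f -` B)" by (intro compact_Int_closed compact_cbox)
    then have "compact (torus_map ` (cbox 0 1 \<inter> f -` B))" by (intro compact_continuous_image continuous_torus_map)
    moreover have "torus_map ` (cbox 0 1 \<inter> f -` B) = g -` B \<inter> S"
      unfolding S_def using g by auto
    ultimately show "closed (g -` B \<inter> S)" by (simp add: compact_imp_closed)
  qed
  have coord: "trig_poly (\<lambda>x. of_real (Re (torus_map x $ j)))" "trig_poly (\<lambda>x. of_real (Im (torus_map x $ j)))" for j :: 'd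
  proof -
    have "eta (axis j 1) x = cis (2 * pi * x $ j)" for x
    proof -
      have "(\<Sum>i\<in>UNIV. of_int ((axis j 1 :: int ^ 'd) $ i) * x $ i) = (\<Sum>i\<in>UNIV. if i = j then x $ i else 0)"
        by (intro sum.cong refl) (simp add: axis_def)
      then show ?thesis by (simp add: eta_def cis_conv_exp mult_ac)
    qed
    then have tm: "torus_map x $ j = eta (axis j 1) x" for x by (simp add: torus_map_def)
    have re: "of_real (Re z) = 1 / 2 * z + 1 / 2 * cnj z" and im: "of_real (Im z) = (- \<i> / 2) * z + (\<i> / 2) * cnj z" for z
      by (simp_all add: complex_eq_iff)
    have eqRe: "(\<lambda>x. complex_of_real (Re (torus_map x $ j))) = (\<lambda>x. 1 / 2 * eta (axis j 1) x + 1 / 2 * eta (- axis j 1) x)"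
      unfolding tm eta_uminus using re by blast
    show "trig_poly (\<lambda>x. of_real (Re (torus_map x $ j)))"
      unfolding eqRe by (intro trig_poly.add trig_poly.monomial)
    have eqIm: "(\<lambda>x. complex_of_real (Im (torus_map x $ j))) = (\<lambda>x. (- \<i> / 2) * eta (axis j 1) x + (\<i> / 2) * eta (- axis j 1) x)"
      unfolding tm eta_uminus using im by blast
    show "trig_poly (\<lambda>x. of_real (Im (torus_map x $ j)))"
      unfolding eqIm by (intro trig_poly.add trig_poly.monomial)
  qed
  interpret function_ring_on R S
  proof
    show "compact S" by (rule S_compact)
    show "continuous_on S p" if "p \<in> R" for p using that by (simp add: R_def)
    show "(\<lambda>x. p x + q x) \<in> R" if pq: "p \<in> R" "q \<in> R" for p q
    proof -
      obtain t u where "trig_poly t" "\<forall>x. complex_of_real (p (torus_map x)) = t x" "trig_poly u" "\<forall>x. complex_of_real (q (torus_map x)) = u x"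
        using pq by (auto simp: R_def)
      then show ?thesis using pq
        by (auto simp: R_def intro!: continuous_intros exI[of _ "\<lambda>x. t x + u x"] trig_poly.add)
    qed
    show "(\<lambda>x. p x * q x) \<in> R" if pq: "p \<in> R" "q \<in> R" for p q
    proof -
      obtain t u where "trig_poly t" "\<forall>x. complex_of_real (p (torus_map x)) = t x" "trig_poly u" "\<forall>x. complex_of_real (q (torus_map x)) = u x"
        using pq by (auto simp: R_def)
      then show ?thesis using pq
        by (auto simp: R_def intro!: continuous_intros exI[of _ "\<lambda>x. t x * u x"] trig_poly_mult)
    qed
    show "(\<lambda>_. c) \<in> R" for c
      by (auto simp: R_def intro!: exI[of _ "\<lambda>_. of_real c"] trig_poly_const)
    show "\<exists>p\<in>R. p y \<noteq> p z" if yz: "y \<in> S" "z \<in> S" "y \<noteq> z" for y z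
    proof -
      obtain j where "y $ j \<noteq> z $ j" using yz by (auto simp: vec_eq_iff)
      then have "Re (y $ j) \<noteq> Re (z $ j) \<or> Im (y $ j) \<noteq> Im (z $ j)" by (auto simp: complex_eq_iff)
      moreover have "(\<lambda>y. Re (y $ j)) \<in> R" "(\<lambda>y. Im (y $ j)) \<in> R"
        using coord[of j] by (auto simp: R_def intro!: continuous_intros)
      ultimately show ?thesis
        using bexI[of "\<lambda>p. p y \<noteq> p z" "\<lambda>y. Re (y $ j)" R] bexI[of "\<lambda>p. p y \<noteq> p z" "\<lambda>y. Im (y $ j)" R] by argo
    qed
  qed
  obtain p where p: "p \<in> R" "\<forall>y\<in>S. \<bar>g y - p y\<bar> < e" using Stone_Weierstrass_basic[OF g_cont e] by blast
  from p(1) have "\<exists>t. trig_poly t \<and> (\<forall>x. complex_of_real (p (torus_map x)) = t x)"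
    unfolding R_def by blast
  then obtain t where t: "trig_poly t" "\<And>x. complex_of_real (p (torus_map x)) = t x" by blast
  have "cmod (of_real (f x) - t x) < e" for x
    using p(2) in_S[of x] unfolding t(2)[symmetric] of_real_diff[symmetric] norm_of_real g[symmetric] by blast
  then show ?thesis using that t(1) by blast
qed

lemma trig_poly_dense:
  fixes f :: "real ^ 'd \<Rightarrow> complex"
  assumes cont: "continuous_on UNIV f" and per: "periodic1 f" and e: "e > 0"
  obtains t where "trig_poly t" "\<And>x. cmod (f x - t x) < e"
proof -
  obtain t where t: "trig_poly t" "\<And>x. cmod (of_real (Re (f x)) - t x) < e / 2"
    using real_trig_poly_dense[of "\<lambda>x. Re (f x)" "e / 2"] cont torus_map_eq_imp[OF per] e
    by (metis continuous_on_Re half_gt_zero)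
  obtain u where u: "trig_poly u" "\<And>x. cmod (of_real (Im (f x)) - u x) < e / 2"
    using real_trig_poly_dense[of "\<lambda>x. Im (f x)" "e / 2"] cont torus_map_eq_imp[OF per] e
    by (metis continuous_on_Im half_gt_zero)
  have "cmod (f x - (t x + \<i> * u x)) < e" for x
  proof -
    have "f x - (t x + \<i> * u x) = (of_real (Re (f x)) - t x) + \<i> * (of_real (Im (f x)) - u x)"
      using complex_eq[of "f x"] by (simp add: algebra_simps)
    then have "cmod (f x - (t x + \<i> * u x)) \<le> cmod (of_real (Re (f x)) - t x) + cmod (of_real (Im (f x)) - u x)"
      by (metis norm_triangle_ineq norm_mult norm_ii mult_1)
    then show ?thesis using t(2)[of x] u(2)[of x] by linarith
  qed
  then show ?thesis using that[of "\<lambda>x. t x + \<i> * u x"] trig_poly.add[OF t(1) trig_poly_scale[OF u(1)]] by blast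
qed

lemma measure_unit_cube: "measure lborel (cbox 0 1 :: (real ^ 'd) set) = 1"
proof -
  have "(1 :: real ^ 'd) \<bullet> b = 1" if "b \<in> Basis" for b
    using that by (auto simp: Basis_vec_def inner_axis)
  then show ?thesis by (simp add: content_cbox)
qed

text \<open>
  Such an \<open>h\<close> is orthogonal to all trigonometric polynomials, hence its squared norm equals the
  integral of \<open>h\<close> against \<open>h - t\<close> for every trigonometric polynomial \<open>t\<close>, which is arbitrarily small by density.
\<close>
lemma fourier_uniqueness:
  fixes h :: "real ^ 'd \<Rightarrow> complex"
  assumes cont: "continuous_on UNIV h" and per: "periodic1 h" and zero: "\<And>k. fourier_coeff h k = 0"
  shows "h x = 0"
proof -
  have contc: "continuous_on (cbox 0 1) h" using cont continuous_on_subset by blast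
  have orth: "(LINT x:cbox 0 1|lborel. h x * cnj (t x)) = 0" if "trig_poly t" for t
    using that
  proof (induction rule: trig_poly.induct)
    case (monomial c k)
    have "(LINT x:cbox 0 1|lborel. h x * cnj (c * eta k x)) = (LINT x:cbox 0 1|lborel. cnj c * (h x * cnj (eta k x)))"
      by (simp add: mult_ac)
    also have "\<dots> = cnj c * fourier_coeff h k" by (simp add: fourier_coeff_def)
    finally show ?case using zero by simp
  next
    case (add f g)
    have "(LINT x:cbox 0 1|lborel. h x * cnj (f x + g x)) = (LINT x:cbox 0 1|lborel. h x * cnj (f x) + h x * cnj (g x))"
      by (simp add: distrib_left)
    also have "\<dots> = (LINT x:cbox 0 1|lborel. h x * cnj (f x)) + (LINT x:cbox 0 1|lborel. h x * cnj (g x))"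
      using add by (intro set_integral_add set_integrable_cube continuous_intros contc trig_poly_continuous)
    finally show ?case using add by simp
  qed
  have "bounded (h ` cbox 0 1)" by (intro compact_imp_bounded compact_continuous_image contc compact_cbox)
  then obtain B where B: "B > 0" "\<And>x. x \<in> cbox 0 1 \<Longrightarrow> cmod (h x) \<le> B" unfolding bounded_pos by blast
  have small: "(LINT x:cbox 0 1|lborel. (cmod (h x))\<^sup>2) \<le> B * e" if "e > 0" for e
  proof -
    obtain t where t: "trig_poly t" "\<And>x. cmod (h x - t x) < e"
      using trig_poly_dense[OF cont per \<open>e > 0\<close>] by blast
    have tc: "continuous_on (cbox 0 1) t" by (rule trig_poly_continuous[OF t(1)])
    have "complex_of_real (LINT x:cbox 0 1|lborel. (cmod (h x))\<^sup>2) = (LINT x:cbox 0 1|lborel. h x * cnj (h x))"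
      unfolding complex_norm_square[symmetric] by (rule set_integral_complex_of_real[symmetric])
    also have "\<dots> = (LINT x:cbox 0 1|lborel. h x * cnj (h x)) - (LINT x:cbox 0 1|lborel. h x * cnj (t x))"
      using orth[OF t(1)] by simp
    also have "\<dots> = (LINT x:cbox 0 1|lborel. h x * cnj (h x) - h x * cnj (t x))"
      by (intro set_integral_diff(2)[symmetric] set_integrable_cube continuous_intros contc tc)
    also have "\<dots> = (LINT x:cbox 0 1|lborel. h x * cnj (h x - t x))" by (simp add: right_diff_distrib)
    finally have rep: "complex_of_real (LINT x:cbox 0 1|lborel. (cmod (h x))\<^sup>2) = (LINT x:cbox 0 1|lborel. h x * cnj (h x - t x))" .
    have "\<bar>LINT x:cbox 0 1|lborel. (cmod (h x))\<^sup>2\<bar> = cmod (LINT x:cbox 0 1|lborel. h x * cnj (h x - t x))"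
      using arg_cong[OF rep, of cmod] unfolding norm_of_real .
    also have "\<dots> \<le> (LINT x:cbox 0 1|lborel. cmod (h x * cnj (h x - t x)))"
      by (intro set_integral_norm_bound set_integrable_cube continuous_intros contc tc)
    also have "\<dots> \<le> (LINT x:cbox 0 1|(lborel :: (real ^ 'd) measure). B * e)"
    proof (intro set_integral_mono set_integrable_cube continuous_intros contc tc)
      show "cmod (h x * cnj (h x - t x)) \<le> B * e" if "x \<in> cbox 0 1" for x
        unfolding norm_mult complex_mod_cnj using B that t(2)[of x] by (intro mult_mono) auto
    qed
    also have "\<dots> = B * e" by (simp add: set_lebesgue_integral_def measure_unit_cube)
    finally show ?thesis by linarith
  qed
  have "(LINT x:cbox 0 1|lborel. (cmod (h x))\<^sup>2) \<le> 0"
  proof (rule field_le_epsilon)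
    fix e :: real assume "e > 0"
    then show "(LINT x:cbox 0 1|lborel. (cmod (h x))\<^sup>2) \<le> 0 + e" using small[of "e / B"] B(1) by simp
  qed
  moreover have cc: "continuous_on (cbox 0 1) (\<lambda>x. (cmod (h x))\<^sup>2)" by (intro continuous_intros contc)
  moreover have "(LINT x:cbox 0 1|lborel. (cmod (h x))\<^sup>2) = integral (cbox 0 1) (\<lambda>x. (cmod (h x))\<^sup>2)"
    by (rule set_borel_integral_eq_integral(2)[OF set_integrable_cube[OF cc]])
  moreover have "integral (cbox 0 1) (\<lambda>x. (cmod (h x))\<^sup>2) \<ge> 0"
    by (intro integral_nonneg integrable_continuous cc) auto
  ultimately have "integral (cbox 0 1) (\<lambda>x. (cmod (h x))\<^sup>2) = 0" by linarith
  moreover have "box 0 (1 :: real ^ 'd) \<noteq> {}" unfolding box_ne_empty by (auto simp: Basis_vec_def inner_axis)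
  ultimately have z: "\<forall>x\<in>cbox 0 1. (cmod (h x))\<^sup>2 = 0"
    using integral_cbox_eq_0_iff[OF cc] by auto
  obtain y where y: "y \<in> cbox 0 1" "torus_map y = torus_map x" using torus_map_cube by blast
  have "h y = 0" using z y(1) by auto
  then show ?thesis using torus_map_eq_imp[OF per y(2)] by simp
qed

definition fourier_series :: "(int ^ 'd \<Rightarrow> complex) \<Rightarrow> real ^ 'd \<Rightarrow> complex" where
  "fourier_series c x = (\<Sum>\<^sub>\<infinity>k. c k * eta k x)"

lemma fourier_series_uniform_limit:
  assumes "(\<lambda>k. cmod (c k)) summable_on UNIV"
  shows "uniform_limit UNIV (\<lambda>K x. \<Sum>k\<in>K. c k * eta k x) (fourier_series c) (finite_subsets_at_top UNIV)"
  unfolding fourier_series_def[abs_def]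
  by (rule Weierstrass_m_test_general[where M = "\<lambda>k. cmod (c k)"]) (use assms in \<open>simp_all add: norm_mult norm_eta\<close>)

lemma fourier_series_approx:
  assumes "(\<lambda>k. cmod (c k)) summable_on UNIV" "e > 0" "finite L"
  shows "\<exists>K. finite K \<and> L \<subseteq> K \<and> (\<forall>x. cmod (fourier_series c x - (\<Sum>k\<in>K. c k * eta k x)) < e)"
proof -
  have ev: "\<forall>\<^sub>F K in finite_subsets_at_top UNIV. \<forall>x\<in>UNIV. dist (\<Sum>k\<in>K. c k * eta k x) (fourier_series c x) < e"
    using uniform_limitD[OF fourier_series_uniform_limit[OF assms(1)] assms(2)] .
  have "\<forall>\<^sub>F K in finite_subsets_at_top UNIV. L \<subseteq> K"
    using assms(3) by (auto simp: eventually_finite_subsets_at_top)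
  from eventually_conj[OF this ev] obtain K where "finite K" "L \<subseteq> K" "\<forall>x\<in>UNIV. dist (\<Sum>k\<in>K. c k * eta k x) (fourier_series c x) < e"
    unfolding eventually_finite_subsets_at_top by (metis finite.emptyI order_refl subset_UNIV)
  then show ?thesis by (intro exI[of _ K]) (simp add: dist_norm norm_minus_commute)
qed

lemma fourier_series_has_sum:
  assumes "(\<lambda>k. cmod (c k)) summable_on UNIV"
  shows "((\<lambda>k. c k * eta k x) has_sum fourier_series c x) UNIV"
proof -
  have "(\<lambda>k. c k * eta k x) summable_on UNIV"
    by (rule abs_summable_summable) (use assms in \<open>simp add: norm_mult norm_eta\<close>)
  then show ?thesis unfolding fourier_series_def by (rule has_sum_infsum)
qed

lemma continuous_fourier_series:
  assumes "(\<lambda>k. cmod (c k)) summable_on UNIV"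
  shows "continuous_on UNIV (fourier_series c)"
proof (rule uniform_limit_theorem[OF _ fourier_series_uniform_limit[OF assms]])
  show "\<forall>\<^sub>F K in finite_subsets_at_top UNIV. continuous_on UNIV (\<lambda>x. \<Sum>k\<in>K. c k * eta k x)"
    by (intro always_eventually allI continuous_intros continuous_eta)
qed simp

lemma periodic_fourier_series: "periodic1 (fourier_series c)"
proof -
  have "eta k (x + axis j 1) = eta k x" for k and x :: "real ^ 'a" and j
    using periodic_eta[of k] by (simp add: periodic1_def)
  then show ?thesis unfolding periodic1_def fourier_series_def by simp
qed

lemma set_integral_cube_sum:
  fixes f :: "'i \<Rightarrow> real ^ 'd \<Rightarrow> complex"
  assumes "\<And>i. i \<in> K \<Longrightarrow> continuous_on (cbox 0 1) (f i)"
  shows "(LINT x:cbox 0 1|lborel. (\<Sum>i\<in>K. f i x)) = (\<Sum>i\<in>K. (LINT x:cbox 0 1|lborel. f i x))"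
  using set_integrable_cube[OF assms]
  unfolding set_lebesgue_integral_def set_integrable_def scaleR_sum_right
  by (intro Bochner_Integration.integral_sum) auto

lemma fourier_coeff_diff:
  assumes "continuous_on UNIV f" "continuous_on UNIV g"
  shows "fourier_coeff (\<lambda>x. f x - g x) k = fourier_coeff f k - fourier_coeff g k"
proof -
  have "continuous_on (cbox 0 1) f" "continuous_on (cbox 0 1) g"
    using assms continuous_on_subset by blast+
  then show ?thesis
    unfolding fourier_coeff_def left_diff_distrib
    by (intro set_integral_diff(2) set_integrable_cube continuous_intros continuous_eta)
qed

lemma fourier_coeff_finite_sum:
  assumes "finite K"
  shows "fourier_coeff (\<lambda>x. \<Sum>k\<in>K. c k * eta k x) l = (if l \<in> K then c l else 0)"
proof -
  have "fourier_coeff (\<lambda>x. \<Sum>k\<in>K. c k * eta k x) l = (LINT x:cbox 0 1|lborel. (\<Sum>k\<in>K. c k * (eta k x * cnj (eta l x))))"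
    unfolding fourier_coeff_def by (simp only: sum_distrib_right mult.assoc)
  also have "\<dots> = (\<Sum>k\<in>K. (LINT x:cbox 0 1|lborel. c k * (eta k x * cnj (eta l x))))"
    by (intro set_integral_cube_sum continuous_intros continuous_eta)
  also have "\<dots> = (\<Sum>k\<in>K. c k * fourier_coeff (eta k) l)"
    by (simp add: fourier_coeff_def)
  also have "\<dots> = (\<Sum>k\<in>K. if k = l then c k else 0)"
    by (intro sum.cong refl) (simp add: fourier_coeff_eta)
  finally show ?thesis using assms by simp
qed

lemma fourier_coeff_close:
  assumes f: "continuous_on UNIV f" and g: "continuous_on UNIV g" and e: "\<And>x. cmod (f x - g x) \<le> e"
  shows "cmod (fourier_coeff f l - fourier_coeff g l) \<le> e"
proof -
  have fg: "continuous_on (cbox 0 1) f" "continuous_on (cbox 0 1) g"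
    using f g continuous_on_subset by blast+
  have "fourier_coeff f l - fourier_coeff g l = (LINT x:cbox 0 1|lborel. f x * cnj (eta l x) - g x * cnj (eta l x))"
    unfolding fourier_coeff_def
    by (intro set_integral_diff(2)[symmetric] set_integrable_cube continuous_intros fg continuous_eta)
  also have "cmod \<dots> \<le> (LINT x:cbox 0 1|lborel. cmod (f x * cnj (eta l x) - g x * cnj (eta l x)))"
    by (intro set_integral_norm_bound set_integrable_cube continuous_intros fg continuous_eta)
  also have "\<dots> \<le> (LINT x:cbox 0 1|(lborel :: (real ^ 'a) measure). e)"
  proof (intro set_integral_mono set_integrable_cube continuous_intros fg continuous_eta)
    show "cmod (f x * cnj (eta l x) - g x * cnj (eta l x)) \<le> e" for x
      unfolding left_diff_distrib[symmetric] norm_mult complex_mod_cnj norm_eta using e by simp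
  qed
  also have "\<dots> = e" by (simp add: set_lebesgue_integral_def measure_unit_cube)
  finally show ?thesis .
qed

lemma fourier_coeff_fourier_series:
  assumes "(\<lambda>k. cmod (c k)) summable_on UNIV"
  shows "fourier_coeff (fourier_series c) l = c l"
proof -
  have "cmod (fourier_coeff (fourier_series c) l - c l) \<le> 0 + e" if e: "e > 0" for e
  proof -
    obtain K where K: "finite K" "{l} \<subseteq> K" "\<forall>x. cmod (fourier_series c x - (\<Sum>k\<in>K. c k * eta k x)) < e"
      using fourier_series_approx[OF assms e, of "{l}"] by blast
    have "cmod (fourier_coeff (fourier_series c) l - fourier_coeff (\<lambda>x. \<Sum>k\<in>K. c k * eta k x) l) \<le> e"
      using K by (intro fourier_coeff_close continuous_fourier_series assms continuous_intros continuous_eta) (auto simp: less_imp_le)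
    then show ?thesis using K by (simp add: fourier_coeff_finite_sum)
  qed
  then have "cmod (fourier_coeff (fourier_series c) l - c l) \<le> 0" by (rule field_le_epsilon)
  then show ?thesis by simp
qed

text \<open>
  The difference is continuous and periodic and has vanishing coefficients.
\<close>
lemma fourier_inversion:
  assumes "continuous_on UNIV f" "periodic1 f" and c: "(\<lambda>k. cmod (fourier_coeff f k)) summable_on UNIV"
  shows "f = fourier_series (fourier_coeff f)"
proof
  fix x
  let ?g = "fourier_series (fourier_coeff f)"
  have g: "continuous_on UNIV ?g" by (rule continuous_fourier_series[OF c])
  have "f x - ?g x = 0"
  proof (rule fourier_uniqueness)
    show "continuous_on UNIV (\<lambda>x. f x - ?g x)" by (intro continuous_intros assms g)
    show "periodic1 (\<lambda>x. f x - ?g x)" using assms(2) periodic_fourier_series[of "fourier_coeff f"] by (simp add: periodic1_def)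
    show "fourier_coeff (\<lambda>x. f x - ?g x) k = 0" for k
      by (simp add: fourier_coeff_diff[OF assms(1) g] fourier_coeff_fourier_series[OF c])

  qed
  then show "f x = ?g x" by simp
qed

lemma fourier_series_finite_sum_norm:
  assumes "finite K"
  shows "(LINT x:cbox 0 1|lborel. (cmod (\<Sum>k\<in>K. c k * eta k x))\<^sup>2) = (\<Sum>k\<in>K. (cmod (c k))\<^sup>2)"
proof -
  let ?g = "\<lambda>x. \<Sum>k\<in>K. c k * eta k x"
  have "complex_of_real (LINT x:cbox 0 1|lborel. (cmod (?g x))\<^sup>2) = (LINT x:cbox 0 1|lborel. ?g x * cnj (?g x))"
    unfolding complex_norm_square[symmetric] by (rule set_integral_complex_of_real[symmetric])
  also have "\<dots> = (LINT x:cbox 0 1|lborel. (\<Sum>l\<in>K. cnj (c l) * (?g x * cnj (eta l x))))"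
    unfolding cnj_sum sum_distrib_left by (simp add: mult_ac)
  also have "\<dots> = (\<Sum>l\<in>K. (LINT x:cbox 0 1|lborel. cnj (c l) * (?g x * cnj (eta l x))))"
    by (intro set_integral_cube_sum continuous_intros continuous_eta)
  also have "\<dots> = (\<Sum>l\<in>K. cnj (c l) * fourier_coeff ?g l)"
    by (simp add: fourier_coeff_def)
  also have "\<dots> = of_real (\<Sum>k\<in>K. (cmod (c k))\<^sup>2)"
    unfolding of_real_sum complex_norm_square using assms by (intro sum.cong refl) (simp add: fourier_coeff_finite_sum mult.commute)
  finally show ?thesis using of_real_eq_iff by blast
qed

text \<open>
  Parseval for the partial sums passes to the uniform limit; only the upper bound is recorded.
\<close>
lemma L2_norm_fourier_series_le:
  assumes c: "(\<lambda>k. cmod (c k)) summable_on UNIV" and S: "\<And>K. finite K \<Longrightarrow> (\<Sum>k\<in>K. (cmod (c k))\<^sup>2) \<le> S"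
  shows "(L2_torus_norm (fourier_series c))\<^sup>2 \<le> S"
proof -
  define B where "B = (\<Sum>\<^sub>\<infinity>k. cmod (c k))"
  have B0: "B \<ge> 0" unfolding B_def by (intro infsum_nonneg) auto
  have gc: "continuous_on (cbox 0 1) (fourier_series c)"
    using continuous_fourier_series[OF c] continuous_on_subset by blast
  have le: "(LINT x:cbox 0 1|lborel. (cmod (fourier_series c x))\<^sup>2) \<le> S + e * (2 * B + 1)" if e: "e > 0" "e \<le> 1" for e
  proof -
    obtain K where K: "finite K" "\<forall>x. cmod (fourier_series c x - (\<Sum>k\<in>K. c k * eta k x)) < e"
      using fourier_series_approx[OF c e(1) finite.emptyI] by blast
    let ?g = "\<lambda>x. \<Sum>k\<in>K. c k * eta k x"
    have gB: "cmod (?g x) \<le> B" for x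
    proof -
      have "cmod (?g x) \<le> (\<Sum>k\<in>K. cmod (c k * eta k x))" by (rule norm_sum)
      also have "\<dots> = (\<Sum>k\<in>K. cmod (c k))" by (simp add: norm_mult norm_eta)
      also have "\<dots> \<le> B" unfolding B_def by (intro finite_sum_le_infsum c K) auto
      finally show ?thesis .
    qed
    have pt: "(cmod (fourier_series c x))\<^sup>2 \<le> (cmod (?g x))\<^sup>2 + e * (2 * B + 1)" for x
    proof -
      have "cmod (fourier_series c x) \<le> cmod (?g x) + e"
        using spec[OF K(2), of x] norm_triangle_sub[of "fourier_series c x" "?g x"] by simp
      then have "(cmod (fourier_series c x))\<^sup>2 \<le> (cmod (?g x) + e)\<^sup>2" by (intro power_mono) auto
      also have "\<dots> = (cmod (?g x))\<^sup>2 + e * (2 * cmod (?g x) + e)" by (simp add: power2_eq_square algebra_simps)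
      also have "\<dots> \<le> (cmod (?g x))\<^sup>2 + e * (2 * B + 1)"
        using gB[of x] e by (intro add_left_mono mult_left_mono) auto
      finally show ?thesis .
    qed
    have "(LINT x:cbox 0 1|lborel. (cmod (fourier_series c x))\<^sup>2) \<le> (LINT x:cbox 0 1|lborel. (cmod (?g x))\<^sup>2 + e * (2 * B + 1))"
      using pt by (intro set_integral_mono set_integrable_cube continuous_intros gc continuous_eta) auto
    also have "\<dots> = (LINT x:cbox 0 1|lborel. (cmod (?g x))\<^sup>2) + (LINT x:cbox 0 1|(lborel :: (real ^ 'a) measure). e * (2 * B + 1))"
      by (intro set_integral_add set_integrable_cube continuous_intros continuous_eta)
    also have "\<dots> = (\<Sum>k\<in>K. (cmod (c k))\<^sup>2) + e * (2 * B + 1)"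
      unfolding fourier_series_finite_sum_norm[OF K(1)] by (simp add: set_lebesgue_integral_def measure_unit_cube)
    also have "\<dots> \<le> S + e * (2 * B + 1)" using S[OF K(1)] by simp
    finally show ?thesis .
  qed
  have "(LINT x:cbox 0 1|lborel. (cmod (fourier_series c x))\<^sup>2) \<le> S"
  proof (rule field_le_epsilon)
    fix \<epsilon> :: real assume \<epsilon>: "\<epsilon> > 0"
    define e where "e = min 1 (\<epsilon> / (2 * B + 1))"
    have "e > 0" "e \<le> 1" using \<epsilon> B0 by (auto simp: e_def)
    moreover have "e * (2 * B + 1) \<le> \<epsilon> / (2 * B + 1) * (2 * B + 1)"
      using B0 by (intro mult_right_mono) (auto simp: e_def)
    ultimately show "(LINT x:cbox 0 1|lborel. (cmod (fourier_series c x))\<^sup>2) \<le> S + \<epsilon>"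
      using le[of e] B0 by simp
  qed
  moreover have "(LINT x:cbox 0 1|lborel. (cmod (fourier_series c x))\<^sup>2) \<ge> 0"
    unfolding set_lebesgue_integral_def by (intro integral_nonneg_AE) auto
  ultimately show ?thesis unfolding L2_torus_norm_def by simp
qed

section \<open>Counting in hyperbolic crosses\<close>

definition cross_weight :: "real \<Rightarrow> int \<Rightarrow> real" where
  "cross_weight \<gamma> a = max 1 (\<bar>of_int a\<bar> / \<gamma>)"

lemma cross_weight_ge1: "cross_weight \<gamma> a \<ge> 1"
  by (simp add: cross_weight_def)

lemma cross_weight_le_iff:
  assumes "\<gamma> > 0" "R \<ge> 1"
  shows "cross_weight \<gamma> a \<le> R \<longleftrightarrow> \<bar>of_int a\<bar> \<le> \<gamma> * R"
  using assms by (simp add: cross_weight_def field_simps)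

lemma hyperbolic_cross_altdef:
  "hyperbolic_cross \<gamma> R = {k. (\<Prod>j\<in>UNIV. cross_weight \<gamma> (k $ j)) \<le> R}"
  by (simp add: hyperbolic_cross_def cross_weight_def)

lemma sum_inverse_le:
  "(\<Sum>a=1..n. 1 / real a) \<le> 1 + ln (real n)" if "n \<ge> 1"
  using that
proof (induction n rule: dec_induct)
  case (step n)
  have "1 / real (Suc n) \<le> ln (real (Suc n)) - ln (real n)"
  proof -
    have "ln (real n / real (Suc n)) \<le> real n / real (Suc n) - 1"
      using step by (intro ln_le_minus_one) simp
    also have "\<dots> = - (1 / real (Suc n))" by (simp add: field_simps)
    finally show ?thesis using step by (simp add: ln_div)
  qed
  then show ?case using step by simp
qed simp

lemma int_interval_card:
  assumes "x \<ge> 0"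
  shows "finite {a::int. \<bar>of_int a\<bar> \<le> (x::real)}" "real (card {a::int. \<bar>of_int a\<bar> \<le> x}) \<le> 2 * x + 1"
    "real (card {a::int. \<bar>of_int a\<bar> \<le> x}) \<ge> x"
proof -
  have eq: "{a::int. \<bar>of_int a\<bar> \<le> x} = {- \<lfloor>x\<rfloor>..\<lfloor>x\<rfloor>}"
    by (auto simp: le_floor_iff abs_le_iff minus_le_iff)
  have f: "\<lfloor>x\<rfloor> \<ge> 0" using assms by simp
  show "finite {a::int. \<bar>of_int a\<bar> \<le> x}" unfolding eq by simp
  have c: "real (card {a::int. \<bar>of_int a\<bar> \<le> x}) = 2 * of_int \<lfloor>x\<rfloor> + 1" unfolding eq using f by simp
  show "real (card {a::int. \<bar>of_int a\<bar> \<le> x}) \<le> 2 * x + 1" unfolding c using of_int_floor_le[of x] by linarith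
  show "real (card {a::int. \<bar>of_int a\<bar> \<le> x}) \<ge> x"
    unfolding c using f real_of_int_floor_add_one_gt[of x] by linarith
qed

text \<open>
  For \<open>a \<noteq> 0\<close> the summand is at most \<open>\<gamma> / \<bar>a\<bar>\<close>, so this is a harmonic sum up to \<open>\<gamma> R\<close>.
\<close>
lemma sum_inverse_cross_weight:
  assumes \<gamma>: "\<gamma> > 0" and R: "R \<ge> 1"
  shows "(\<Sum>a\<in>{a. cross_weight \<gamma> a \<le> R}. 1 / cross_weight \<gamma> a) \<le> (1 + 2 * \<gamma> * (1 + \<bar>ln \<gamma>\<bar>)) * (1 + ln R)"
proof -
  define L where "L = nat \<lfloor>\<gamma> * R\<rfloor>"
  have gR: "\<gamma> * R > 0" using \<gamma> R by simp
  have eq: "{a. cross_weight \<gamma> a \<le> R} = {- int L..int L}"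
    unfolding cross_weight_le_iff[OF \<gamma> R] using gR by (auto simp: L_def le_floor_iff abs_le_iff minus_le_iff)
  have split: "{- int L..int L} = {0} \<union> (int ` {1..L} \<union> (\<lambda>a. - int a) ` {1..L})"
  proof (intro equalityI subsetI)
    fix x assume "x \<in> {- int L..int L}"
    then show "x \<in> {0} \<union> (int ` {1..L} \<union> (\<lambda>a. - int a) ` {1..L})"
      by (cases x rule: int_cases3) auto
  qed auto
  have half: "(\<Sum>a\<in>f ` {1..L}. 1 / cross_weight \<gamma> a) \<le> (\<Sum>a=1..L. \<gamma> * (1 / real a))"
    if f: "inj f" "\<And>a. \<bar>f a\<bar> = int a" for f
  proof -
    have "(\<Sum>a\<in>f ` {1..L}. 1 / cross_weight \<gamma> a) = (\<Sum>a=1..L. 1 / cross_weight \<gamma> (f a))"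
      using f(1) by (subst sum.reindex) (auto intro: inj_on_subset)
    also have "\<dots> \<le> (\<Sum>a=1..L. \<gamma> * (1 / real a))"
    proof (intro sum_mono)
      fix a assume "a \<in> {1..L}"
      moreover have "\<bar>real_of_int (f a)\<bar> = real a" using f(2)[of a] by (metis of_int_abs of_int_of_nat_eq)
      ultimately show "1 / cross_weight \<gamma> (f a) \<le> \<gamma> * (1 / real a)"
        using \<gamma> by (auto simp: cross_weight_def field_simps max_def)
    qed
    finally show ?thesis .
  qed
  have pos: "(\<Sum>a\<in>int ` {1..L}. 1 / cross_weight \<gamma> a) \<le> (\<Sum>a=1..L. \<gamma> * (1 / real a))"
    and neg: "(\<Sum>a\<in>(\<lambda>a. - int a) ` {1..L}. 1 / cross_weight \<gamma> a) \<le> (\<Sum>a=1..L. \<gamma> * (1 / real a))"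
    by (rule half; simp add: inj_def)+
  have harm: "(\<Sum>a=1..L. \<gamma> * (1 / real a)) \<le> \<gamma> * ((1 + \<bar>ln \<gamma>\<bar>) * (1 + ln R))"
  proof (cases "L \<ge> 1")
    case True
    have "(\<Sum>a=1..L. \<gamma> * (1 / real a)) = \<gamma> * (\<Sum>a=1..L. 1 / real a)"
      by (simp add: sum_distrib_left)
    also have "\<dots> \<le> \<gamma> * (1 + ln (real L))"
      using sum_inverse_le[OF True] \<gamma> by (intro mult_left_mono) auto
    also have "\<dots> \<le> \<gamma> * (1 + ln (\<gamma> * R))"
    proof -
      have "real L \<le> \<gamma> * R" using gR unfolding L_def by (simp add: of_nat_nat)
      then show ?thesis using True \<gamma> by (intro mult_left_mono add_left_mono ln_mono) auto
    qed
    also have "\<dots> \<le> \<gamma> * ((1 + \<bar>ln \<gamma>\<bar>) * (1 + ln R))"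
    proof (intro mult_left_mono)
      have "0 \<le> \<bar>ln \<gamma>\<bar> * ln R" using R by (intro mult_nonneg_nonneg) auto
      moreover have "(1 + \<bar>ln \<gamma>\<bar>) * (1 + ln R) = 1 + \<bar>ln \<gamma>\<bar> + ln R + \<bar>ln \<gamma>\<bar> * ln R"
        by (simp add: algebra_simps)
      moreover have "ln (\<gamma> * R) = ln \<gamma> + ln R" using \<gamma> R by (simp add: ln_mult)
      ultimately show "1 + ln (\<gamma> * R) \<le> (1 + \<bar>ln \<gamma>\<bar>) * (1 + ln R)" by linarith
    qed (use \<gamma> in simp)
    finally show ?thesis .
  next
    case False
    then show ?thesis using \<gamma> R by simp
  qed
  have "(\<Sum>a\<in>{a. cross_weight \<gamma> a \<le> R}. 1 / cross_weight \<gamma> a)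
      \<le> 1 / cross_weight \<gamma> 0 + ((\<Sum>a\<in>int ` {1..L}. 1 / cross_weight \<gamma> a) + (\<Sum>a\<in>(\<lambda>a. - int a) ` {1..L}. 1 / cross_weight \<gamma> a))"
    unfolding eq split by (subst sum.union_disjoint; (auto simp: ) )+
  also have "\<dots> \<le> 1 + 2 * (\<gamma> * ((1 + \<bar>ln \<gamma>\<bar>) * (1 + ln R)))"
    using pos neg harm by (simp add: cross_weight_def)
  also have "\<dots> \<le> (1 + 2 * \<gamma> * (1 + \<bar>ln \<gamma>\<bar>)) * (1 + ln R)"
    using R by (simp add: algebra_simps)
  finally show ?thesis .
qed

text \<open>
  The hyperbolic cross in the coordinates \<open>S\<close> only, which allows induction on the set of coordinates.
\<close>
definition partial_cross :: "real \<Rightarrow> 'd set \<Rightarrow> real \<Rightarrow> ('d \<Rightarrow> int) set" where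
  "partial_cross \<gamma> S R = {k \<in> PiE S (\<lambda>_. UNIV). (\<Prod>j\<in>S. cross_weight \<gamma> (k j)) \<le> R}"

lemma partial_cross_insert:
  assumes "finite S" "i \<notin> S"
  shows "partial_cross \<gamma> (insert i S) R
    \<subseteq> (\<Union>a\<in>{a. cross_weight \<gamma> a \<le> R}. (\<lambda>f. f(i := a)) ` partial_cross \<gamma> S (R / cross_weight \<gamma> a))"
proof
  fix k assume k: "k \<in> partial_cross \<gamma> (insert i S) R"
  define f where "f = restrict k S"
  have kf: "k = f(i := k i)"
    using k assms by (auto simp: f_def partial_cross_def fun_eq_iff PiE_def extensional_def)
  have prod: "cross_weight \<gamma> (k i) * (\<Prod>j\<in>S. cross_weight \<gamma> (k j)) \<le> R"
    using k assms by (simp add: partial_cross_def)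
  have "(\<Prod>j\<in>S. cross_weight \<gamma> (k j)) \<ge> 1" by (intro prod_ge_1 cross_weight_ge1)
  then have "cross_weight \<gamma> (k i) * 1 \<le> cross_weight \<gamma> (k i) * (\<Prod>j\<in>S. cross_weight \<gamma> (k j))"
    using cross_weight_ge1[of \<gamma> "k i"] by (intro mult_left_mono) auto
  then have 1: "cross_weight \<gamma> (k i) \<le> R" using prod by simp
  have "(\<Prod>j\<in>S. cross_weight \<gamma> (f j)) = (\<Prod>j\<in>S. cross_weight \<gamma> (k j))"
    by (intro prod.cong refl) (simp add: f_def)
  also have "\<dots> \<le> R / cross_weight \<gamma> (k i)"
    using prod cross_weight_ge1[of \<gamma> "k i"] by (simp add: field_simps)
  finally have "f \<in> partial_cross \<gamma> S (R / cross_weight \<gamma> (k i))"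
    by (simp add: partial_cross_def f_def)
  then show "k \<in> (\<Union>a\<in>{a. cross_weight \<gamma> a \<le> R}. (\<lambda>f. f(i := a)) ` partial_cross \<gamma> S (R / cross_weight \<gamma> a))"
    using 1 kf by blast
qed

text \<open>
  Fixing the value \<open>a\<close> of a new coordinate leaves a cross of radius \<open>R / cross_weight \<gamma> a\<close> in the old
  ones; summing these counts gives one harmonic sum and therefore one more factor \<open>1 + ln R\<close>.
  A single coordinate contributes no logarithm, so the power is one less than the number of coordinates.
\<close>
lemma partial_cross_card:
  assumes \<gamma>: "\<gamma> > 0" and S: "finite S" "S \<noteq> {}"
  defines "A \<equiv> 1 + 2 * \<gamma> * (1 + \<bar>ln \<gamma>\<bar>)"
  shows "R \<ge> 1 \<Longrightarrow> finite (partial_cross \<gamma> S R) \<and>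
     real (card (partial_cross \<gamma> S R)) \<le> A ^ card S * R * (1 + ln R) ^ (card S - 1)"
  using S
proof (induction S arbitrary: R rule: finite_ne_induct)
  case (singleton i)
  have sub: "partial_cross \<gamma> {i} R \<subseteq> (\<lambda>a. (\<lambda>_. undefined)(i := a)) ` {a. \<bar>of_int a\<bar> \<le> \<gamma> * R}"
  proof
    fix k assume k: "k \<in> partial_cross \<gamma> {i} R"
    then have "cross_weight \<gamma> (k i) \<le> R" by (simp add: partial_cross_def)
    then have "k i \<in> {a. \<bar>of_int a\<bar> \<le> \<gamma> * R}" using cross_weight_le_iff[OF \<gamma> singleton(1)] by simp
    moreover have "k = (\<lambda>_. undefined)(i := k i)"
      using k by (auto simp: partial_cross_def fun_eq_iff PiE_def extensional_def)
    ultimately show "k \<in> (\<lambda>a. (\<lambda>_. undefined)(i := a)) ` {a. \<bar>of_int a\<bar> \<le> \<gamma> * R}" by blast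
  qed
  have gR: "\<gamma> * R \<ge> 0" using \<gamma> singleton by simp
  have fin: "finite {a::int. \<bar>of_int a\<bar> \<le> \<gamma> * R}" by (rule int_interval_card(1)[OF gR])
  have "card (partial_cross \<gamma> {i} R) \<le> card {a::int. \<bar>of_int a\<bar> \<le> \<gamma> * R}"
    by (rule order_trans[OF card_mono[OF _ sub] card_image_le]) (use fin in auto)
  also have "real \<dots> \<le> 2 * (\<gamma> * R) + 1" by (rule int_interval_card(2)[OF gR])
  also have "\<dots> \<le> 2 * (\<gamma> * R) + 1 * R + 2 * \<gamma> * \<bar>ln \<gamma>\<bar> * R"
  proof -
    have "0 \<le> 2 * \<gamma> * \<bar>ln \<gamma>\<bar> * R" using singleton \<gamma> by (intro mult_nonneg_nonneg) auto
    then show ?thesis using singleton by linarith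
  qed
  also have "\<dots> = A * R" by (simp add: A_def algebra_simps)
  finally show ?case using finite_subset[OF sub] fin by simp
next
  case (insert i S)
  define U where "U = {a. cross_weight \<gamma> a \<le> R}"
  have finU: "finite U" unfolding U_def cross_weight_le_iff[OF \<gamma> insert.prems]
    using \<gamma> insert.prems by (intro int_interval_card(1)) simp
  have A1: "A \<ge> 1" unfolding A_def using \<gamma> by simp
  have IH: "finite (partial_cross \<gamma> S (R / cross_weight \<gamma> a)) \<and>
     real (card (partial_cross \<gamma> S (R / cross_weight \<gamma> a))) \<le> A ^ card S * R * (1 + ln R) ^ (card S - 1) * (1 / cross_weight \<gamma> a)"
    if a: "a \<in> U" for a
  proof -
    let ?w = "cross_weight \<gamma> a"
    have w: "1 \<le> ?w" "?w \<le> R" using a cross_weight_ge1 by (auto simp: U_def)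
    then have Rw: "R / ?w \<ge> 1" "R / ?w \<le> R" using insert.prems by (auto simp: field_simps mult_le_cancel_left1)
    have "(1 + ln (R / ?w)) ^ (card S - 1) \<le> (1 + ln R) ^ (card S - 1)"
      using Rw by (intro power_mono add_left_mono ln_mono) auto
    then have "A ^ card S * (R / ?w) * (1 + ln (R / ?w)) ^ (card S - 1) \<le> A ^ card S * (R / ?w) * (1 + ln R) ^ (card S - 1)"
    proof (intro mult_left_mono)
      show "0 \<le> A ^ card S * (R / ?w)" using A1 Rw by (intro mult_nonneg_nonneg zero_le_power) linarith+
    qed
    then show ?thesis using insert.IH[OF Rw(1)] by (auto simp: field_simps)
  qed
  have sub: "partial_cross \<gamma> (insert i S) R \<subseteq> (\<Union>a\<in>U. (\<lambda>f. f(i := a)) ` partial_cross \<gamma> S (R / cross_weight \<gamma> a))"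
    unfolding U_def by (rule partial_cross_insert) fact+
  have finUn: "finite (\<Union>a\<in>U. (\<lambda>f. f(i := a)) ` partial_cross \<gamma> S (R / cross_weight \<gamma> a))"
    using finU IH by auto
  have "card (partial_cross \<gamma> (insert i S) R) \<le> card (\<Union>a\<in>U. (\<lambda>f. f(i := a)) ` partial_cross \<gamma> S (R / cross_weight \<gamma> a))"
    by (rule card_mono[OF finUn sub])
  also have "\<dots> \<le> (\<Sum>a\<in>U. card ((\<lambda>f. f(i := a)) ` partial_cross \<gamma> S (R / cross_weight \<gamma> a)))"
    by (rule card_UN_le[OF finU])
  also have "\<dots> \<le> (\<Sum>a\<in>U. card (partial_cross \<gamma> S (R / cross_weight \<gamma> a)))"
    using IH by (intro sum_mono card_image_le) auto
  finally have "real (card (partial_cross \<gamma> (insert i S) R)) \<le> (\<Sum>a\<in>U. real (card (partial_cross \<gamma> S (R / cross_weight \<gamma> a))))"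
    by (simp flip: of_nat_sum)
  also have "\<dots> \<le> (\<Sum>a\<in>U. A ^ card S * R * (1 + ln R) ^ (card S - 1) * (1 / cross_weight \<gamma> a))"
    using IH by (intro sum_mono) auto
  also have "\<dots> = A ^ card S * R * (1 + ln R) ^ (card S - 1) * (\<Sum>a\<in>U. 1 / cross_weight \<gamma> a)"
    by (simp only: sum_distrib_left)
  also have "\<dots> \<le> A ^ card S * R * (1 + ln R) ^ (card S - 1) * (A * (1 + ln R))"
    using sum_inverse_cross_weight[OF \<gamma> insert.prems] A1 insert.prems
    unfolding U_def A_def[symmetric] by (intro mult_left_mono) auto
  also have "\<dots> = A ^ card (insert i S) * R * (1 + ln R) ^ (card (insert i S) - 1)"
  proof -
    have "card S \<ge> 1" using insert by (simp add: Suc_le_eq card_gt_0_iff)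
    then have "(1 + ln R) ^ (card S - 1) * (1 + ln R) = (1 + ln R) ^ card S"
      by (metis power_Suc2 Suc_pred' Suc_le_eq One_nat_def)
    then show ?thesis using insert by (simp add: mult_ac)
  qed
  finally show ?case using finite_subset[OF sub finUn] by simp
qed

text \<open>
  The lower bound comes from the points on one coordinate axis.
\<close>
lemma hyperbolic_cross_card:
  assumes \<gamma>: "\<gamma> > 0" and R: "R \<ge> 1"
  shows "finite (hyperbolic_cross \<gamma> R :: (int ^ 'd) set)"
    and "real (card (hyperbolic_cross \<gamma> R :: (int ^ 'd) set))
       \<le> (1 + 2 * \<gamma> * (1 + \<bar>ln \<gamma>\<bar>)) ^ CARD('d) * R * (1 + ln R) ^ (CARD('d) - 1)"
    and "real (card (hyperbolic_cross \<gamma> R :: (int ^ 'd) set)) \<ge> \<gamma> * R"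
proof -
  let ?H = "hyperbolic_cross \<gamma> R :: (int ^ 'd) set"
  have bij: "bij_betw (\<lambda>k. vec_nth k) ?H (partial_cross \<gamma> UNIV R)"
    unfolding bij_betw_def
  proof
    show "inj_on (\<lambda>k. vec_nth k) ?H" by (simp add: inj_on_def vec_eq_iff)
    have "f \<in> (\<lambda>k. vec_nth k) ` ?H" if "f \<in> partial_cross \<gamma> UNIV R" for f
      using that by (intro image_eqI[of _ _ "\<chi> j. f j"]) (auto simp: hyperbolic_cross_altdef partial_cross_def)
    then show "(\<lambda>k. vec_nth k) ` ?H = partial_cross \<gamma> UNIV R"
      by (auto simp: hyperbolic_cross_altdef partial_cross_def)
  qed
  note card = partial_cross_card[OF \<gamma> finite_class.finite_UNIV UNIV_not_empty[where 'a = 'd] R]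
  show fin: "finite ?H" using bij_betw_finite[OF bij] card by simp
  show "real (card ?H) \<le> (1 + 2 * \<gamma> * (1 + \<bar>ln \<gamma>\<bar>)) ^ CARD('d) * R * (1 + ln R) ^ (CARD('d) - 1)"
    using bij_betw_same_card[OF bij] card by simp
  obtain j :: 'd where True by simp
  have gR: "\<gamma> * R \<ge> 0" using \<gamma> R by simp
  have "(\<lambda>a. axis j a) ` {a::int. \<bar>of_int a\<bar> \<le> \<gamma> * R} \<subseteq> ?H"
  proof (intro image_subsetI)
    fix a :: int assume a: "a \<in> {a. \<bar>of_int a\<bar> \<le> \<gamma> * R}"
    have "(\<Prod>i\<in>UNIV. cross_weight \<gamma> (axis j a $ i)) = (\<Prod>i\<in>UNIV. if i = j then cross_weight \<gamma> a else 1)"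
      by (intro prod.cong refl) (auto simp: axis_def cross_weight_def)
    also have "\<dots> = cross_weight \<gamma> a" by simp
    also have "\<dots> \<le> R" using a cross_weight_le_iff[OF \<gamma> R] by simp
    finally show "axis j a \<in> ?H" by (simp add: hyperbolic_cross_altdef)
  qed
  then have "card {a::int. \<bar>of_int a\<bar> \<le> \<gamma> * R} \<le> card ?H"
    using fin by (intro card_inj_on_le[of "\<lambda>a. axis j a"]) (auto simp: inj_on_def axis_eq_axis)
  then show "real (card ?H) \<ge> \<gamma> * R" using int_interval_card(3)[OF gR] by linarith
qed

lemma mix_weight_lower:
  fixes k :: "int ^ 'd"
  assumes \<gamma>: "\<gamma> > 0" and s: "s > 0"
  shows "mix_weight s k \<ge> (min 1 ((2 * pi * \<gamma>) powr (2 * s))) ^ CARD('d) * (\<Prod>j\<in>UNIV. cross_weight \<gamma> (k $ j)) powr (2 * s)"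
proof -
  let ?c = "min 1 ((2 * pi * \<gamma>) powr (2 * s))"
  have c: "0 < ?c" using \<gamma> by simp
  have "?c * cross_weight \<gamma> a powr (2 * s) \<le> 1 + (2 * pi * \<bar>of_int a\<bar>) powr (2 * s)" for a
  proof (cases "\<bar>of_int a\<bar> / \<gamma> \<le> 1")
    case True
    then have "cross_weight \<gamma> a = 1" by (simp add: cross_weight_def)
    then show ?thesis by (simp add: min_def) (smt (verit) powr_ge_zero)
  next
    case False
    then have w: "cross_weight \<gamma> a = \<bar>of_int a\<bar> / \<gamma>" by (simp add: cross_weight_def)
    have "?c * cross_weight \<gamma> a powr (2 * s) \<le> (2 * pi * \<gamma>) powr (2 * s) * (\<bar>of_int a\<bar> / \<gamma>) powr (2 * s)"
      unfolding w by (intro mult_right_mono) auto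
    also have "\<dots> = (2 * pi * \<bar>of_int a\<bar>) powr (2 * s)"
      using \<gamma> by (simp add: mult.assoc flip: powr_mult)
    finally show ?thesis by simp
  qed
  then have "(\<Prod>j\<in>UNIV. ?c * cross_weight \<gamma> (k $ j) powr (2 * s)) \<le> mix_weight s k"
    unfolding mix_weight_def using c by (intro prod_mono) (auto intro!: mult_nonneg_nonneg simp: less_imp_le)
  moreover have "(\<Prod>j\<in>UNIV. ?c * cross_weight \<gamma> (k $ j) powr (2 * s)) = ?c ^ CARD('d) * (\<Prod>j\<in>UNIV. cross_weight \<gamma> (k $ j)) powr (2 * s)"
    using cross_weight_ge1[of \<gamma>] by (simp add: prod.distrib prod_powr_distrib order_trans[OF zero_le_one])
  ultimately show ?thesis by simp
qed

lemma mix_weight_ge1: "mix_weight s k \<ge> 1"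
  unfolding mix_weight_def by (intro prod_ge_1) simp

text \<open>
  With \<open>\<epsilon> = - ln q / 2\<close> the polynomial factor is, up to a constant, a single term of the exponential series
  of \<open>\<epsilon> (i + 2)\<close> and hence dominated by \<open>exp (\<epsilon> i)\<close>; what remains is geometric with ratio \<open>sqrt q\<close>.
\<close>
lemma summable_poly_geometric:
  fixes q :: real
  assumes q: "0 < q" "q < 1"
  shows "summable (\<lambda>i::nat. q ^ i * (real i + 2) ^ n)"
proof -
  define \<epsilon> where "\<epsilon> = - ln q / 2"
  have \<epsilon>: "\<epsilon> > 0" using q by (simp add: \<epsilon>_def)
  have bound: "q ^ i * (real i + 2) ^ n \<le> fact n / \<epsilon> ^ n * exp (2 * \<epsilon>) * (exp (- \<epsilon>)) ^ i" for i
  proof -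
    have "(\<epsilon> * (real i + 2)) ^ n / fact n \<le> exp (\<epsilon> * (real i + 2))"
    proof -
      have "(\<Sum>j\<in>{n}. (\<epsilon> * (real i + 2)) ^ j /\<^sub>R fact j) \<le> (\<Sum>j. (\<epsilon> * (real i + 2)) ^ j /\<^sub>R fact j)"
        using \<epsilon> by (intro sum_le_suminf summable_exp_generic) auto
      then show ?thesis by (simp add: exp_def divide_inverse mult.commute)
    qed
    then have "\<epsilon> ^ n * (real i + 2) ^ n \<le> fact n * exp (\<epsilon> * (real i + 2))"
      unfolding power_mult_distrib by (simp add: pos_divide_le_eq mult.commute)
    then have "(real i + 2) ^ n \<le> fact n / \<epsilon> ^ n * exp (\<epsilon> * (real i + 2))"
      using \<epsilon> by (simp add: pos_le_divide_eq mult.commute)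
    then have "q ^ i * (real i + 2) ^ n \<le> q ^ i * (fact n / \<epsilon> ^ n * exp (\<epsilon> * (real i + 2)))"
      using q by (intro mult_left_mono) auto
    also have "\<dots> = exp (- \<epsilon>) ^ i * exp (- \<epsilon>) ^ i * (fact n / \<epsilon> ^ n * exp (\<epsilon> * (real i + 2)))"
    proof -
      have "q = exp (- \<epsilon>) * exp (- \<epsilon>)" using q by (simp add: \<epsilon>_def flip: exp_add)
      then have "q ^ i = exp (- \<epsilon>) ^ i * exp (- \<epsilon>) ^ i" by (simp only: power_mult_distrib[symmetric])
      then show ?thesis by simp
    qed
    also have "exp (\<epsilon> * (real i + 2)) = exp (2 * \<epsilon>) * exp \<epsilon> ^ i"
      by (simp add: algebra_simps exp_add exp_of_nat2_mult)
    also have "exp (- \<epsilon>) ^ i * exp (- \<epsilon>) ^ i * (fact n / \<epsilon> ^ n * (exp (2 * \<epsilon>) * exp \<epsilon> ^ i))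
        = fact n / \<epsilon> ^ n * exp (2 * \<epsilon>) * exp (- \<epsilon>) ^ i * (exp (- \<epsilon>) * exp \<epsilon>) ^ i"
      by (simp only: power_mult_distrib mult_ac)
    also have "\<dots> = fact n / \<epsilon> ^ n * exp (2 * \<epsilon>) * exp (- \<epsilon>) ^ i"
      by (simp flip: exp_add)
    finally show ?thesis .
  qed
  have "summable (\<lambda>i. fact n / \<epsilon> ^ n * exp (2 * \<epsilon>) * (exp (- \<epsilon>)) ^ i)"
    using \<epsilon> by (intro summable_mult summable_geometric) simp
  then show ?thesis
    by (rule summable_comparison_test[rotated]) (use bound q in \<open>auto intro!: exI[of _ 0]\<close>)
qed

text \<open>
  Dyadic decomposition: in the layer where the product of the cross weights lies between \<open>2 ^ i R\<close> and
  \<open>2 ^ (i + 1) R\<close> there are at most as many frequencies as in the cross of radius \<open>2 ^ (i + 1) R\<close>, each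
  contributing at most a multiple of \<open>(2 ^ i R) powr (- 2 * s)\<close>.  As \<open>2 * s > 1\<close>, the layers decay geometrically up to a
  polynomial factor in \<open>i\<close>.
\<close>
lemma cross_tail_sum:
  assumes \<gamma>: "\<gamma> > 0" and s: "s > 1 / 2"
  obtains B where "B > 0" "\<And>R F. R \<ge> 1 \<Longrightarrow> finite F \<Longrightarrow> F \<inter> hyperbolic_cross \<gamma> R = {} \<Longrightarrow>
     (\<Sum>k\<in>F. 1 / mix_weight s (k :: int ^ 'd)) \<le> B * R powr (1 - 2 * s) * (1 + ln R) ^ (CARD('d) - 1)"
proof -
  define A where "A = (1 + 2 * \<gamma> * (1 + \<bar>ln \<gamma>\<bar>)) ^ CARD('d)"
  define c where "c = (min 1 ((2 * pi * \<gamma>) powr (2 * s))) ^ CARD('d)"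
  define q where "q = 2 powr (1 - 2 * s)"
  define G where "G = (\<Sum>i. q ^ i * (real i + 2) ^ (CARD('d) - 1))"
  have A: "A > 0" unfolding A_def using \<gamma> by (intro zero_less_power) (simp add: add_pos_nonneg)
  have c: "c > 0" unfolding c_def using \<gamma> by simp
  have q: "0 < q" "q < 1" using s by (simp_all add: q_def powr_less_one)
  have sG: "summable (\<lambda>i. q ^ i * (real i + 2) ^ (CARD('d) - 1))" by (rule summable_poly_geometric[OF q])
  have G: "G > 0" unfolding G_def using q by (intro suminf_pos sG) auto
  have "(\<Sum>k\<in>F. 1 / mix_weight s (k :: int ^ 'd)) \<le> (2 * A * G / c) * R powr (1 - 2 * s) * (1 + ln R) ^ (CARD('d) - 1)"
    if R: "R \<ge> 1" and F: "finite F" "F \<inter> hyperbolic_cross \<gamma> R = {}" for R F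
  proof -
    define w where "w k = (\<Prod>j\<in>UNIV. cross_weight \<gamma> (k $ j))" for k :: "int ^ 'd"
    (* lev k is the index of the dyadic layer of k; outside the cross, layer 0 starts at R. *)
    define lev where "lev k = (LEAST i::nat. w k \<le> 2 ^ Suc i * R)" for k
    have w1: "w k \<ge> 1" for k unfolding w_def by (intro prod_ge_1 cross_weight_ge1)
    have ex: "\<exists>i::nat. w k \<le> 2 ^ Suc i * R" for k
    proof -
      obtain i where "w k < 2 ^ i" using real_arch_pow[of 2 "w k"] by auto
      also have "(2::real) ^ i \<le> 2 ^ Suc i * 1" by simp
      also have "\<dots> \<le> 2 ^ Suc i * R" using R by (intro mult_left_mono) auto
      finally show ?thesis by (intro exI[of _ i]) simp
    qed
    have up: "w k \<le> 2 ^ Suc (lev k) * R" for k unfolding lev_def using ex[of k] by (rule LeastI_ex)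
    have low: "w k > 2 ^ lev k * R" if "k \<in> F" for k
    proof (cases "lev k")
      case 0
      have "k \<notin> hyperbolic_cross \<gamma> R" using that F by blast
      then show ?thesis using 0 by (simp add: hyperbolic_cross_altdef w_def)
    next
      case (Suc j)
      then have "\<not> w k \<le> 2 ^ Suc j * R" unfolding lev_def by (intro not_less_Least) simp
      then show ?thesis using Suc by simp
    qed
    define N where "N = Suc (Max (insert 0 (lev ` F)))"
    have N: "lev ` F \<subseteq> {..<N}" unfolding N_def using F by (auto simp: less_Suc_eq_le)
    have layer: "(\<Sum>k\<in>{k \<in> F. lev k = i}. 1 / mix_weight s k)
        \<le> (2 * A / c) * R powr (1 - 2 * s) * (1 + ln R) ^ (CARD('d) - 1) * (q ^ i * (real i + 2) ^ (CARD('d) - 1))" for i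
    proof -
      let ?T = "2 ^ Suc i * R"
      have pos: "2 ^ i * R > 0" using R by simp
      have T1: "?T \<ge> 1"
      proof -
        have "1 * 1 \<le> (2 :: real) ^ Suc i * R" by (intro mult_mono one_le_power R) auto
        then show ?thesis by simp
      qed
      have "(\<Sum>k\<in>{k \<in> F. lev k = i}. 1 / mix_weight s k) \<le> (\<Sum>k\<in>{k \<in> F. lev k = i}. 1 / (c * (2 ^ i * R) powr (2 * s)))"
      proof (intro sum_mono)
        fix k assume k: "k \<in> {k \<in> F. lev k = i}"
        have "(2 ^ i * R) powr (2 * s) \<le> w k powr (2 * s)"
          using low[of k] k pos s by (intro powr_mono2) auto
        then have "c * (2 ^ i * R) powr (2 * s) \<le> c * w k powr (2 * s)" using c by (intro mult_left_mono) auto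
        also have "\<dots> \<le> mix_weight s k" unfolding c_def w_def using mix_weight_lower[OF \<gamma>, of s k] s by simp
        finally show "1 / mix_weight s k \<le> 1 / (c * (2 ^ i * R) powr (2 * s))"
          using c pos by (intro divide_left_mono mult_pos_pos) (auto intro: less_le_trans[OF zero_less_one mix_weight_ge1])
      qed
      also have "\<dots> = real (card {k \<in> F. lev k = i}) * (1 / (c * (2 ^ i * R) powr (2 * s)))" by simp
      also have "\<dots> \<le> (A * ?T * (1 + ln ?T) ^ (CARD('d) - 1)) * (1 / (c * (2 ^ i * R) powr (2 * s)))"
      proof (intro mult_right_mono)
        have "{k \<in> F. lev k = i} \<subseteq> hyperbolic_cross \<gamma> ?T"
          using up by (auto simp: hyperbolic_cross_altdef w_def)
        then have "card {k \<in> F. lev k = i} \<le> card (hyperbolic_cross \<gamma> ?T :: (int ^ 'd) set)"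
          by (intro card_mono hyperbolic_cross_card(1) \<gamma> T1)
        also have "real \<dots> \<le> A * ?T * (1 + ln ?T) ^ (CARD('d) - 1)"
          unfolding A_def by (intro hyperbolic_cross_card(2) \<gamma> T1)
        finally show "real (card {k \<in> F. lev k = i}) \<le> A * ?T * (1 + ln ?T) ^ (CARD('d) - 1)" by simp
      qed (use c in simp)
      also have "\<dots> \<le> (A * ?T * ((1 + ln R) * (real i + 2)) ^ (CARD('d) - 1)) * (1 / (c * (2 ^ i * R) powr (2 * s)))"
      proof (intro mult_right_mono mult_left_mono power_mono)
        have "ln ?T = real (Suc i) * ln 2 + ln R" using R by (simp add: ln_mult ln_realpow algebra_simps)
        also have "\<dots> \<le> real (Suc i) * 1 + ln R" using ln_2_less_1 by (intro add_right_mono mult_left_mono) auto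
        finally have "1 + ln ?T \<le> 2 + real i + ln R" by simp
        also have "\<dots> \<le> (1 + ln R) * (real i + 2)"
        proof -
          have "0 \<le> ln R * (real i + 1)" using R by simp
          then show ?thesis by (simp add: algebra_simps)
        qed
        finally show "1 + ln ?T \<le> (1 + ln R) * (real i + 2)" .
        show "0 \<le> 1 + ln ?T" using T1 by (simp del: power_Suc)
      qed (use A c R in auto)
      also have "\<dots> = (2 * A / c) * (1 + ln R) ^ (CARD('d) - 1) * (real i + 2) ^ (CARD('d) - 1) * ((2 ^ i * R) / (2 ^ i * R) powr (2 * s))"
      proof -
        have "(A * (2 * t) * (x * y)) * (1 / (c * p)) = (2 * A / c) * x * y * (t / p)" for t x y p :: real
          by simp
        from this[of "2 ^ i * R"] show ?thesis unfolding power_mult_distrib power_Suc by (simp only: mult.assoc)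
      qed
      also have "(2 ^ i * R) / (2 ^ i * R) powr (2 * s) = (2 ^ i * R) powr (1 - 2 * s)"
        using pos by (simp add: powr_diff)
      also have "\<dots> = q ^ i * R powr (1 - 2 * s)"
      proof -
        have "(2 ^ i :: real) powr (1 - 2 * s) = q ^ i"
          unfolding q_def by (simp add: powr_powr mult.commute flip: powr_realpow)
        then show ?thesis using R by (simp add: powr_mult)
      qed
      finally show ?thesis by (simp add: mult_ac)
    qed
    have "(\<Sum>k\<in>F. 1 / mix_weight s k) = (\<Sum>i<N. \<Sum>k\<in>{k \<in> F. lev k = i}. 1 / mix_weight s k)"
      by (rule sum.group[symmetric]) (use F N in auto)
    also have "\<dots> \<le> (\<Sum>i<N. (2 * A / c) * R powr (1 - 2 * s) * (1 + ln R) ^ (CARD('d) - 1) * (q ^ i * (real i + 2) ^ (CARD('d) - 1)))"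
      by (intro sum_mono layer)
    also have "\<dots> = (2 * A / c) * R powr (1 - 2 * s) * (1 + ln R) ^ (CARD('d) - 1) * (\<Sum>i<N. q ^ i * (real i + 2) ^ (CARD('d) - 1))"
      by (simp only: sum_distrib_left)
    also have "\<dots> \<le> (2 * A / c) * R powr (1 - 2 * s) * (1 + ln R) ^ (CARD('d) - 1) * G"
      unfolding G_def using A c q R by (intro mult_left_mono sum_le_suminf sG) auto
    finally show ?thesis by (simp add: mult_ac)
  qed
  moreover have "2 * A * G / c > 0" using A G c by simp
  ultimately show ?thesis using that by blast
qed

lemma summable_inverse_mix_weight:
  assumes s: "s > 1 / 2"
  shows "(\<lambda>k :: int ^ 'd. 1 / mix_weight s k) summable_on UNIV"
proof -
  obtain B where B: "B > 0" "\<And>R F. R \<ge> 1 \<Longrightarrow> finite F \<Longrightarrow> F \<inter> hyperbolic_cross 1 R = {} \<Longrightarrow>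
     (\<Sum>k\<in>F. 1 / mix_weight s (k :: int ^ 'd)) \<le> B * R powr (1 - 2 * s) * (1 + ln R) ^ (CARD('d) - 1)"
    using cross_tail_sum[OF zero_less_one s, where ?'d = 'd] by blast
  let ?H = "hyperbolic_cross 1 1 :: (int ^ 'd) set"
  have finH: "finite ?H" by (intro hyperbolic_cross_card(1)) auto
  have nn: "1 / mix_weight s k \<ge> 0" for k :: "int ^ 'd" using mix_weight_ge1[of s k] by simp
  have "(\<Sum>k\<in>F. 1 / mix_weight s k) \<le> B + (\<Sum>k\<in>?H. 1 / mix_weight s k)" if F: "finite F" for F :: "(int ^ 'd) set"
  proof -
    have "(\<Sum>k\<in>F. 1 / mix_weight s k) = (\<Sum>k\<in>F - ?H. 1 / mix_weight s k) + (\<Sum>k\<in>F \<inter> ?H. 1 / mix_weight s k)"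
      using F by (subst sum.union_disjoint[symmetric]) (auto intro!: sum.cong)
    also have "(\<Sum>k\<in>F - ?H. 1 / mix_weight s k) \<le> B" using B(2)[of 1 "F - ?H"] F by auto
    also have "(\<Sum>k\<in>F \<inter> ?H. 1 / mix_weight s k) \<le> (\<Sum>k\<in>?H. 1 / mix_weight s k)"
      using finH nn by (intro sum_mono2) auto
    finally show ?thesis by simp
  qed
  then show ?thesis
    by (intro nonneg_bdd_above_summable_on bdd_aboveI[of _ "B + (\<Sum>k\<in>?H. 1 / mix_weight s k)"]) (use nn in auto)
qed

text \<open>
  Outside the cross the weights are at least a multiple of \<open>R powr (2 * s)\<close>, and the tail sum is at most
  a multiple of \<open>R powr (1 - 2 * s)\<close> times a power of the logarithm.  The cardinality \<open>m\<close> satisfies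
  \<open>\<gamma> R \<le> m \<le> A R (ln m) ^ (d - 1)\<close>: the lower bound allows \<open>ln R\<close> to be replaced by \<open>ln m\<close>, and the upper bound
  \<open>R\<close> by \<open>m / (A (ln m) ^ (d - 1))\<close>.  Both estimates then carry the same power of the logarithm.
\<close>
theorem hyperbolic_cross_weight_bounds:
  assumes \<gamma>: "\<gamma> > 0" and s: "s > 1 / 2"
  obtains C where "C \<ge> 1"
    "\<And>R (H :: (int ^ 'd) set) k. 1 < R \<Longrightarrow> H = hyperbolic_cross \<gamma> R \<Longrightarrow> card H \<ge> 3 \<Longrightarrow> k \<notin> H \<Longrightarrow>
       1 / mix_weight s k \<le> C * (real (card H) powr (- 2 * s) * ln (real (card H)) powr ((real CARD('d) - 1) * 2 * s))"
    "\<And>R (H :: (int ^ 'd) set) F. 1 < R \<Longrightarrow> H = hyperbolic_cross \<gamma> R \<Longrightarrow> card H \<ge> 3 \<Longrightarrow> finite F \<Longrightarrow> F \<inter> H = {} \<Longrightarrow>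
       (\<Sum>k\<in>F. 1 / mix_weight s k) \<le> C * (real (card H) powr (- 2 * s + 1) * ln (real (card H)) powr ((real CARD('d) - 1) * 2 * s))"
proof -
  let ?d = "CARD('d)"
  obtain B where B: "B > 0" "\<And>R F. R \<ge> 1 \<Longrightarrow> finite F \<Longrightarrow> F \<inter> hyperbolic_cross \<gamma> R = {} \<Longrightarrow>
     (\<Sum>k\<in>F. 1 / mix_weight s (k :: int ^ 'd)) \<le> B * R powr (1 - 2 * s) * (1 + ln R) ^ (?d - 1)"
    using cross_tail_sum[OF \<gamma> s, where ?'d = 'd] by blast
  define c where "c = (min 1 ((2 * pi * \<gamma>) powr (2 * s))) ^ ?d"
  define g where "g = 2 + \<bar>ln \<gamma>\<bar>"
  define A where "A = (1 + 2 * \<gamma> * (1 + \<bar>ln \<gamma>\<bar>)) ^ ?d * g ^ (?d - 1)"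
  have c: "c > 0" unfolding c_def using \<gamma> by simp
  have g: "g > 0" unfolding g_def by simp
  have A: "A > 0" unfolding A_def using \<gamma> g by (intro mult_pos_pos zero_less_power) (simp_all add: add_pos_nonneg)
  have d1: "real (?d - 1) = real ?d - 1" by (simp add: of_nat_diff Suc_leI)
  have main: "1 + ln R \<le> g * ln (real (card H)) \<and> 1 \<le> ln (real (card H)) \<and> real (card H) / (A * ln (real (card H)) ^ (?d - 1)) \<le> R"
    if R: "1 < R" and H: "H = hyperbolic_cross \<gamma> R" "card H \<ge> 3" for R and H :: "(int ^ 'd) set"
  proof -
    define m where "m = real (card H)"
    have m3: "m \<ge> 3" using H by (simp add: m_def)
    have "exp 1 \<le> m" using exp_le m3 by linarith
    then have L1: "1 \<le> ln m" using m3 by (subst ln_ge_iff) auto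
    have "\<gamma> * R \<le> m" unfolding m_def H(1) using hyperbolic_cross_card(3)[OF \<gamma>, of R, where ?'d = 'd] R by simp
    then have "ln (\<gamma> * R) \<le> ln m" using \<gamma> R m3 by (intro ln_mono) auto
    then have "ln R \<le> ln m + \<bar>ln \<gamma>\<bar> * 1" using \<gamma> R by (simp add: ln_mult)
    also have "\<dots> \<le> ln m + \<bar>ln \<gamma>\<bar> * ln m" using L1 by (intro add_left_mono mult_left_mono) auto
    finally have lnR: "1 + ln R \<le> g * ln m" using L1 by (simp add: g_def algebra_simps)
    have "m \<le> (1 + 2 * \<gamma> * (1 + \<bar>ln \<gamma>\<bar>)) ^ ?d * R * (1 + ln R) ^ (?d - 1)"
      unfolding m_def H(1) using hyperbolic_cross_card(2)[OF \<gamma>, of R, where ?'d = 'd] R by simp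
    also have "\<dots> \<le> (1 + 2 * \<gamma> * (1 + \<bar>ln \<gamma>\<bar>)) ^ ?d * R * (g * ln m) ^ (?d - 1)"
      using lnR R \<gamma> by (intro mult_left_mono power_mono) auto
    also have "\<dots> = R * (A * ln m ^ (?d - 1))" by (simp add: A_def power_mult_distrib)
    finally have "m / (A * ln m ^ (?d - 1)) \<le> R"
      using A L1 by (subst pos_divide_le_eq) auto
    then show ?thesis using lnR L1 by (simp add: m_def)
  qed
  define C where "C = max 1 (max (A powr (2 * s) / c) (B * A powr (2 * s - 1) * g ^ (?d - 1)))"
  show ?thesis
  proof (rule that[of C])
    show "C \<ge> 1" by (simp add: C_def)
  next
    fix R and H :: "(int ^ 'd) set" and k
    assume R: "1 < R" and H: "H = hyperbolic_cross \<gamma> R" "card H \<ge> 3" and k: "k \<notin> H"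
    define m L where "m = real (card H)" and "L = ln (real (card H))"
    have m: "m > 0" using H by (simp add: m_def)
    have L: "L \<ge> 1" and Rm: "m / (A * L ^ (?d - 1)) \<le> R" using main[OF R H] by (simp_all add: m_def L_def)
    have AL: "A * L ^ (?d - 1) > 0" using A L by simp
    define w where "w = (\<Prod>j\<in>UNIV. cross_weight \<gamma> (k $ j))"
    have "w > R" using k H by (simp add: hyperbolic_cross_altdef w_def)
    then have "(m / (A * L ^ (?d - 1))) powr (2 * s) \<le> w powr (2 * s)"
      using Rm m AL s by (intro powr_mono2) auto
    then have "c * (m / (A * L ^ (?d - 1))) powr (2 * s) \<le> c * w powr (2 * s)" using c by (intro mult_left_mono) auto
    also have "\<dots> \<le> mix_weight s k" unfolding c_def w_def using mix_weight_lower[OF \<gamma>, of s k] s by simp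
    finally have "1 / mix_weight s k \<le> 1 / (c * (m / (A * L ^ (?d - 1))) powr (2 * s))"
    proof (intro divide_left_mono mult_pos_pos)
      show "0 < mix_weight s k" using mix_weight_ge1[of s k] by linarith
      show "0 < (m / (A * L ^ (?d - 1))) powr (2 * s)"
        by (subst powr_gt_zero) (rule less_imp_neq[OF divide_pos_pos[OF m AL], symmetric])
    qed (use c in auto)
    also have "\<dots> = (A powr (2 * s) / c) * (m powr (- 2 * s) * (L ^ (?d - 1)) powr (2 * s))"
      using m A L c by (simp add: powr_divide powr_mult powr_minus field_simps)
    also have "(L ^ (?d - 1)) powr (2 * s) = L powr ((real ?d - 1) * 2 * s)"
      using L by (simp add: powr_powr d1 algebra_simps flip: powr_realpow)
    also have "(A powr (2 * s) / c) * (m powr (- 2 * s) * \<dots>) \<le> C * (m powr (- 2 * s) * \<dots>)"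
      by (intro mult_right_mono) (auto simp: C_def)
    finally show "1 / mix_weight s k \<le> C * (real (card H) powr (- 2 * s) * ln (real (card H)) powr ((real ?d - 1) * 2 * s))"
      unfolding m_def L_def .
  next
    fix R and H :: "(int ^ 'd) set" and F
    assume R: "1 < R" and H: "H = hyperbolic_cross \<gamma> R" "card H \<ge> 3" and F: "finite F" "F \<inter> H = {}"
    define m L where "m = real (card H)" and "L = ln (real (card H))"
    have m: "m > 0" using H by (simp add: m_def)
    have L: "L \<ge> 1" and Rm: "m / (A * L ^ (?d - 1)) \<le> R" and lnR: "1 + ln R \<le> g * L"
      using main[OF R H] by (simp_all add: m_def L_def)
    have AL: "A * L ^ (?d - 1) > 0" using A L by simp
    have "(\<Sum>k\<in>F. 1 / mix_weight s k) \<le> B * R powr (1 - 2 * s) * (1 + ln R) ^ (?d - 1)"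
      using B(2)[of R F] R F H by simp
    also have "\<dots> \<le> B * (m / (A * L ^ (?d - 1))) powr (1 - 2 * s) * (g * L) ^ (?d - 1)"
    proof (intro mult_mono power_mono)
      show "R powr (1 - 2 * s) \<le> (m / (A * L ^ (?d - 1))) powr (1 - 2 * s)"
        using Rm m AL s by (intro powr_mono2') auto
    qed (use lnR R B in auto)
    also have "(m / (A * L ^ (?d - 1))) powr (1 - 2 * s) = m powr (- 2 * s + 1) * A powr (2 * s - 1) * (L ^ (?d - 1)) powr (2 * s - 1)"
    proof -
      define Q where "Q = A * L ^ (?d - 1)"
      have "Q > 0" using AL by (simp add: Q_def)
      then have "(m / Q) powr (1 - 2 * s) = m powr (1 - 2 * s) / Q powr (1 - 2 * s)"
        using m by (simp add: powr_divide)
      moreover have "Q powr (1 - 2 * s) = inverse (Q powr (2 * s - 1))"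
        using powr_minus[of Q "2 * s - 1"] by simp
      moreover have "Q powr (2 * s - 1) = A powr (2 * s - 1) * (L ^ (?d - 1)) powr (2 * s - 1)"
        unfolding Q_def using A L by (simp add: powr_mult)
      ultimately show ?thesis unfolding Q_def[symmetric] by (simp add: divide_inverse)
    qed
    also have "B * (m powr (- 2 * s + 1) * A powr (2 * s - 1) * (L ^ (?d - 1)) powr (2 * s - 1)) * (g * L) ^ (?d - 1)
        = (B * A powr (2 * s - 1) * g ^ (?d - 1)) * (m powr (- 2 * s + 1) * ((L ^ (?d - 1)) powr (2 * s - 1) * L ^ (?d - 1)))"
      by (simp add: power_mult_distrib mult_ac)
    also have "(L ^ (?d - 1)) powr (2 * s - 1) * L ^ (?d - 1) = L powr ((real ?d - 1) * 2 * s)"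
    proof -
      have "(L ^ (?d - 1)) powr (2 * s - 1) * L ^ (?d - 1) = (L ^ (?d - 1)) powr (2 * s - 1) * (L ^ (?d - 1)) powr 1"
        using L by simp
      also have "\<dots> = (L ^ (?d - 1)) powr (2 * s)" unfolding powr_add[symmetric] by simp
      also have "\<dots> = L powr ((real ?d - 1) * 2 * s)"
        using L by (simp add: powr_powr d1 algebra_simps flip: powr_realpow)
      finally show ?thesis .
    qed
    also have "(B * A powr (2 * s - 1) * g ^ (?d - 1)) * (m powr (- 2 * s + 1) * \<dots>) \<le> C * (m powr (- 2 * s + 1) * \<dots>)"
      by (intro mult_right_mono) (auto simp: C_def)
    finally show "(\<Sum>k\<in>F. 1 / mix_weight s k) \<le> C * (real (card H) powr (- 2 * s + 1) * ln (real (card H)) powr ((real ?d - 1) * 2 * s))"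
      unfolding m_def L_def .
  qed
qed

section \<open>Stability and error of least squares\<close>

lemma spectral_calculus_product:
  assumes fin: "finite I" and u: "unitary_on I u"
  shows "(\<Sum>m\<in>I. (\<Sum>r\<in>I. of_real (f r) * u r k * cnj (u r m)) * (\<Sum>r\<in>I. of_real (g r) * u r m * cnj (u r l)))
     = (\<Sum>r\<in>I. of_real (f r * g r) * u r k * cnj (u r l))"
proof -
  have "(\<Sum>m\<in>I. (\<Sum>r\<in>I. of_real (f r) * u r k * cnj (u r m)) * (\<Sum>r\<in>I. of_real (g r) * u r m * cnj (u r l)))
     = (\<Sum>m\<in>I. \<Sum>r\<in>I. \<Sum>t\<in>I. (of_real (f r) * u r k * of_real (g t) * cnj (u t l)) * (u t m * cnj (u r m)))"
    unfolding sum_product by (intro sum.cong refl) (simp only: mult_ac)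
  also have "\<dots> = (\<Sum>r\<in>I. \<Sum>m\<in>I. \<Sum>t\<in>I. (of_real (f r) * u r k * of_real (g t) * cnj (u t l)) * (u t m * cnj (u r m)))"
    by (rule sum.swap)
  also have "\<dots> = (\<Sum>r\<in>I. \<Sum>t\<in>I. \<Sum>m\<in>I. (of_real (f r) * u r k * of_real (g t) * cnj (u t l)) * (u t m * cnj (u r m)))"
    by (intro sum.cong refl sum.swap)
  also have "\<dots> = (\<Sum>r\<in>I. \<Sum>t\<in>I. if t = r then of_real (f r) * u r k * of_real (g r) * cnj (u r l) else 0)"
    unfolding sum_distrib_left[symmetric]
    by (intro sum.cong refl) (simp add: unitary_on_rows[OF u])
  also have "\<dots> = (\<Sum>r\<in>I. of_real (f r * g r) * u r k * cnj (u r l))"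
    using fin by (simp add: mult_ac)
  finally show ?thesis .
qed

lemma invertible_matrix_on_positive_spectrum:
  assumes fin: "finite I" and sp: "spectral_on I A lam u" and lam: "\<And>r. r \<in> I \<Longrightarrow> lam r > 0"
  shows "invertible_matrix_on I A"
proof -
  have u: "unitary_on I u" by (rule spectral_on_unitary[OF sp])
  have lam0: "lam r \<noteq> 0" if "r \<in> I" for r using lam[OF that] by simp
  have A: "A k l = (\<Sum>r\<in>I. of_real (lam r) * u r k * cnj (u r l))" if "k \<in> I" "l \<in> I" for k l
    using sp that by (simp add: spectral_on_def)
  define B where "B k l = (\<Sum>r\<in>I. of_real (1 / lam r) * u r k * cnj (u r l))" for k l
  have one: "(\<Sum>r\<in>I. of_real (f r) * u r k * cnj (u r l)) = (if k = l then 1 else 0)"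
    if f: "\<And>r. r \<in> I \<Longrightarrow> f r = 1" and kl: "k \<in> I" "l \<in> I" for f k l
  proof -
    have "(\<Sum>r\<in>I. of_real (f r) * u r k * cnj (u r l)) = (\<Sum>r\<in>I. u r k * cnj (u r l))"
      by (intro sum.cong refl) (simp add: f)
    then show ?thesis using unitary_on_cols[OF u kl] by simp
  qed
  have "(\<Sum>m\<in>I. A k m * B m l) = (if k = l then 1 else 0)" if kl: "k \<in> I" "l \<in> I" for k l
  proof -
    have "(\<Sum>m\<in>I. A k m * B m l) = (\<Sum>r\<in>I. of_real (lam r * (1 / lam r)) * u r k * cnj (u r l))"
      unfolding spectral_calculus_product[OF fin u, symmetric] B_def using kl by (intro sum.cong refl) (simp add: A)
    also have "\<dots> = (if k = l then 1 else 0)"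
      by (rule one) (simp_all add: lam0 kl)
    finally show ?thesis .
  qed
  moreover have "(\<Sum>m\<in>I. B k m * A m l) = (if k = l then 1 else 0)" if kl: "k \<in> I" "l \<in> I" for k l
  proof -
    have "(\<Sum>m\<in>I. B k m * A m l) = (\<Sum>r\<in>I. of_real (1 / lam r * lam r) * u r k * cnj (u r l))"
      unfolding spectral_calculus_product[OF fin u, symmetric] B_def using kl by (intro sum.cong refl) (simp add: A)
    also have "\<dots> = (if k = l then 1 else 0)"
      by (rule one) (simp_all add: lam0 kl)
    finally show ?thesis .
  qed
  ultimately have "inverse_matrix_on I A B" unfolding inverse_matrix_on_def by blast
  then show ?thesis unfolding invertible_matrix_on_def by blast
qed

lemma gram_matrix_sum_outer:
  "gram_matrix P y = sum_outer (\<lambda>i k. cnj (eta k (y i))) P"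
  by (intro ext) (simp add: gram_matrix_def sum_outer_def sampling_matrix_def)

text \<open>
  The residual after subtracting the least squares fit is orthogonal to the sampled exponentials
  (\<open>orth\<close>), so the part \<open>Le\<close> of the samples of \<open>g\<close> that the fit explains is no longer than \<open>g\<close>
  itself.  The frame bound converts this into a bound on the coefficients.
\<close>
lemma least_squares_stability:
  fixes y :: "'i \<Rightarrow> real ^ 'd"
  assumes fin: "finite I" and \<Lambda>: "\<Lambda> > 0"
    and frame: "\<And>a. \<Lambda> * (\<Sum>k\<in>I. (cmod (a k))\<^sup>2) \<le> (\<Sum>i\<in>P. (cmod (\<Sum>k\<in>I. eta k (y i) * a k))\<^sup>2)"
  shows "least_squares_well_defined I P y"
    and "\<Lambda> * (\<Sum>k\<in>I. (cmod (least_squares_coeff I P y f k - c k))\<^sup>2)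
       \<le> (\<Sum>i\<in>P. (cmod (f (y i) - (\<Sum>k\<in>I. c k * eta k (y i))))\<^sup>2)"
proof -
  let ?G = "gram_matrix P y"
  obtain lam u where sp: "spectral_on I ?G lam u"
    using hermitian_spectral_decomposition[OF fin hermitian_sum_outer] unfolding gram_matrix_sum_outer by blast
  have lam: "lam r > 0" if r: "r \<in> I" for r
  proof -
    have "lam r = (\<Sum>i\<in>P. (cmod (\<Sum>k\<in>I. eta k (y i) * u r k))\<^sup>2)"
      using sum_outer_eigenvalue[OF fin sp[unfolded gram_matrix_sum_outer] r] by simp
    then have "\<Lambda> * 1 \<le> lam r" using frame[of "u r"] spectral_basis_norm[OF spectral_on_unitary[OF sp] r] by simp
    then show ?thesis using \<Lambda> by simp
  qed
  show wd: "least_squares_well_defined I P y"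
    unfolding least_squares_well_defined_def
    by (rule invertible_matrix_on_positive_spectrum[OF fin sp lam])
  define B where "B = matrix_inv_on I ?G"
  have B: "inverse_matrix_on I ?G B"
    unfolding B_def matrix_inv_on_def
    by (rule someI_ex[of "inverse_matrix_on I ?G"])
       (rule wd[unfolded least_squares_well_defined_def invertible_matrix_on_def])
  define a where "a = least_squares_coeff I P y f"
  define \<rho> where "\<rho> l = (\<Sum>i\<in>P. cnj (eta l (y i)) * f (y i))" for l
  have a_eq: "a l = (\<Sum>m\<in>I. B l m * \<rho> m)" for l
    unfolding a_def least_squares_coeff_def B_def \<rho>_def sampling_matrix_def ..
  have normal: "(\<Sum>l\<in>I. ?G k l * a l) = \<rho> k" if k: "k \<in> I" for k
  proof -
    have "(\<Sum>l\<in>I. ?G k l * a l) = (\<Sum>l\<in>I. \<Sum>m\<in>I. ?G k l * B l m * \<rho> m)"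
      unfolding a_eq sum_distrib_left by (simp only: mult.assoc)
    also have "\<dots> = (\<Sum>m\<in>I. (\<Sum>l\<in>I. ?G k l * B l m) * \<rho> m)"
      unfolding sum_distrib_right by (rule sum.swap)
    also have "\<dots> = (\<Sum>m\<in>I. if m = k then \<rho> m else 0)"
      using B k by (intro sum.cong refl) (simp add: inverse_matrix_on_def)
    finally show ?thesis using k fin by simp
  qed
  define e where "e k = a k - c k" for k
  define g where "g i = f (y i) - (\<Sum>k\<in>I. c k * eta k (y i))" for i
  define Le where "Le i = (\<Sum>k\<in>I. e k * eta k (y i))" for i
  have row: "(\<Sum>i\<in>P. cnj (eta k (y i)) * (\<Sum>l\<in>I. x l * eta l (y i))) = (\<Sum>l\<in>I. ?G k l * x l)" for k x
  proof -
    have "(\<Sum>i\<in>P. cnj (eta k (y i)) * (\<Sum>l\<in>I. x l * eta l (y i)))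
        = (\<Sum>i\<in>P. \<Sum>l\<in>I. cnj (eta k (y i)) * eta l (y i) * x l)"
      unfolding sum_distrib_left by (simp only: mult_ac)
    also have "\<dots> = (\<Sum>l\<in>I. \<Sum>i\<in>P. cnj (eta k (y i)) * eta l (y i) * x l)" by (rule sum.swap)
    finally show ?thesis unfolding gram_matrix_def sampling_matrix_def sum_distrib_right .
  qed
  have orth: "(\<Sum>i\<in>P. cnj (eta k (y i)) * (g i - Le i)) = 0" if k: "k \<in> I" for k
  proof -
    have "(\<Sum>i\<in>P. cnj (eta k (y i)) * (g i - Le i))
        = \<rho> k - (\<Sum>i\<in>P. cnj (eta k (y i)) * (\<Sum>l\<in>I. c l * eta l (y i))) - (\<Sum>i\<in>P. cnj (eta k (y i)) * (\<Sum>l\<in>I. e l * eta l (y i)))"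
      unfolding \<rho>_def g_def Le_def by (simp only: right_diff_distrib sum_subtractf)
    also have "\<dots> = (\<Sum>l\<in>I. ?G k l * a l) - (\<Sum>l\<in>I. ?G k l * c l) - (\<Sum>l\<in>I. ?G k l * e l)"
      unfolding row normal[OF k] ..
    also have "\<dots> = 0" unfolding e_def by (simp add: algebra_simps sum_subtractf)
    finally show ?thesis .
  qed
  have "(\<Sum>i\<in>P. cnj (Le i) * (g i - Le i)) = (\<Sum>i\<in>P. \<Sum>k\<in>I. cnj (e k) * (cnj (eta k (y i)) * (g i - Le i)))"
    unfolding Le_def cnj_sum sum_distrib_right by (simp only: complex_cnj_mult mult.assoc)
  also have "\<dots> = (\<Sum>k\<in>I. cnj (e k) * (\<Sum>i\<in>P. cnj (eta k (y i)) * (g i - Le i)))"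
    unfolding sum_distrib_left by (rule sum.swap)
  also have "\<dots> = 0" using orth by simp
  finally have zero: "(\<Sum>i\<in>P. cnj (Le i) * (g i - Le i)) = 0" .
  have pt: "(cmod (g i))\<^sup>2 = (cmod (Le i))\<^sup>2 + (cmod (g i - Le i))\<^sup>2 + 2 * Re (cnj (Le i) * (g i - Le i))" for i
    unfolding cmod_power2 by (simp add: power2_eq_square algebra_simps)
  have "(\<Sum>i\<in>P. (cmod (g i))\<^sup>2) = (\<Sum>i\<in>P. (cmod (Le i))\<^sup>2) + (\<Sum>i\<in>P. (cmod (g i - Le i))\<^sup>2) + 2 * Re (\<Sum>i\<in>P. cnj (Le i) * (g i - Le i))"
    unfolding Re_sum sum_distrib_left sum.distrib[symmetric] by (intro sum.cong refl pt)
  then have "(\<Sum>i\<in>P. (cmod (Le i))\<^sup>2) \<le> (\<Sum>i\<in>P. (cmod (g i))\<^sup>2)"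
    unfolding zero by (simp add: sum_nonneg)
  moreover have "\<Lambda> * (\<Sum>k\<in>I. (cmod (e k))\<^sup>2) \<le> (\<Sum>i\<in>P. (cmod (Le i))\<^sup>2)"
    using frame[of e] unfolding Le_def by (simp only: mult.commute)
  ultimately show "\<Lambda> * (\<Sum>k\<in>I. (cmod (least_squares_coeff I P y f k - c k))\<^sup>2)
       \<le> (\<Sum>i\<in>P. (cmod (f (y i) - (\<Sum>k\<in>I. c k * eta k (y i))))\<^sup>2)"
    unfolding e_def g_def a_def by linarith
qed

text \<open>
  Absolute summability of the coefficients follows from
  \<open>2 \<bar>c\<bar> \<le> \<bar>c\<bar>\<^sup>2 w + 1 / w\<close> and the summability of \<open>1 / w\<close>.
\<close>
lemma Hmix_unit_ball:
  assumes s: "s > 1 / 2" and f: "f \<in> Hmix s" "Hmix_norm s f \<le> 1"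
  shows "finite F \<Longrightarrow> (\<Sum>k\<in>F. (cmod (fourier_coeff f k))\<^sup>2 * mix_weight s k) \<le> 1"
    and "(\<lambda>k. cmod (fourier_coeff f k)) summable_on UNIV"
    and "f = fourier_series (fourier_coeff f)"
proof -
  let ?c = "fourier_coeff f"
  have sm: "(\<lambda>k. (cmod (?c k))\<^sup>2 * mix_weight s k) summable_on UNIV" using f by (simp add: Hmix_def)
  have nn: "(cmod (?c k))\<^sup>2 * mix_weight s k \<ge> 0" for k using mix_weight_ge1[of s k] by simp
  have "(\<Sum>\<^sub>\<infinity>k. (cmod (?c k))\<^sup>2 * mix_weight s k) \<le> 1"
    using f(2) unfolding Hmix_norm_def by simp
  then show "(\<Sum>k\<in>F. (cmod (?c k))\<^sup>2 * mix_weight s k) \<le> 1" if "finite F" for F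
    using finite_sum_le_infsum[OF sm that] nn by fastforce
  have "(\<lambda>k. (cmod (?c k))\<^sup>2 * mix_weight s k + 1 / mix_weight s k) summable_on UNIV"
    by (intro summable_on_add sm summable_inverse_mix_weight s)
  then show abs: "(\<lambda>k. cmod (?c k)) summable_on UNIV"
  proof (rule summable_on_comparison_test)
    fix k :: "int ^ 'a"
    define w where "w = sqrt (mix_weight s k)"
    have w: "w > 0" "w\<^sup>2 = mix_weight s k" using mix_weight_ge1[of s k] by (auto simp: w_def)
    have "0 \<le> (cmod (?c k) * w - 1 / w)\<^sup>2" by simp
    also have "\<dots> = (cmod (?c k))\<^sup>2 * w\<^sup>2 + 1 / w\<^sup>2 - 2 * cmod (?c k)"
      using w(1) by (simp add: power2_eq_square field_simps)
    finally show "cmod (?c k) \<le> (cmod (?c k))\<^sup>2 * mix_weight s k + 1 / mix_weight s k"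
      unfolding w(2) using norm_ge_zero[of "?c k"] by linarith
  qed auto
  show "f = fourier_series ?c"
    using f by (intro fourier_inversion abs) (auto simp: Hmix_def)
qed

text \<open>
  Cauchy-Schwarz with the weights, on finite sets of frequencies first.
\<close>
lemma Hmix_tail_bound:
  assumes s: "s > 1 / 2" and f: "f \<in> Hmix s" "Hmix_norm s f \<le> 1" and K: "finite K"
    and \<tau>: "\<And>F. finite F \<Longrightarrow> F \<inter> K = {} \<Longrightarrow> (\<Sum>k\<in>F. 1 / mix_weight s k) \<le> \<tau>"
  shows "(cmod (f x - (\<Sum>k\<in>K. fourier_coeff f k * eta k x)))\<^sup>2 \<le> \<tau>"
proof -
  let ?c = "fourier_coeff f"
  have \<tau>0: "\<tau> \<ge> 0" using \<tau>[of "{}"] by simp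
  have fin: "cmod (\<Sum>k\<in>F. ?c k * eta k x) \<le> sqrt \<tau>" if F: "finite F" "F \<inter> K = {}" for F
  proof -
    have "cmod (\<Sum>k\<in>F. ?c k * eta k x) \<le> (\<Sum>k\<in>F. cmod (?c k))"
      by (rule order_trans[OF norm_sum]) (simp add: norm_mult norm_eta)
    also have "\<dots> = (\<Sum>k\<in>F. (cmod (?c k) * sqrt (mix_weight s k)) * (1 / sqrt (mix_weight s k)))"
    proof (intro sum.cong refl)
      fix k show "cmod (?c k) = (cmod (?c k) * sqrt (mix_weight s k)) * (1 / sqrt (mix_weight s k))"
        using mix_weight_ge1[of s k] by simp
    qed
    finally have "(cmod (\<Sum>k\<in>F. ?c k * eta k x))\<^sup>2 \<le> (\<Sum>k\<in>F. (cmod (?c k) * sqrt (mix_weight s k)) * (1 / sqrt (mix_weight s k)))\<^sup>2"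
      by (intro power_mono) auto
    also have "\<dots> \<le> (\<Sum>k\<in>F. (cmod (?c k) * sqrt (mix_weight s k))\<^sup>2) * (\<Sum>k\<in>F. (1 / sqrt (mix_weight s k))\<^sup>2)"
      by (rule Cauchy_Schwarz_ineq_sum)
    also have "\<dots> = (\<Sum>k\<in>F. (cmod (?c k))\<^sup>2 * mix_weight s k) * (\<Sum>k\<in>F. 1 / mix_weight s k)"
    proof -
      have "mix_weight s k \<ge> 0" for k :: "int ^ 'a" using mix_weight_ge1[of s k] by linarith
      then show ?thesis by (simp add: power_mult_distrib power_divide)
    qed
    also have "\<dots> \<le> 1 * \<tau>"
    proof (rule mult_mono)
      show "(\<Sum>k\<in>F. (cmod (?c k))\<^sup>2 * mix_weight s k) \<le> 1" by (rule Hmix_unit_ball(1)[OF s f F(1)])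
      show "(\<Sum>k\<in>F. 1 / mix_weight s k) \<le> \<tau>" by (rule \<tau>[OF F])
      show "0 \<le> (\<Sum>k\<in>F. 1 / mix_weight s k)"
        by (intro sum_nonneg divide_nonneg_nonneg) (auto intro: order_trans[OF zero_le_one mix_weight_ge1])
    qed simp
    finally show ?thesis using real_le_rsqrt by simp
  qed
  have "cmod (f x - (\<Sum>k\<in>K. ?c k * eta k x)) \<le> sqrt \<tau>"
  proof (rule field_le_epsilon)
    fix e :: real assume e: "e > 0"
    obtain F where F: "finite F" "K \<subseteq> F" "\<forall>x. cmod (fourier_series ?c x - (\<Sum>k\<in>F. ?c k * eta k x)) < e"
      using fourier_series_approx[OF Hmix_unit_ball(2)[OF s f] e K] by blast
    have fx: "f x = fourier_series ?c x" by (rule fun_cong[OF Hmix_unit_ball(3)[OF s f]])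
    have "f x - (\<Sum>k\<in>K. ?c k * eta k x) = (fourier_series ?c x - (\<Sum>k\<in>F. ?c k * eta k x)) + (\<Sum>k\<in>F - K. ?c k * eta k x)"
      using fx sum_diff[OF F(1,2), of "\<lambda>k. ?c k * eta k x"] by simp
    then have "cmod (f x - (\<Sum>k\<in>K. ?c k * eta k x)) \<le> cmod (fourier_series ?c x - (\<Sum>k\<in>F. ?c k * eta k x)) + cmod (\<Sum>k\<in>F - K. ?c k * eta k x)"
      by (simp only: norm_triangle_ineq)
    also have "\<dots> \<le> e + sqrt \<tau>" using F fin[of "F - K"] by (intro add_mono) (auto intro: less_imp_le)
    finally show "cmod (f x - (\<Sum>k\<in>K. ?c k * eta k x)) \<le> sqrt \<tau> + e" by simp
  qed
  then have "(cmod (f x - (\<Sum>k\<in>K. ?c k * eta k x)))\<^sup>2 \<le> (sqrt \<tau>)\<^sup>2" by (intro power_mono) auto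
  then show ?thesis using \<tau>0 by simp
qed

theorem least_squares_error_bound:
  fixes y :: "'i \<Rightarrow> real ^ 'd"
  assumes s: "s > 1 / 2" and f: "f \<in> Hmix s" "Hmix_norm s f \<le> 1"
    and IK: "finite K" "I \<subseteq> K" and N: "finite N" "P \<subseteq> N"
    and \<sigma>: "\<And>k. k \<notin> I \<Longrightarrow> 1 / mix_weight s k \<le> \<sigma>" "\<sigma> \<ge> 0"
    and \<tau>: "\<And>F. finite F \<Longrightarrow> F \<inter> K = {} \<Longrightarrow> (\<Sum>k\<in>F. 1 / mix_weight s k) \<le> \<tau>"
    and \<Lambda>: "\<Lambda> > 0"
    and frame: "\<And>a. \<Lambda> * (\<Sum>k\<in>I. (cmod (a k))\<^sup>2) \<le> (\<Sum>i\<in>P. (cmod (\<Sum>k\<in>I. eta k (y i) * a k))\<^sup>2)"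
    and U: "\<And>a. (\<Sum>i\<in>N. (cmod (\<Sum>k\<in>K - I. eta k (y i) / of_real (sqrt (mix_weight s k)) * a k))\<^sup>2) \<le> U * (\<Sum>k\<in>K - I. (cmod (a k))\<^sup>2)"
    and U0: "U \<ge> 0"
  shows "(L2_torus_norm (\<lambda>x. f x - least_squares I P y f x))\<^sup>2 \<le> \<sigma> + (2 * U + 2 * real (card N) * \<tau>) / \<Lambda>"
proof -
  let ?c = "fourier_coeff f"
  have finI: "finite I" using IK finite_subset by blast
  have w0: "mix_weight s k > 0" for k :: "int ^ 'd" using mix_weight_ge1[of s k] by linarith
  define a where "a = least_squares_coeff I P y f"
  define e where "e k = ?c k - (if k \<in> I then a k else 0)" for k
  have abs: "(\<lambda>k. cmod (?c k)) summable_on UNIV" by (rule Hmix_unit_ball(2)[OF s f])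
  have abs_a: "(\<lambda>k. cmod (if k \<in> I then a k else 0)) summable_on UNIV"
    by (rule finite_nonzero_values_imp_summable_on) (rule finite_subset[OF _ finI], auto)
  have abs_e: "(\<lambda>k. cmod (e k)) summable_on UNIV"
    by (rule summable_on_comparison_test[OF summable_on_add[OF abs abs_a]])
       (auto simp: e_def intro: norm_triangle_ineq4)
  have diff: "(\<lambda>x. f x - least_squares I P y f x) = fourier_series e"
  proof
    fix x
    have fx: "f x = fourier_series ?c x" by (rule fun_cong[OF Hmix_unit_ball(3)[OF s f]])
    have "((\<lambda>k. ?c k * eta k x) has_sum f x) UNIV" using fourier_series_has_sum[OF abs, of x] fx by simp
    moreover have "((\<lambda>k. (if k \<in> I then a k else 0) * eta k x) has_sum least_squares I P y f x) UNIV"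
      by (rule has_sum_finite_neutralI[OF finI subset_UNIV]) (simp_all add: least_squares_def a_def)
    ultimately have "((\<lambda>k. ?c k * eta k x - (if k \<in> I then a k else 0) * eta k x) has_sum (f x - least_squares I P y f x)) UNIV"
      using has_sum_add[OF _ has_sum_uminusI] by fastforce
    then have "((\<lambda>k. e k * eta k x) has_sum (f x - least_squares I P y f x)) UNIV"
      unfolding e_def left_diff_distrib .
    then show "f x - least_squares I P y f x = fourier_series e x"
      unfolding fourier_series_def by (rule infsumI[symmetric])
  qed
  have residual: "(cmod (f (y i) - (\<Sum>k\<in>I. ?c k * eta k (y i))))\<^sup>2
      \<le> 2 * (cmod (\<Sum>k\<in>K - I. ?c k * eta k (y i)))\<^sup>2 + 2 * \<tau>" for i
  proof -
    let ?A = "\<Sum>k\<in>K - I. ?c k * eta k (y i)" and ?B = "f (y i) - (\<Sum>k\<in>K. ?c k * eta k (y i))"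
    have "f (y i) - (\<Sum>k\<in>I. ?c k * eta k (y i)) = ?A + ?B"
      using sum_diff[OF IK, of "\<lambda>k. ?c k * eta k (y i)"] by simp
    then have "cmod (f (y i) - (\<Sum>k\<in>I. ?c k * eta k (y i))) \<le> cmod ?A + cmod ?B"
      by (simp only: norm_triangle_ineq)
    then have "(cmod (f (y i) - (\<Sum>k\<in>I. ?c k * eta k (y i))))\<^sup>2 \<le> (cmod ?A + cmod ?B)\<^sup>2"
      by (intro power_mono) auto
    also have "\<dots> \<le> 2 * (cmod ?A)\<^sup>2 + 2 * (cmod ?B)\<^sup>2"
      using zero_le_power2[of "cmod ?A - cmod ?B"] by (simp add: power2_sum power2_diff)
    also have "\<dots> \<le> 2 * (cmod ?A)\<^sup>2 + 2 * \<tau>"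
      using Hmix_tail_bound[OF s f IK(1) \<tau>, of "y i"] by simp
    finally show ?thesis .
  qed
  have first: "(\<Sum>i\<in>N. (cmod (\<Sum>k\<in>K - I. ?c k * eta k (y i)))\<^sup>2) \<le> U"
  proof -
    define x where "x k = of_real (sqrt (mix_weight s k)) * ?c k" for k
    have "(\<Sum>k\<in>K - I. ?c k * eta k (y i)) = (\<Sum>k\<in>K - I. eta k (y i) / of_real (sqrt (mix_weight s k)) * x k)" for i
    proof (intro sum.cong refl)
      fix k :: "int ^ 'd"
      have "complex_of_real (sqrt (mix_weight s k)) \<noteq> 0" using w0[of k] by simp
      then show "?c k * eta k (y i) = eta k (y i) / of_real (sqrt (mix_weight s k)) * x k" by (simp add: x_def)
    qed
    then have "(\<Sum>i\<in>N. (cmod (\<Sum>k\<in>K - I. ?c k * eta k (y i)))\<^sup>2) \<le> U * (\<Sum>k\<in>K - I. (cmod (x k))\<^sup>2)"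
      using U[of x] by simp
    also have "(\<Sum>k\<in>K - I. (cmod (x k))\<^sup>2) = (\<Sum>k\<in>K - I. (cmod (?c k))\<^sup>2 * mix_weight s k)"
      using w0 by (intro sum.cong refl) (simp add: x_def norm_mult power_mult_distrib less_imp_le mult.commute)
    also have "U * \<dots> \<le> U * 1"
      using IK U0 by (intro mult_left_mono Hmix_unit_ball(1)[OF s f]) auto
    finally show ?thesis by simp
  qed
  have "\<Lambda> * (\<Sum>k\<in>I. (cmod (a k - ?c k))\<^sup>2) \<le> (\<Sum>i\<in>P. (cmod (f (y i) - (\<Sum>k\<in>I. ?c k * eta k (y i))))\<^sup>2)"
    unfolding a_def by (rule least_squares_stability(2)[OF finI \<Lambda> frame])
  also have "\<dots> \<le> (\<Sum>i\<in>N. (cmod (f (y i) - (\<Sum>k\<in>I. ?c k * eta k (y i))))\<^sup>2)"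
    using N by (intro sum_mono2) auto
  also have "\<dots> \<le> (\<Sum>i\<in>N. 2 * (cmod (\<Sum>k\<in>K - I. ?c k * eta k (y i)))\<^sup>2 + 2 * \<tau>)"
    by (intro sum_mono residual)
  also have "\<dots> = 2 * (\<Sum>i\<in>N. (cmod (\<Sum>k\<in>K - I. ?c k * eta k (y i)))\<^sup>2) + 2 * real (card N) * \<tau>"
    by (simp add: sum.distrib sum_distrib_left)
  also have "\<dots> \<le> 2 * U + 2 * real (card N) * \<tau>" using first by simp
  finally have coeff: "(\<Sum>k\<in>I. (cmod (a k - ?c k))\<^sup>2) \<le> (2 * U + 2 * real (card N) * \<tau>) / \<Lambda>"
    using \<Lambda> by (simp add: pos_le_divide_eq mult.commute)
  show ?thesis
    unfolding diff
  proof (rule L2_norm_fourier_series_le[OF abs_e])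
    fix F :: "(int ^ 'd) set" assume F: "finite F"
    have "(\<Sum>k\<in>F. (cmod (e k))\<^sup>2) = (\<Sum>k\<in>F \<inter> I. (cmod (e k))\<^sup>2) + (\<Sum>k\<in>F - I. (cmod (e k))\<^sup>2)"
      by (rule sum.Int_Diff[OF F])
    also have "(\<Sum>k\<in>F \<inter> I. (cmod (e k))\<^sup>2) = (\<Sum>k\<in>F \<inter> I. (cmod (a k - ?c k))\<^sup>2)"
      by (intro sum.cong refl) (simp add: e_def norm_minus_commute)
    also have "\<dots> \<le> (\<Sum>k\<in>I. (cmod (a k - ?c k))\<^sup>2)" using finI by (intro sum_mono2) auto
    also have "\<dots> \<le> (2 * U + 2 * real (card N) * \<tau>) / \<Lambda>" by (rule coeff)
    also have "(\<Sum>k\<in>F - I. (cmod (e k))\<^sup>2) \<le> (\<Sum>k\<in>F - I. \<sigma> * ((cmod (?c k))\<^sup>2 * mix_weight s k))"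
    proof (intro sum_mono)
      fix k assume "k \<in> F - I"
      then have k: "k \<notin> I" by simp
      have "1 \<le> \<sigma> * mix_weight s k" using \<sigma>(1)[OF k] w0[of k] by (simp add: pos_divide_le_eq)
      then have "1 * (cmod (?c k))\<^sup>2 \<le> (\<sigma> * mix_weight s k) * (cmod (?c k))\<^sup>2" by (intro mult_right_mono) auto
      then show "(cmod (e k))\<^sup>2 \<le> \<sigma> * ((cmod (?c k))\<^sup>2 * mix_weight s k)" using k by (simp add: e_def mult_ac)
    qed
    also have "\<dots> = \<sigma> * (\<Sum>k\<in>F - I. (cmod (?c k))\<^sup>2 * mix_weight s k)" by (rule sum_distrib_left[symmetric])
    also have "\<dots> \<le> \<sigma> * 1" using \<sigma>(2) F by (intro mult_left_mono Hmix_unit_ball(1)[OF s f]) auto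
    finally show "(\<Sum>k\<in>F. (cmod (e k))\<^sup>2) \<le> \<sigma> + (2 * U + 2 * real (card N) * \<tau>) / \<Lambda>" by simp
  qed
qed

section \<open>Random points of a lattice\<close>

text \<open>
  Reconstruction means that the exponentials of \<open>K\<close> form an isotropic family at a random lattice point.
\<close>
lemma lattice_expectation:
  assumes M: "M > 0" and rec: "reconstructing_lattice M z K" and kl: "k \<in> K" "l \<in> K"
  shows "measure_pmf.expectation (pmf_of_set {1..M}) (\<lambda>i. cnj (eta k (lattice_point M z i)) * eta l (lattice_point M z i))
     = (if k = l then 1 else 0)"
proof -
  have "measure_pmf.expectation (pmf_of_set {1..M}) (\<lambda>i. cnj (eta k (lattice_point M z i)) * eta l (lattice_point M z i))
      = (\<Sum>i\<in>{1..M}. pmf (pmf_of_set {1..M}) i *\<^sub>R (cnj (eta k (lattice_point M z i)) * eta l (lattice_point M z i)))"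
    using M by (intro integral_measure_pmf) auto
  also have "\<dots> = (\<Sum>i=1..M. eta (l - k) (lattice_point M z i) / of_nat M)"
    using M by (intro sum.cong refl) (simp add: eta_diff scaleR_conv_of_real mult.commute)
  also have "\<dots> = (if l = k then 1 else 0)"
    using rec kl unfolding reconstructing_lattice_def sum_divide_distrib by blast
  finally show ?thesis by auto
qed

lemma exp_one_le_3: "exp 1 \<le> (3 :: real)"
  using exp_le by simp

text \<open>
  After division by \<open>sqrt m\<close> the sampled vectors have norm 1 and second moment \<open>1 / m\<close> times the identity.
  As \<open>e \<le> 3\<close>, the \<open>n\<close> factors \<open>1 - 1 / (e m)\<close> multiply to at most \<open>m ^ (- 24)\<close>, which outweighs the factor \<open>m ^ 20\<close> for the threshold
  and the factor \<open>m\<close> for the dimension.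
\<close>
lemma random_lattice_frame_bound:
  assumes M: "M > 0" and rec: "reconstructing_lattice M z K" and IK: "finite I" "I \<subseteq> K" and m: "card I \<ge> 3"
    and n: "72 * real (card I) * ln (real (card I)) \<le> real n"
  shows "measure_pmf.prob (Pi_pmf {1..n} 0 (\<lambda>_. pmf_of_set {1..M}))
     {J. \<exists>a. (\<Sum>i\<in>{1..n}. (cmod (\<Sum>k\<in>I. eta k (lattice_point M z (J i)) * a k))\<^sup>2)
          < 20 * real (card I) * ln (real (card I)) * (\<Sum>k\<in>I. (cmod (a k))\<^sup>2)} \<le> 1 / real (card I)"
    (is "measure_pmf.prob _ ?bad \<le> _")
proof -
  define r where "r = real (card I)"
  define L where "L = ln r"
  have r3: "r \<ge> 3" using m by (simp add: r_def)
  have L0: "L > 0" using r3 by (simp add: L_def)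
  have rL: "exp L = r" using r3 by (simp add: L_def)
  define v where "v i k = cnj (eta k (lattice_point M z i)) / of_real (sqrt r)" for i and k :: "int ^ 'a"
  have vsq: "complex_of_real (sqrt r) * of_real (sqrt r) = of_real r" using r3 by (simp flip: of_real_mult)
  have form: "(\<Sum>i\<in>{1..n}. (cmod (\<Sum>k\<in>I. cnj (v (J i) k) * a k))\<^sup>2)
      = (\<Sum>i\<in>{1..n}. (cmod (\<Sum>k\<in>I. eta k (lattice_point M z (J i)) * a k))\<^sup>2) / r" for J a
    unfolding sum_divide_distrib
  proof (intro sum.cong refl)
    fix i
    have "(\<Sum>k\<in>I. cnj (v (J i) k) * a k) = (\<Sum>k\<in>I. eta k (lattice_point M z (J i)) * a k) / of_real (sqrt r)"
      by (simp add: v_def sum_divide_distrib)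
    then show "(cmod (\<Sum>k\<in>I. cnj (v (J i) k) * a k))\<^sup>2 = (cmod (\<Sum>k\<in>I. eta k (lattice_point M z (J i)) * a k))\<^sup>2 / r"
      using r3 by (simp add: norm_divide power_divide)
  qed
  have "?bad = {J. \<exists>a. (\<Sum>i\<in>{1..n}. (cmod (\<Sum>k\<in>I. cnj (v (J i) k) * a k))\<^sup>2) < (20 * L) * (\<Sum>k\<in>I. (cmod (a k))\<^sup>2)}"
  proof -
    have "(x / r < (20 * L) * y) = (x < 20 * r * L * y)" for x y using r3 by (simp add: pos_divide_less_eq mult_ac)
    then show ?thesis unfolding form r_def[symmetric] L_def[symmetric] by simp
  qed
  then have "measure_pmf.prob (Pi_pmf {1..n} 0 (\<lambda>_. pmf_of_set {1..M})) ?bad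
     \<le> real (card I) * (1 - (1 / r) / exp 1) ^ n * exp (20 * L)"
  proof (simp only:, intro matrix_chernoff_lower)
    show "finite I" by fact
    show "finite (set_pmf (pmf_of_set {1..M}))" using M by simp
    show "(\<Sum>k\<in>I. (cmod (v i k))\<^sup>2) \<le> 1" for i
      using r3 by (simp add: v_def norm_divide norm_eta power_divide r_def)
    show "measure_pmf.expectation (pmf_of_set {1..M}) (\<lambda>i. v i k * cnj (v i l)) = (if k = l then of_real (1 / r) else 0)"
      if kl: "k \<in> I" "l \<in> I" for k l
    proof -
      have "(\<lambda>i. v i k * cnj (v i l)) = (\<lambda>i. (cnj (eta k (lattice_point M z i)) * eta l (lattice_point M z i)) / of_real r)"
        by (rule ext) (simp add: v_def vsq)
      moreover have "k \<in> K" "l \<in> K" using kl IK by auto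
      ultimately show ?thesis using lattice_expectation[OF M rec, of k l] by simp
    qed
    show "0 \<le> 1 / r" "1 / r \<le> 1" using r3 by simp_all
  qed
  also have "\<dots> \<le> exp L * exp (- (24 * L)) * exp (20 * L)"
  proof (intro mult_right_mono)
    have "(1 - (1 / r) / exp 1) ^ n \<le> exp (- (1 / r / exp 1)) ^ n"
    proof (rule power_mono)
      show "1 - 1 / r / exp 1 \<le> exp (- (1 / r / exp 1))" using exp_ge_add_one_self[of "- (1 / r / exp 1)"] by simp
      have "1 / r / exp 1 \<le> 1 / r / 1" using r3 by (intro divide_left_mono) auto
      then show "0 \<le> 1 - 1 / r / exp 1" using r3 by (smt (verit) divide_le_eq_1 div_by_1)
    qed
    also have "\<dots> = exp (- (real n / (r * exp 1)))" by (simp flip: exp_of_nat_mult)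
    also have "\<dots> \<le> exp (- (24 * L))"
    proof -
      have "24 * L * (r * exp 1) \<le> 24 * L * (r * 3)"
        using L0 r3 exp_one_le_3 by (intro mult_left_mono) auto
      also have "\<dots> \<le> real n" using n by (simp add: r_def L_def mult_ac)
      finally have "24 * L \<le> real n / (r * exp 1)" using r3 by (simp add: pos_le_divide_eq)
      then show ?thesis by simp
    qed
    finally show "real (card I) * (1 - 1 / r / exp 1) ^ n \<le> exp L * exp (- (24 * L))"
      unfolding rL r_def by (intro mult_left_mono) auto
  qed simp
  also have "\<dots> = exp (- (3 * L))" by (simp flip: exp_add)
  also have "\<dots> \<le> exp (- L)" using L0 by simp
  also have "\<dots> = 1 / real (card I)" by (simp add: exp_minus rL r_def divide_inverse)
  finally show ?thesis .
qed

text \<open>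
  The scaling by \<open>r \<sigma>\<close> makes the norms at most 1 and the entries of the second moment at most \<open>1 / r\<close>.
  The potential is then at most \<open>r exp (e n / r) \<le> r ^ 220\<close>, and the threshold \<open>222\<close> leaves a failure
  probability of at most \<open>1 / r\<close>.
\<close>
lemma random_lattice_tail_bound:
  fixes w :: "int ^ 'd \<Rightarrow> real"
  assumes M: "M > 0" and rec: "reconstructing_lattice M z K" and D: "finite D" "D \<subseteq> K" and r3: "r \<ge> 3"
    and w: "\<And>k. k \<in> D \<Longrightarrow> w k > 0" and \<sigma>: "\<sigma> > 0" "\<And>k. k \<in> D \<Longrightarrow> 1 / w k \<le> \<sigma>" "(\<Sum>k\<in>D. 1 / w k) \<le> r * \<sigma>"
    and n: "real n \<le> 73 * r * ln r"
  shows "measure_pmf.prob (Pi_pmf {1..n} 0 (\<lambda>_. pmf_of_set {1..M}))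
     {J. \<exists>a. (\<Sum>i\<in>{1..n}. (cmod (\<Sum>k\<in>D. eta k (lattice_point M z (J i)) / of_real (sqrt (w k)) * a k))\<^sup>2)
          > 222 * r * ln r * \<sigma> * (\<Sum>k\<in>D. (cmod (a k))\<^sup>2)} \<le> 1 / r"
    (is "measure_pmf.prob _ ?bad \<le> _")
proof -
  define L where "L = ln r"
  have L0: "L > 0" using r3 by (simp add: L_def)
  have rL: "exp L = r" using r3 by (simp add: L_def)
  have r\<sigma>: "r * \<sigma> > 0" using r3 \<sigma> by simp
  define v where "v i k = cnj (eta k (lattice_point M z i)) / of_real (sqrt (w k * (r * \<sigma>)))" for i and k :: "int ^ 'd"
  have form: "(\<Sum>i\<in>{1..n}. (cmod (\<Sum>k\<in>D. cnj (v (J i) k) * a k))\<^sup>2)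
      = (\<Sum>i\<in>{1..n}. (cmod (\<Sum>k\<in>D. eta k (lattice_point M z (J i)) / of_real (sqrt (w k)) * a k))\<^sup>2) / (r * \<sigma>)" for J a
    unfolding sum_divide_distrib
  proof (intro sum.cong refl)
    fix i
    have "(\<Sum>k\<in>D. cnj (v (J i) k) * a k)
        = (\<Sum>k\<in>D. eta k (lattice_point M z (J i)) / of_real (sqrt (w k)) * a k) / of_real (sqrt (r * \<sigma>))"
      unfolding sum_divide_distrib by (intro sum.cong refl) (simp add: v_def real_sqrt_mult)
    then show "(cmod (\<Sum>k\<in>D. cnj (v (J i) k) * a k))\<^sup>2
        = (cmod (\<Sum>k\<in>D. eta k (lattice_point M z (J i)) / of_real (sqrt (w k)) * a k))\<^sup>2 / (r * \<sigma>)"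
      using r\<sigma> by (simp add: norm_divide power_divide del: real_sqrt_mult)
  qed
  have sq: "complex_of_real (sqrt (w k * (r * \<sigma>))) * of_real (sqrt (w k * (r * \<sigma>))) = of_real (w k * (r * \<sigma>))" if "k \<in> D" for k
  proof -
    have "w k * (r * \<sigma>) \<ge> 0" using w[OF that] r\<sigma> by simp
    then show ?thesis unfolding of_real_mult[symmetric] by simp
  qed
  have tot: "(\<Sum>k\<in>D. 1 / (w k * (r * \<sigma>))) \<le> 1"
  proof -
    have "(\<Sum>k\<in>D. 1 / (w k * (r * \<sigma>))) = (\<Sum>k\<in>D. 1 / w k) / (r * \<sigma>)"
      by (simp add: sum_divide_distrib)
    then show ?thesis using \<sigma>(3) r\<sigma> by (simp add: pos_divide_le_eq)
  qed
  have "?bad = {J. \<exists>a. (\<Sum>i\<in>{1..n}. (cmod (\<Sum>k\<in>D. cnj (v (J i) k) * a k))\<^sup>2) > (222 * L) * (\<Sum>k\<in>D. (cmod (a k))\<^sup>2)}"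
  proof -
    have "((222 * L) * y < x / (r * \<sigma>)) = (222 * r * L * \<sigma> * y < x)" for x y
      using r\<sigma> by (simp add: pos_less_divide_eq mult_ac)
    then show ?thesis unfolding form L_def[symmetric] by simp
  qed
  then have "measure_pmf.prob (Pi_pmf {1..n} 0 (\<lambda>_. pmf_of_set {1..M})) ?bad
     \<le> ((1 + exp 1 * (1 / r)) ^ n - 1) / (1 / r) / (exp (222 * L) - 1)"
  proof (simp only:, intro matrix_chernoff_upper[where \<omega> = "\<lambda>k. 1 / (w k * (r * \<sigma>))"])
    show "finite D" by fact
    show "finite (set_pmf (pmf_of_set {1..M}))" using M by simp
    show "(\<Sum>k\<in>D. (cmod (v i k))\<^sup>2) \<le> 1" for i
    proof -
      have "(\<Sum>k\<in>D. (cmod (v i k))\<^sup>2) = (\<Sum>k\<in>D. 1 / (w k * (r * \<sigma>)))"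
      proof (intro sum.cong refl)
        fix k assume "k \<in> D"
        then have "w k * (r * \<sigma>) \<ge> 0" using w[of k] r\<sigma> by simp
        then show "(cmod (v i k))\<^sup>2 = 1 / (w k * (r * \<sigma>))"
          by (simp add: v_def norm_divide norm_eta power_divide del: real_sqrt_mult)
      qed
      then show ?thesis using tot by simp
    qed
    show "measure_pmf.expectation (pmf_of_set {1..M}) (\<lambda>i. v i k * cnj (v i l)) = (if k = l then of_real (1 / (w k * (r * \<sigma>))) else 0)"
      if kl: "k \<in> D" "l \<in> D" for k l
    proof -
      have "(\<lambda>i. v i k * cnj (v i l)) = (\<lambda>i. (cnj (eta k (lattice_point M z i)) * eta l (lattice_point M z i))
          / (of_real (sqrt (w k * (r * \<sigma>))) * of_real (sqrt (w l * (r * \<sigma>)))))"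
        by (rule ext) (simp add: v_def del: real_sqrt_mult)
      moreover have "k \<in> K" "l \<in> K" using kl D by auto
      ultimately show ?thesis using lattice_expectation[OF M rec, of k l] sq[OF kl(2)] by simp
    qed
    show "0 \<le> 1 / (w k * (r * \<sigma>))" if "k \<in> D" for k using w[OF that] r\<sigma> by simp
    show "1 / (w k * (r * \<sigma>)) \<le> 1 / r" if "k \<in> D" for k
    proof -
      have "1 / (w k * (r * \<sigma>)) = (1 / w k) / \<sigma> * (1 / r)" by simp
      also have "\<dots> \<le> 1 * (1 / r)"
      proof (rule mult_right_mono)
        show "1 / w k / \<sigma> \<le> 1" using \<sigma>(2)[OF that] \<sigma>(1) by (subst pos_divide_le_eq) auto
      qed (use r3 in simp)
      finally show ?thesis by simp
    qed
    show "(\<Sum>k\<in>D. 1 / (w k * (r * \<sigma>))) \<le> 1" by (rule tot)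
    show "0 < 1 / r" "0 < 222 * L" using r3 L0 by simp_all
  qed
  also have "\<dots> \<le> exp (219 * L) * exp L / (exp (222 * L) - 1)"
  proof (rule divide_right_mono)
    have "(1 + exp 1 * (1 / r)) ^ n \<le> exp (exp 1 * (1 / r)) ^ n"
      using r3 by (intro power_mono exp_ge_add_one_self) (auto intro: add_nonneg_nonneg)
    also have "\<dots> = exp (real n * exp 1 / r)" by (simp flip: exp_of_nat_mult)
    also have "\<dots> \<le> exp (219 * L)"
    proof -
      have "real n * exp 1 \<le> 73 * r * L * 3"
        using n exp_one_le_3 r3 L0 unfolding L_def by (intro mult_mono) auto
      then show ?thesis using r3 by (simp add: pos_divide_le_eq mult_ac)
    qed
    finally have "(1 + exp 1 * (1 / r)) ^ n - 1 \<le> exp (219 * L)" by simp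
    then show "((1 + exp 1 * (1 / r)) ^ n - 1) / (1 / r) \<le> exp (219 * L) * exp L"
      unfolding rL using r3 by (simp add: mult_right_mono)
  qed (use L0 in simp)
  also have "\<dots> \<le> 1 / r"
  proof -
    have "exp (221 * L) \<ge> 1" using L0 by simp
    moreover have "exp (222 * L) = exp (221 * L) * r" unfolding rL[symmetric] by (simp flip: exp_add)
    moreover have "exp (221 * L) * 3 \<le> exp (221 * L) * r" using r3 by (intro mult_left_mono) auto
    ultimately have "exp (221 * L) \<le> exp (222 * L) - 1" by linarith
    moreover have "exp (219 * L) * exp L * r = exp (221 * L)" unfolding rL[symmetric] by (simp flip: exp_add)
    ultimately have "exp (219 * L) * exp L * r \<le> exp (222 * L) - 1" by simp
    moreover have "exp (222 * L) - 1 > 0" using L0 by simp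
    ultimately show ?thesis using r3 by (simp add: pos_divide_le_eq pos_le_divide_eq mult_ac)
  qed
  finally show ?thesis .
qed

text \<open>
  For \<open>b \<le> 2\<close> this is \<open>b - 1 \<le> b ^ 3\<close>.  For larger \<open>b\<close> the selection is made with \<open>b = 2\<close>, and the right
  side never drops below 1.
\<close>
lemma oversampling_factor:
  fixes b :: real
  assumes "b > 1"
  shows "1 / (min b 2 - 1)\<^sup>2 \<le> (b / (b - 1)) ^ 3"
proof (cases "b \<le> 2")
  case True
  have "(b - 1) ^ 3 \<le> (b - 1)\<^sup>2 * 1"
    using assms True unfolding power3_eq_cube power2_eq_square by (intro mult_left_mono) auto
  also have "\<dots> \<le> (b - 1)\<^sup>2 * b ^ 3" using assms by (intro mult_left_mono) auto
  finally have "(b - 1) ^ 3 \<le> (b - 1)\<^sup>2 * b ^ 3" .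
  then have "1 / (b - 1)\<^sup>2 \<le> b ^ 3 / (b - 1) ^ 3"
    using assms by (simp add: pos_divide_le_eq pos_le_divide_eq mult_ac)
  then show ?thesis using True by (simp add: power_divide)
next
  case False
  then have "1 \<le> b / (b - 1)" by (simp add: pos_le_divide_eq)
  then show ?thesis using False by simp
qed

text \<open>
  The failure probability is at most \<open>2 / m\<close>, from one event for each of the two eigenvalue bounds; on the
  complement everything is deterministic.  The constant \<open>17761\<close> combines the frame bound
  \<open>\<Lambda> = (b - 1)\<^sup>2 m / 40\<close>, for \<open>b \<le> 2\<close>, with the two halves \<open>2 * 222\<close> and \<open>2 * 73\<close> of the residual:
  \<open>40 * 444 + 1\<close>, where the 1 accounts for the frequencies outside \<open>I\<close>.
\<close>
theorem corollary1p2: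
  fixes s \<gamma> :: real
  assumes "s > 1 / 2" and "\<gamma> > 0"
  shows "\<exists>C>0. \<forall>(R::real) (R_MZ::real) (I::(int ^ 'd) set) (I_MZ::(int ^ 'd) set) (M::nat) (z::int ^ 'd) (b::real) (n::nat).
    1 < R \<longrightarrow> 1 < R_MZ \<longrightarrow>
    I = hyperbolic_cross \<gamma> R \<longrightarrow> I_MZ = hyperbolic_cross \<gamma> R_MZ \<longrightarrow>
    I \<subseteq> I_MZ \<longrightarrow> card I \<ge> 3 \<longrightarrow>
    M > 0 \<longrightarrow> reconstructing_lattice M z I_MZ \<longrightarrow>
    b > 1 + 1 / real (card I) \<longrightarrow>
    n = nat \<lceil>72 * real (card I) * ln (real (card I))\<rceil> \<longrightarrow>
    measure_pmf.prob (Pi_pmf {1..n} 0 (\<lambda>_. pmf_of_set {1..M}))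
      {J. \<exists>P\<subseteq>{1..n}. int (card P) \<le> \<lceil>b * real (card I)\<rceil> \<and>
         least_squares_well_defined I P (\<lambda>i. lattice_point M z (J i)) \<and>
         (SUP f\<in>{f \<in> Hmix s. Hmix_norm s f \<le> 1}.
            ereal ((L2_torus_norm (\<lambda>x. f x - least_squares I P (\<lambda>i. lattice_point M z (J i)) f x))\<^sup>2))
         \<le> ereal (C * (b / (b - 1)) ^ 3 * ln (real (card I)) *
              (real (card I) powr (- 2 * s) * ln (real (card I)) powr ((real CARD('d) - 1) * 2 * s)
               + real (card I_MZ) powr (- 2 * s + 1) * ln (real (card I_MZ)) powr (2 * (real CARD('d) - 1) * s)))}
    \<ge> 1 - 4 / real (card I)"
proof -
  obtain C where C1: "C \<ge> 1"
    and Cpt: "\<And>R (H :: (int ^ 'd) set) k. 1 < R \<Longrightarrow> H = hyperbolic_cross \<gamma> R \<Longrightarrow> card H \<ge> 3 \<Longrightarrow> k \<notin> H \<Longrightarrow>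
       1 / mix_weight s k \<le> C * (real (card H) powr (- 2 * s) * ln (real (card H)) powr ((real CARD('d) - 1) * 2 * s))"
    and Csum: "\<And>R (H :: (int ^ 'd) set) F. 1 < R \<Longrightarrow> H = hyperbolic_cross \<gamma> R \<Longrightarrow> card H \<ge> 3 \<Longrightarrow> finite F \<Longrightarrow> F \<inter> H = {} \<Longrightarrow>
       (\<Sum>k\<in>F. 1 / mix_weight s k) \<le> C * (real (card H) powr (- 2 * s + 1) * ln (real (card H)) powr ((real CARD('d) - 1) * 2 * s))"
    using hyperbolic_cross_weight_bounds[OF assms(2,1), where ?'d = 'd] by blast
  show ?thesis
  proof (rule exI[of _ "17761 * C"], intro conjI allI impI)
    show "0 < 17761 * C" using C1 by simp
  next
    fix R K_R :: real and I K :: "(int ^ 'd) set" and M :: nat and z :: "int ^ 'd" and b :: real and n :: nat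
    assume R: "1 < R" "1 < K_R" and I: "I = hyperbolic_cross \<gamma> R" and K: "K = hyperbolic_cross \<gamma> K_R"
      and IK: "I \<subseteq> K" and I3: "card I \<ge> 3" and M: "M > 0" and rec: "reconstructing_lattice M z K"
      and b: "b > 1 + 1 / real (card I)" and n: "n = nat \<lceil>72 * real (card I) * ln (real (card I))\<rceil>"
    define r where "r = real (card I)"
    define L where "L = ln r"
    (* \<sigma> bounds 1 / mix_weight outside I, and r * \<sigma> bounds its sum there; \<tau> bounds the sum outside K. *)
    define \<sigma> where "\<sigma> = C * (r powr (- 2 * s) * L powr ((real CARD('d) - 1) * 2 * s))"
    define \<tau> where "\<tau> = C * (real (card K) powr (- 2 * s + 1) * ln (real (card K)) powr ((real CARD('d) - 1) * 2 * s))"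
    let ?Q = "Pi_pmf {1..n} 0 (\<lambda>_. pmf_of_set {1..M})"
    let ?y = "\<lambda>J i. lattice_point M z (J i)"
    let ?good = "{J. \<exists>P\<subseteq>{1..n}. int (card P) \<le> \<lceil>b * real (card I)\<rceil> \<and>
         least_squares_well_defined I P (\<lambda>i. lattice_point M z (J i)) \<and>
         (SUP f\<in>{f \<in> Hmix s. Hmix_norm s f \<le> 1}.
            ereal ((L2_torus_norm (\<lambda>x. f x - least_squares I P (\<lambda>i. lattice_point M z (J i)) f x))\<^sup>2))
         \<le> ereal (17761 * C * (b / (b - 1)) ^ 3 * ln (real (card I)) *
              (real (card I) powr (- 2 * s) * ln (real (card I)) powr ((real CARD('d) - 1) * 2 * s)
               + real (card K) powr (- 2 * s + 1) * ln (real (card K)) powr (2 * (real CARD('d) - 1) * s)))}"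
    define bad1 where "bad1 = {J. \<exists>a. (\<Sum>i\<in>{1..n}. (cmod (\<Sum>k\<in>I. eta k (?y J i) * a k))\<^sup>2)
          < 20 * real (card I) * ln (real (card I)) * (\<Sum>k\<in>I. (cmod (a k))\<^sup>2)}"
    define bad2 where "bad2 = {J. \<exists>a. (\<Sum>i\<in>{1..n}. (cmod (\<Sum>k\<in>K - I. eta k (?y J i) / of_real (sqrt (mix_weight s k)) * a k))\<^sup>2)
          > 222 * r * ln r * \<sigma> * (\<Sum>k\<in>K - I. (cmod (a k))\<^sup>2)}"
    have finI: "finite I" unfolding I using R by (intro hyperbolic_cross_card(1) assms) auto
    have finK: "finite K" unfolding K using R by (intro hyperbolic_cross_card(1) assms) auto
    have K3: "card K \<ge> 3" using card_mono[OF finK IK] I3 by linarith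
    have neI: "I \<noteq> {}" using I3 by auto
    have r3: "r \<ge> 3" using I3 by (simp add: r_def)
    have "exp 1 \<le> r" using exp_one_le_3 r3 by linarith
    then have L1: "L \<ge> 1" using r3 unfolding L_def by (subst ln_ge_iff) auto
    have b1: "b > 1" using b by (smt (verit) divide_nonneg_nonneg of_nat_0_le_iff)
    have rL: "r * L \<ge> 3" using mult_mono[of 3 r 1 L] r3 L1 by simp
    have n_low: "72 * real (card I) * ln (real (card I)) \<le> real n" unfolding n by linarith
    have n_up: "real n \<le> 73 * r * ln r"
    proof -
      have "real n \<le> 72 * r * L + 1"
        unfolding n r_def[symmetric] L_def[symmetric] using rL by (simp add: mult.assoc)
      then show ?thesis using rL unfolding L_def by linarith
    qed
    have \<sigma>0: "\<sigma> > 0" unfolding \<sigma>_def using C1 r3 L1 by (intro mult_pos_pos) auto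
    have \<tau>0: "\<tau> \<ge> 0" unfolding \<tau>_def using C1 by simp
    have \<sigma>: "1 / mix_weight s k \<le> \<sigma>" if "k \<notin> I" for k
      using Cpt[OF R(1) I I3 that] unfolding \<sigma>_def r_def L_def .
    have \<sigma>sum: "(\<Sum>k\<in>K - I. 1 / mix_weight s k) \<le> r * \<sigma>"
    proof -
      have "(\<Sum>k\<in>K - I. 1 / mix_weight s k) \<le> C * (r powr (- 2 * s + 1) * L powr ((real CARD('d) - 1) * 2 * s))"
        unfolding r_def L_def using finK by (intro Csum[OF R(1) I I3]) auto
      also have "\<dots> = r * \<sigma>" using powr_add[of r "- 2 * s" 1] r3 by (simp add: \<sigma>_def)
      finally show ?thesis .
    qed
    have \<tau>: "(\<Sum>k\<in>F. 1 / mix_weight s k) \<le> \<tau>" if "finite F" "F \<inter> K = {}" for F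
      using Csum[OF R(2) K K3 that] unfolding \<tau>_def .
    have p1: "measure_pmf.prob ?Q bad1 \<le> 1 / r"
      unfolding bad1_def r_def by (rule random_lattice_frame_bound[OF M rec finI IK I3 n_low])
    have p2: "measure_pmf.prob ?Q bad2 \<le> 1 / r"
      unfolding bad2_def
    proof (rule random_lattice_tail_bound[OF M rec _ _ r3 _ \<sigma>0 _ \<sigma>sum n_up])
      show "mix_weight s k > 0" for k :: "int ^ 'd" using mix_weight_ge1[of s k] by linarith
    qed (use finK \<sigma> in auto)
    have good: "J \<in> ?good" if J: "J \<notin> bad1" "J \<notin> bad2" for J
    proof -
      (* Selecting fewer positions than allowed costs only a constant factor. *)
      define b' where "b' = min b 2"
      have b': "1 < b'" "b' \<le> 2" "b' \<le> b" using b1 by (auto simp: b'_def)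
      (* n is at most 73 r ln r, so 20 r ln r is at least n / 4. *)
      have low: "(\<Sum>i\<in>{1..n}. (cmod (\<Sum>k\<in>I. cnj (cnj (eta k (?y J i))) * a k))\<^sup>2)
          \<ge> 1 / 4 * real (card {1..n}) * (\<Sum>k\<in>I. (cmod (a k))\<^sup>2)" for a
      proof -
        have "1 / 4 * real n \<le> 20 * r * ln r" using n_up rL unfolding L_def by linarith
        then have "1 / 4 * real n * (\<Sum>k\<in>I. (cmod (a k))\<^sup>2) \<le> 20 * r * ln r * (\<Sum>k\<in>I. (cmod (a k))\<^sup>2)"
          by (intro mult_right_mono sum_nonneg) auto
        also have "\<dots> \<le> (\<Sum>i\<in>{1..n}. (cmod (\<Sum>k\<in>I. eta k (?y J i) * a k))\<^sup>2)"
          using J(1) unfolding bad1_def r_def by (simp add: not_less)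
        finally show ?thesis by simp
      qed
      have n72: "real (card {1..n}) \<ge> 72 * real (card I)"
      proof -
        have "72 * r * 1 \<le> 72 * r * L" using L1 r3 by (intro mult_left_mono) auto
        then show ?thesis using n_low by (simp add: r_def L_def)
      qed
      obtain P where P: "P \<subseteq> {1..n}" "int (card P) \<le> \<lceil>b' * real (card I)\<rceil>"
        and frame: "\<And>a. (\<Sum>i\<in>P. (cmod (\<Sum>k\<in>I. cnj (cnj (eta k (?y J i))) * a k))\<^sup>2)
           \<ge> 1 / 4 * ((b' - 1)\<^sup>2 * real (card I) / 10) * (\<Sum>k\<in>I. (cmod (a k))\<^sup>2)"
        using frame_subsampling[OF finI finite_atLeastAtMost neI b'(1,2) n72 _ low] by auto
      define \<Lambda> where "\<Lambda> = 1 / 4 * ((b' - 1)\<^sup>2 * real (card I) / 10)"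
      have \<Lambda>0: "\<Lambda> > 0" using b' r3 by (simp add: \<Lambda>_def r_def)
      have frame': "\<Lambda> * (\<Sum>k\<in>I. (cmod (a k))\<^sup>2) \<le> (\<Sum>i\<in>P. (cmod (\<Sum>k\<in>I. eta k (?y J i) * a k))\<^sup>2)" for a
        using frame[of a] by (simp add: \<Lambda>_def)
      have up: "(\<Sum>i\<in>{1..n}. (cmod (\<Sum>k\<in>K - I. eta k (?y J i) / of_real (sqrt (mix_weight s k)) * a k))\<^sup>2)
          \<le> 222 * r * ln r * \<sigma> * (\<Sum>k\<in>K - I. (cmod (a k))\<^sup>2)" for a
        using J(2) unfolding bad2_def by (simp add: not_less)
      have U0: "222 * r * ln r * \<sigma> \<ge> 0" using r3 L1 \<sigma>0 unfolding L_def by simp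
      have wd: "least_squares_well_defined I P (?y J)"
        by (rule least_squares_stability(1)[OF finI \<Lambda>0 frame'])
      define B where "B = 17761 * C * (b / (b - 1)) ^ 3 * ln (real (card I)) *
              (real (card I) powr (- 2 * s) * ln (real (card I)) powr ((real CARD('d) - 1) * 2 * s)
               + real (card K) powr (- 2 * s + 1) * ln (real (card K)) powr (2 * (real CARD('d) - 1) * s))"
      have final: "\<sigma> + (2 * (222 * r * ln r * \<sigma>) + 2 * real (card {1..n}) * \<tau>) / \<Lambda> \<le> B"
      proof -
        define q where "q = 1 / (b' - 1)\<^sup>2"
        have q1: "q \<ge> 1"
        proof -
          have "(b' - 1)\<^sup>2 \<le> 1" using b' by (simp add: power_le_one)
          then show ?thesis using b' by (simp add: q_def)
        qed
        have "2 * real n * \<tau> \<le> 2 * (73 * r * L) * \<tau>"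
          using n_up \<tau>0 unfolding L_def by (intro mult_right_mono) auto
        then have "(2 * (222 * r * ln r * \<sigma>) + 2 * real n * \<tau>) / \<Lambda> \<le> (r * L * (444 * \<sigma> + 146 * \<tau>)) / \<Lambda>"
          using \<Lambda>0 unfolding L_def by (intro divide_right_mono) (auto simp: algebra_simps)
        also have "\<dots> = 40 * q * L * (444 * \<sigma> + 146 * \<tau>)"
          using r3 b' by (simp add: \<Lambda>_def q_def r_def[symmetric] field_simps)
        also have "\<dots> \<le> 40 * q * L * (444 * (\<sigma> + \<tau>))"
          using q1 L1 \<tau>0 by (intro mult_left_mono) auto
        finally have 1: "(2 * (222 * r * ln r * \<sigma>) + 2 * real n * \<tau>) / \<Lambda> \<le> 17760 * (q * L * (\<sigma> + \<tau>))"
          by (simp add: mult_ac)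
        have "1 * 1 \<le> q * L" using q1 L1 by (intro mult_mono) auto
        then have "1 * (\<sigma> + \<tau>) \<le> q * L * (\<sigma> + \<tau>)" using \<sigma>0 \<tau>0 by (intro mult_right_mono) auto
        moreover have "\<sigma> \<le> 1 * (\<sigma> + \<tau>)" using \<tau>0 by simp
        ultimately have "\<sigma> \<le> q * L * (\<sigma> + \<tau>)" by (rule order_trans[rotated])
        from add_mono[OF this 1]
        have "\<sigma> + (2 * (222 * r * ln r * \<sigma>) + 2 * real n * \<tau>) / \<Lambda> \<le> q * L * (\<sigma> + \<tau>) + 17760 * (q * L * (\<sigma> + \<tau>))" .
        also have "\<dots> = 17761 * (q * L * (\<sigma> + \<tau>))" by simp
        also have "\<dots> \<le> 17761 * ((b / (b - 1)) ^ 3 * L * (\<sigma> + \<tau>))"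
          using oversampling_factor[OF b1] L1 \<sigma>0 \<tau>0 unfolding q_def b'_def
          by (intro mult_left_mono mult_right_mono) auto
        also have "\<dots> = B"
          unfolding B_def \<sigma>_def \<tau>_def L_def r_def by (simp add: algebra_simps)
        finally show ?thesis by simp
      qed
      have "ereal ((L2_torus_norm (\<lambda>x. f x - least_squares I P (?y J) f x))\<^sup>2) \<le> ereal B"
        if f: "f \<in> {f \<in> Hmix s. Hmix_norm s f \<le> 1}" for f
      proof -
        have "(L2_torus_norm (\<lambda>x. f x - least_squares I P (?y J) f x))\<^sup>2
            \<le> \<sigma> + (2 * (222 * r * ln r * \<sigma>) + 2 * real (card {1..n}) * \<tau>) / \<Lambda>"
          using f by (intro least_squares_error_bound[OF assms(1) _ _ finK IK finite_atLeastAtMost P(1) \<sigma> less_imp_le[OF \<sigma>0] \<tau> \<Lambda>0 frame' up U0]) auto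
        then show ?thesis using final by simp
      qed
      then have "(SUP f\<in>{f \<in> Hmix s. Hmix_norm s f \<le> 1}.
            ereal ((L2_torus_norm (\<lambda>x. f x - least_squares I P (?y J) f x))\<^sup>2)) \<le> ereal B"
        by (rule SUP_least)
      moreover have "int (card P) \<le> \<lceil>b * real (card I)\<rceil>"
      proof -
        have "b' * real (card I) \<le> b * real (card I)" using b' by (intro mult_right_mono) auto
        then show ?thesis using P(2) ceiling_mono order_trans by blast
      qed
      ultimately show ?thesis using P(1) wd unfolding B_def by blast
    qed
    have "1 - 4 / real (card I) \<le> 1 - (1 / r + 1 / r)" using r3 by (simp add: r_def field_simps)
    also have "\<dots> \<le> 1 - (measure_pmf.prob ?Q bad1 + measure_pmf.prob ?Q bad2)" using p1 p2 by linarith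
    also have "\<dots> \<le> 1 - measure_pmf.prob ?Q (bad1 \<union> bad2)"
      using measure_Un_le[of bad1 "measure_pmf ?Q" bad2] by simp
    also have "\<dots> = measure_pmf.prob ?Q (- (bad1 \<union> bad2))"
      using measure_pmf.prob_compl[of "bad1 \<union> bad2" ?Q] by (simp add: Compl_eq_Diff_UNIV)
    also have "\<dots> \<le> measure_pmf.prob ?Q ?good"
      by (rule measure_pmf.finite_measure_mono) (use good in auto)
    finally show "1 - 4 / real (card I) \<le> measure_pmf.prob ?Q ?good" .
  qed
qed

end
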